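(* A digraph $\Gamma$ is a primitive weakly distance-regular circulant digraph if and only if $\Gamma$ is isomorphic to one of the following: (i) the Paley digraph of order $p$, where $p$ is a prime with $p\equiv 3\pmod 4$; (ii) the directed circuit of length $p$, where $p$ is a prime; (iii) $\mathrm{Cay}(\mathbb{Z}_{13},\{1,3,9\})$.
   Context: Digraphs are finite, simple, and not undirected. For vertices $x,y$, $\partial(x,y)$ is the (directed) distance from $x$ to $y$ and $\tilde\partial(x,y)=(\partial(x,y),\partial(y,x))$. A strongly connected digraph $\Gamma$ is weakly distance-regular if $\mathfrak{X}(\Gamma)=(V\Gamma,\{\Gamma_{\tilde i}\}_{\tilde i\in\tilde\partial(\Gamma)})$ is an association scheme, where $\tilde\partial(\Gamma)=\{\tilde\partial(x,y)\mid x,y\in V\Gamma\}$ and $\Gamma_{\tilde i}=\{(x,y)\mid\tilde\partial(x,y)=\tilde i\}$; $\Gamma$ is primitive if this scheme is primitive, i.e. every non-diagonal relation generates the scheme (a relation generates if the smallest set $F$ of relations containing it with $R_{i^*}R_j\subseteq F$ for all $R_i,R_j\in F$ is the set of all relations, where $R_iR_j$ is the set of relations $R_l$ with nonzero intersection number $p^l_{i,j}$). For a group $H$ and a generating set $S\subseteq H\setminus\{e\}$ containing some $s$ with $s^{-1}\notin S$, the Cayley digraph $\mathrm{Cay}(H,S)$ has vertex set $H$ and arcs $x\to y$ whenever $yx^{-1}\in S$; a circulant digraph is one isomorphic to a Cayley digraph of a cyclic group. For a prime power $q\equiv 3\pmod 4$ with primitive element $\alpha$, the Paley digraph of order $q$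 has vertex set $\mathrm{GF}(q)$ and arcs $(x,y)$ with $x-y\in\alpha\langle\alpha^2\rangle$. *)

theory Defs
  imports
    "HOL-Library.Disjoint_Sets"
    "HOL-Algebra.Elementary_Groups"
    "HOL-Algebra.Multiplicative_Group"
    "HOL-Number_Theory.Residues"
    "Graph_Theory.Graph_Theory"
begin

definition path_set :: "'a set \<Rightarrow> ('i \<Rightarrow> 'a rel) \<Rightarrow> 'i \<Rightarrow> 'i \<Rightarrow> 'a \<Rightarrow> 'a \<Rightarrow> 'a set" where
  "path_set X R i j x y = {z \<in> X. (x, z) \<in> R i \<and> (z, y) \<in> R j}"

text \<open>Commutativity of the scheme is not part of the definition.\<close>

definition association_scheme :: "'a set \<Rightarrow> 'i set \<Rightarrow> ('i \<Rightarrow> 'a rel) \<Rightarrow> bool" where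
  "association_scheme X I R \<longleftrightarrow>
     finite X \<and> X \<noteq> {} \<and> inj_on R I \<and> partition_on (X \<times> X) (R ` I) \<and>
     (\<exists>i\<in>I. R i = Id_on X) \<and>
     (\<forall>i\<in>I. \<exists>j\<in>I. R j = (R i)\<inverse>) \<and>
     (\<forall>i\<in>I. \<forall>j\<in>I. \<forall>l\<in>I. \<exists>p::nat. \<forall>(x, y)\<in>R l. card (path_set X R i j x y) = p)"

text \<open>The next three notions are meaningful when \<^term>\<open>association_scheme X I R\<close> holds
  and the indices lie in \<^term>\<open>I\<close>; the definite descriptions are then unique.\<close>

definition intersection_number ::
    "'a set \<Rightarrow> ('i \<Rightarrow> 'a rel) \<Rightarrow> 'i \<Rightarrow> 'i \<Rightarrow> 'i \<Rightarrow> nat" where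
  "intersection_number X R i j l =
     (THE p. \<forall>(x, y)\<in>R l. card (path_set X R i j x y) = p)"

definition transpose_index :: "'i set \<Rightarrow> ('i \<Rightarrow> 'a rel) \<Rightarrow> 'i \<Rightarrow> 'i" where
  "transpose_index I R i = (THE j. j \<in> I \<and> R j = (R i)\<inverse>)"

definition complex_product ::
    "'a set \<Rightarrow> 'i set \<Rightarrow> ('i \<Rightarrow> 'a rel) \<Rightarrow> 'i \<Rightarrow> 'i \<Rightarrow> 'i set" where
  "complex_product X I R i j = {l \<in> I. intersection_number X R i j l \<noteq> 0}"

definition closed_subset :: "'a set \<Rightarrow> 'i set \<Rightarrow> ('i \<Rightarrow> 'a rel) \<Rightarrow> 'i set \<Rightarrow> bool" where
  "closed_subset X I R F \<longleftrightarrow>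
     F \<subseteq> I \<and> (\<forall>i\<in>F. \<forall>j\<in>F. complex_product X I R (transpose_index I R i) j \<subseteq> F)"

definition closed_span :: "'a set \<Rightarrow> 'i set \<Rightarrow> ('i \<Rightarrow> 'a rel) \<Rightarrow> 'i \<Rightarrow> 'i set" where
  "closed_span X I R i = \<Inter>{F. closed_subset X I R F \<and> i \<in> F}"

definition primitive_scheme :: "'a set \<Rightarrow> 'i set \<Rightarrow> ('i \<Rightarrow> 'a rel) \<Rightarrow> bool" where
  "primitive_scheme X I R \<longleftrightarrow>
     association_scheme X I R \<and> (\<forall>i\<in>I. R i \<noteq> Id_on X \<longrightarrow> closed_span X I R i = I)"

text \<open>Directed distance: the least length of a directed walk, obtained from the weighted
  distance of the library by giving every arc weight one.\<close>

definition ddist :: "('a, 'b) pre_digraph \<Rightarrow> 'a \<Rightarrow> 'a \<Rightarrow> ereal" where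
  "ddist G x y = wf_digraph.\<mu> G (\<lambda>_. 1) x y"

definition two_way_dist :: "('a, 'b) pre_digraph \<Rightarrow> 'a \<Rightarrow> 'a \<Rightarrow> ereal \<times> ereal" where
  "two_way_dist G x y = (ddist G x y, ddist G y x)"

definition two_way_dists :: "('a, 'b) pre_digraph \<Rightarrow> (ereal \<times> ereal) set" where
  "two_way_dists G = {two_way_dist G x y | x y. x \<in> verts G \<and> y \<in> verts G}"

definition dist_relation :: "('a, 'b) pre_digraph \<Rightarrow> ereal \<times> ereal \<Rightarrow> 'a rel" where
  "dist_relation G i = {(x, y) \<in> verts G \<times> verts G. two_way_dist G x y = i}"

definition weakly_distance_regular :: "('a, 'b) pre_digraph \<Rightarrow> bool" where
  "weakly_distance_regular G \<longleftrightarrow>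
     strongly_connected G \<and> association_scheme (verts G) (two_way_dists G) (dist_relation G)"

definition primitive_digraph :: "('a, 'b) pre_digraph \<Rightarrow> bool" where
  "primitive_digraph G \<longleftrightarrow> primitive_scheme (verts G) (two_way_dists G) (dist_relation G)"

definition cayley_digraph :: "('g, 'm) monoid_scheme \<Rightarrow> 'g set \<Rightarrow> 'g pair_pre_digraph" where
  "cayley_digraph H S =
     \<lparr>pverts = carrier H,
      parcs = {(x, y) \<in> carrier H \<times> carrier H. y \<otimes>\<^bsub>H\<^esub> inv\<^bsub>H\<^esub> x \<in> S}\<rparr>"

definition cayley_connection_set :: "('g, 'm) monoid_scheme \<Rightarrow> 'g set \<Rightarrow> bool" where
  "cayley_connection_set H S \<longleftrightarrow>
     S \<subseteq> carrier H - {\<one>\<^bsub>H\<^esub>} \<and> generate H S = carrier H \<and> (\<exists>s\<in>S. inv\<^bsub>H\<^esub> s \<notin> S)"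

text \<open>The cyclic group is quantified over groups with carrier in \<^typ>\<open>int\<close>. Nothing is lost,
  since every cyclic group is isomorphic to such a group.\<close>

definition circulant :: "('a, 'b) pre_digraph \<Rightarrow> bool" where
  "circulant G \<longleftrightarrow>
     (\<exists>(H :: int monoid) S. group H \<and> cyclic_group H \<and> cayley_connection_set H S \<and>
        digraph_iso G (with_proj (cayley_digraph H S)))"

definition directed_circuit :: "nat \<Rightarrow> nat pair_pre_digraph" where
  "directed_circuit n = \<lparr>pverts = {..<n}, parcs = {(i, (i + 1) mod n) | i. i < n}\<rparr>"

definition primitive_element :: "('f, 'm) ring_scheme \<Rightarrow> 'f \<Rightarrow> bool" where
  "primitive_element F \<alpha> \<longleftrightarrow>
     \<alpha> \<in> carrier (mult_of F) \<and> generate (mult_of F) {\<alpha>} = carrier (mult_of F)"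

text \<open>Intended for a finite field \<^term>\<open>F\<close> whose order is congruent to 3 modulo 4 and a primitive
  element \<^term>\<open>\<alpha>\<close>.\<close>

definition paley_digraph :: "('f, 'm) ring_scheme \<Rightarrow> 'f \<Rightarrow> 'f pair_pre_digraph" where
  "paley_digraph F \<alpha> =
     \<lparr>pverts = carrier F,
      parcs = {(x, y) \<in> carrier F \<times> carrier F.
        x \<ominus>\<^bsub>F\<^esub> y \<in> \<alpha> <#\<^bsub>mult_of F\<^esub> generate (mult_of F) {\<alpha> [^]\<^bsub>mult_of F\<^esub> (2::nat)}}\<rparr>"

end

(*
A circulant digraph of order n is described by the function a(z), the distance from 0 to z in Z_n,
and its two-way distance classes by x ~ y iff a(x) = a(y) and a(-x) = a(-y). Schur's argument with
q-th powers in the group ring modulo a prime q shows first that a primitive scheme with two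
different non-diagonal classes forces n to be prime, and then that ~ is invariant under
multiplication, so that for n = p prime the classes of non-zero elements are the cosets of a group
K of units.

By scaling, every coset contained in the connection set has the same girth, and therefore the
connection set is a single coset, without loss of generality K. Let g = a(-1) + 1 be the girth.
For g = 4 two consecutive steps of a shortest circuit give a self-paired class. For g >= 5 the
steps that can follow 1 on a shortest circuit form a group U, since (1 + u)(1 + v) expands to the
sum of four consecutive steps; U is closed under u -> (1 + u)/2, hence under arithmetic
progressions, so it is trivial and so is K. For g = 3, sums and differences of two elements of K
lie in 0, K, -K and C, -C for one further class C. If there is no C, K has index 2 (Paley).
Otherwise the identity 1 - u^2 = (1 - u)(1 + u) and counting the solutions of 1 + u = v + w in K
give |K| = 3, and then p divides 7 * 13.
*)
theory Submission
  imports Defs "HOL-Computational_Algebra.Polynomial"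
begin

text \<open>The rigidity comes from multiplication permuting the classes: as the class of some step
  is not self-paired, no nonzero class is, so \<open>a x\<close> and \<open>a (- x)\<close> always
  differ. For girth 3 the triangle inequality then leaves very few pairs of distances for sums and
  differences of two steps, and equal pairs mean equal cosets of K. The obstacle is that nothing
  bounds the index of K. Only sums and differences of two elements of K are under control; a product
  of two elements of C may lie in an unknown class. This forces a split on c^2, for c in C. It is
  never in K, all of whose elements are squares of elements of K. If it is not in - K either, it
  lies outside all known classes, and this leaves 2 as the only possible element of C of the form 1
  + u with u in K. If it lies in - K, the known classes turn out to be all classes. Either way the
  numbers of representations satisfy linear relations that alone do not determine |K|. The solutions
  of 1 + u = v + w, counted in two ways, supply the missing quadratic equation.\<close>

section \<open>Inverses and multiplication modulo \<open>n\<close>\<close>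

lemma prime_inverse_mod:
  fixes n x :: int
  assumes "prime n" "\<not> n dvd x" obtains y where "[x * y = 1] (mod n)"
proof -
  have "coprime x n" using assms by (metis coprime_commute prime_imp_coprime)
  then show ?thesis using that cong_solve_coprime_int by blast
qed

lemma fermat_int:
  fixes n x :: int
  assumes "prime n" "\<not> n dvd x" shows "[x ^ (nat n - 1) = 1] (mod n)"
proof -
  have "residues n" using prime_gt_1_int[OF assms(1)] by (simp add: residues_def)
  moreover have "coprime x n" using assms by (metis coprime_commute prime_imp_coprime)
  moreover have "totient (nat n) = nat n - 1" using assms(1) by (simp add: totient_prime)
  ultimately show ?thesis using residues.euler_theorem by metis
qed

lemma bij_betw_mult_mod:
  fixes n t r :: int
  assumes r: "[t * r = 1] (mod n)" and n: "n > 0"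
  shows "bij_betw (\<lambda>x. t * x mod n) {0..<n} {0..<n}"
proof (rule bij_betwI[of _ _ _ "\<lambda>x. r * x mod n"])
  have 1: "(t * (r * x mod n)) mod n = x mod n" "(r * (t * x mod n)) mod n = x mod n" for x
  proof -
    have "[t * r * x = 1 * x] (mod n)" using r by (rule cong_scalar_right)
    then show "(t * (r * x mod n)) mod n = x mod n" "(r * (t * x mod n)) mod n = x mod n"
      unfolding mod_mult_right_eq by (simp_all add: cong_def algebra_simps)
  qed
  show "(r * (t * x mod n)) mod n = x" if "x \<in> {0..<n}" for x using that unfolding 1 by simp
  show "(t * (r * x mod n)) mod n = x" if "x \<in> {0..<n}" for x using that unfolding 1 by simp
qed (use n in auto)

subsection \<open>Distance functions on cyclic groups\<close>

text \<open>The last assumption cuts one step off a shortest walk. The connection set does not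
  occur: it is recovered as the set of \<open>s\<close> with \<open>a s = 1\<close>.\<close>

locale circulant_distance =
  fixes n :: int and a :: "int \<Rightarrow> nat"
  assumes n_pos: "n > 0"
    and dist_cong: "[x = y] (mod n) \<Longrightarrow> a x = a y"
    and dist_0_iff: "a x = 0 \<longleftrightarrow> n dvd x"
    and dist_triangle: "a (x + y) \<le> a x + a y"
    and dist_step: "a x = Suc d \<Longrightarrow> \<exists>s. a s = 1 \<and> a (x - s) = d"
begin

definition eqv :: "int \<Rightarrow> int \<Rightarrow> bool" (infix \<open>\<simeq>\<close> 50) where
  "x \<simeq> y \<longleftrightarrow> a x = a y \<and> a (- x) = a (- y)"

lemma eqv_refl [simp]: "x \<simeq> x" and eqv_sym: "x \<simeq> y \<Longrightarrow> y \<simeq> x"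
  and eqv_trans [trans]: "x \<simeq> y \<Longrightarrow> y \<simeq> z \<Longrightarrow> x \<simeq> z"
  and eqv_uminus: "x \<simeq> y \<Longrightarrow> - x \<simeq> - y"
  by (auto simp: eqv_def)

lemma eqv_cong: "[x = y] (mod n) \<Longrightarrow> x \<simeq> y"
  by (simp add: eqv_def dist_cong cong_minus_minus_iff)

lemma eqv_0_iff: "x \<simeq> 0 \<longleftrightarrow> n dvd x"
  using dist_0_iff[of 0] dist_0_iff[of x] dist_0_iff[of "-x"] by (auto simp: eqv_def)

lemma eqv_dvd_iff: "x \<simeq> y \<Longrightarrow> n dvd x \<longleftrightarrow> n dvd y"
  by (metis eqv_def dist_0_iff)

end

text \<open>Invariance under multiplication is the outcome of the group ring argument
  (\<open>eqv_mult_of_prime\<close>). It is assumed here so that the analysis of distances stays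
  independent of that argument.\<close>

locale prime_circulant = circulant_distance +
  assumes prime_n: "prime n"
    and eqv_mult: "x \<simeq> y \<Longrightarrow> t * x \<simeq> t * y"
    and asymmetric: "\<exists>s. a s = 1 \<and> a (- s) \<noteq> 1"
begin

lemma inverse_mod:
  assumes "\<not> n dvd x" obtains y where "[x * y = 1] (mod n)"
  using prime_inverse_mod prime_n assms that by blast

text \<open>Multiplication by \<open>s * y\<close>, where \<open>y\<close> inverts \<open>x\<close>,
  takes \<open>x\<close> to \<open>s\<close> and \<open>- x\<close> to \<open>- s\<close>. A
  self-paired class would therefore make the class of \<open>s\<close> self-paired, against
  \<open>asymmetric\<close>.\<close>

lemma dist_uminus_neq:
  assumes "\<not> n dvd x" shows "a x \<noteq> a (- x)"
proof
  assume "a x = a (- x)"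
  then have x: "x \<simeq> - x" by (simp add: eqv_def)
  obtain s where s: "a s = 1" "a (- s) \<noteq> 1" using asymmetric by blast
  obtain y where y: "[x * y = 1] (mod n)" using inverse_mod[OF assms] .
  have "[s * y * x = s] (mod n)" "[s * y * (- x) = - s] (mod n)"
    using cong_scalar_left[OF y, of s] cong_scalar_left[OF y, of "-s"]
    by (simp_all add: algebra_simps)
  with eqv_mult[OF x, of "s * y"] have "s \<simeq> - s"
    by (meson eqv_cong eqv_sym eqv_trans)
  with s show False by (simp add: eqv_def)
qed

lemma eqv_mult2: "x \<simeq> y \<Longrightarrow> z \<simeq> w \<Longrightarrow> x * z \<simeq> y * w"
  by (metis eqv_mult eqv_trans mult.commute)

lemma eqv_mult_cancel:
  assumes "t * x \<simeq> t * y" "\<not> n dvd t" shows "x \<simeq> y"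
proof -
  obtain r where r: "[t * r = 1] (mod n)" using inverse_mod assms(2) by blast
  have *: "[r * (t * z) = z] (mod n)" for z
    using cong_scalar_left[OF r, of z] by (simp add: algebra_simps)
  show ?thesis using eqv_mult[OF assms(1), of r] *[of x] *[of y]
    by (meson eqv_cong eqv_sym eqv_trans)
qed

lemma dvd_mult_iff: "n dvd x * y \<longleftrightarrow> n dvd x \<or> n dvd y"
  using prime_n by (simp add: prime_dvd_mult_iff)

lemma not_dvd_1: "\<not> n dvd 1"
  using prime_n by auto

end

section \<open>Normalisation: girth and the class of the steps\<close>

text \<open>A step with the shortest way back has been scaled to 1 (this is done in
  \<open>connection_set_classification\<close>), so that \<open>a (- 1) + 1\<close> is the
  girth.\<close>

locale normalized_circulant = prime_circulant +
  assumes dist_1: "a 1 = 1"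
    and dist_minus_one_le: "a s = 1 \<Longrightarrow> a (- 1) \<le> a (- s)"
begin

lemma dist_one_not_dvd: "a x = 1 \<Longrightarrow> \<not> n dvd x"
  by (metis dist_0_iff zero_neq_one)

text \<open>A shortest walk to \<open>x\<close> and one back form a closed walk. Without its first
  step \<open>s\<close> it is a walk from \<open>s\<close> back to 0, of length at least
  \<open>a (- s)\<close>, hence at least \<open>a (- 1)\<close>.\<close>

lemma girth:
  assumes "\<not> n dvd x" shows "a (- 1) + 1 \<le> a x + a (- x)"
proof -
  obtain d where d: "a x = Suc d" using assms by (metis dist_0_iff not0_implies_Suc)
  then obtain s where s: "a s = 1" "a (x - s) = d" using dist_step by blast
  have "a (- s) \<le> a (- x) + a (x - s)" using dist_triangle[of "-x" "x - s"] by simp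
  with dist_minus_one_le[OF s(1)] s d show ?thesis by simp
qed

lemma dist_minus_one_gt_1: "a (- 1) > 1"
proof -
  have "a (-1) \<noteq> 0" using not_dvd_1 by (simp add: dist_0_iff)
  moreover have "a (-1) \<noteq> 1" using dist_uminus_neq[OF not_dvd_1] dist_1 by simp
  ultimately show ?thesis by linarith
qed

text \<open>The last hypothesis says that \<open>x\<close> lies on a shortest circuit. Every step
  \<open>k\<close> of such a circuit has \<open>a (- k) = a (- 1)\<close>, so
  \<open>k \<simeq> 1\<close> and \<open>s * k \<simeq> s\<close> is a step again: multiplication by
  \<open>s\<close> maps the walk step by step.\<close>

lemma dist_scale_le:
  assumes "a s = 1" "a x = d" "a x + a (- x) \<le> a (- 1) + 1"
  shows "a (s * x) \<le> d"
  using assms(2,3)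
proof (induction d arbitrary: x)
  case 0
  then have "n dvd s * x" by (simp add: dist_0_iff)
  then show ?case by (simp add: dist_0_iff[symmetric])
next
  case (Suc d)
  obtain k where k: "a k = 1" "a (x - k) = d" using dist_step Suc.prems by blast
  have "a (- k) \<le> a (- x) + a (x - k)" using dist_triangle[of "-x" "x - k"] by simp
  with Suc.prems k dist_minus_one_le[OF k(1)] have "k \<simeq> 1"
    by (simp add: eqv_def dist_1)
  then have "s * k \<simeq> s" using eqv_mult[of k 1 s] by simp
  then have "a (s * k) = 1" using assms(1) by (simp add: eqv_def)
  moreover have "a (- (x - k)) \<le> a k + a (- x)" using dist_triangle[of k "-x"] by simp
  then have "a (s * (x - k)) \<le> d" using Suc k by simp
  moreover have "a (s * x) \<le> a (s * k) + a (s * (x - k))"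
    using dist_triangle[of "s * k" "s * (x - k)"] by (simp add: algebra_simps)
  ultimately show ?case by simp
qed

text \<open>Scaling the way back from 1 gives \<open>a (- s) \<le> a (- 1)\<close>, and the choice
  of the step 1 gives the reverse inequality. Thus all steps form one class.\<close>

lemma dist_eq_1_iff: "a s = 1 \<longleftrightarrow> s \<simeq> 1"
proof
  assume s: "a s = 1"
  have "a (s * (- 1)) \<le> a (- 1)" by (rule dist_scale_le[OF s refl]) (simp add: dist_1)
  with dist_minus_one_le[OF s] show "s \<simeq> 1" by (simp add: eqv_def s dist_1)
qed (simp add: eqv_def dist_1)

lemma eqv_1_mult: "u \<simeq> 1 \<Longrightarrow> u * x \<simeq> x"
  using eqv_mult2[of u 1 x x] by simp

lemma eqv_1_inverse:
  assumes "u \<simeq> 1" obtains v where "v \<simeq> 1" "[u * v = 1] (mod n)"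
proof -
  have "\<not> n dvd u" using assms eqv_dvd_iff not_dvd_1 by blast
  then obtain v where v: "[u * v = 1] (mod n)" using inverse_mod by blast
  have "v \<simeq> u * v" using eqv_1_mult[OF assms] eqv_sym by blast
  with v that eqv_cong eqv_trans show ?thesis by blast
qed

text \<open>In other words, the classes of nonzero residues are cosets of the group K of all
  \<open>u \<simeq> 1\<close>.\<close>

lemma eqv_ratio:
  assumes "x \<simeq> y" "\<not> n dvd x" obtains w where "w \<simeq> 1" "[y = x * w] (mod n)"
proof -
  obtain r where r: "[x * r = 1] (mod n)" using inverse_mod assms(2) by blast
  have "[y = x * (r * y)] (mod n)"
    using cong_scalar_right[OF r, of y] by (simp add: algebra_simps cong_sym_eq)
  moreover have "r * y \<simeq> r * x" using assms(1) eqv_mult eqv_sym by blast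
  then have "r * y \<simeq> 1" using r by (metis eqv_cong eqv_trans mult.commute)
  ultimately show ?thesis using that by blast
qed

lemma dist_minus_one_neq_3: "a (- 1) \<noteq> 3"
proof
  assume b: "a (- 1) = 3"
  then obtain k where k: "a k = 1" "a (- 1 - k) = 2" using dist_step[of "-1" 2] by auto
  have nd: "\<not> n dvd 1 + k"
    using k(2) dist_0_iff[of "-1-k"] by (metis dvd_minus_iff minus_add_distrib uminus_add_conv_diff add.commute zero_neq_numeral)
  have "a (1 + k) \<le> 2" using dist_triangle[of 1 k] k dist_1 by simp
  moreover have "- (1 + k) = - 1 - k" by simp
  then have "4 \<le> a (1 + k) + 2" using girth[OF nd] b k by simp
  ultimately show False using dist_uminus_neq[OF nd] k by simp
qed

lemma dist_stepE:
  assumes "a x = d" "d > 0" obtains s where "a s = 1" "a (x - s) = d - 1"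
proof -
  have "a x = Suc (d - 1)" using assms by simp
  from dist_step[OF this] that show ?thesis by blast
qed

section \<open>Starts of shortest circuits, and girth at least five\<close>

text \<open>The way out has length at most 2 and the way back at most \<open>a (- 1) - 1\<close>; by
  \<open>girth\<close> both bounds are attained. All sums of two steps that start a shortest circuit
  therefore lie in a single class.\<close>

lemma minimal_type_2:
  assumes "a x = 1" "a y = 1" "a (- (x + y)) \<le> a (- 1) - 1"
  shows "\<not> n dvd x + y" "a (x + y) = 2" "a (- (x + y)) = a (- 1) - 1"
proof -
  show nd: "\<not> n dvd x + y"
  proof
    assume "n dvd x + y"
    then have "[y = - x] (mod n)" by (simp add: cong_iff_dvd_diff add.commute)
    then have "a (- x) = 1" using assms dist_cong by metis
    then show False using dist_minus_one_le[OF assms(1)] dist_minus_one_gt_1 by simp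
  qed
  have "a (x + y) \<le> 2" using dist_triangle[of x y] assms by simp
  then show "a (x + y) = 2" "a (- (x + y)) = a (- 1) - 1"
    using girth[OF nd] assms(3) dist_minus_one_gt_1 by linarith+
qed

text \<open>\<open>neighbour u\<close>: a shortest closed walk can start with the steps \<open>1, u\<close>.\<close>
definition neighbour :: "int \<Rightarrow> bool" where
  "neighbour u \<longleftrightarrow> a u = 1 \<and> a (- (1 + u)) \<le> a (- 1) - 1"

lemma neighbour_eqv_1: "neighbour u \<Longrightarrow> u \<simeq> 1"
  unfolding neighbour_def by (rule iffD1[OF dist_eq_1_iff]) (rule conjunct1)

lemma neighbour_cong: "[u = v] (mod n) \<Longrightarrow> neighbour u \<Longrightarrow> neighbour v"
  unfolding neighbour_def
  by (metis cong_add_lcancel cong_minus_minus_iff dist_cong)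

lemma neighbour_type:
  assumes "neighbour u" "neighbour v" shows "1 + u \<simeq> 1 + v" "\<not> n dvd 1 + u"
  using minimal_type_2[of 1 u] minimal_type_2[of 1 v] assms dist_1
  by (auto simp: neighbour_def eqv_def)

lemma dist_unit_mult: "u \<simeq> 1 \<Longrightarrow> a (u * x) = a x" and dist_unit_mult_uminus: "u \<simeq> 1 \<Longrightarrow> a (- (u * x)) = a (- x)"
  using eqv_1_mult[of u x] by (auto simp: eqv_def)

text \<open>Steps commute, so a circuit that starts with \<open>1, u\<close> may as well start with
  \<open>u, 1\<close>. Division by \<open>u\<close> preserves distances and turns this into
  \<open>1, v\<close>.\<close>

lemma neighbour_inverse:
  assumes "neighbour u" "[u * v = 1] (mod n)" shows "neighbour v"
proof -
  have u: "u \<simeq> 1" using assms(1) by (rule neighbour_eqv_1)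
  have "u * v \<simeq> v" using eqv_1_mult u by blast
  then have v: "v \<simeq> 1" using assms(2) eqv_cong eqv_sym eqv_trans by blast
  have "[- (u * (1 + v)) = - (1 + u)] (mod n)"
    using assms(2) by (simp add: algebra_simps cong_iff_dvd_diff dvd_diff_commute)
  then have "a (- (1 + v)) = a (- (1 + u))"
    using dist_cong dist_unit_mult_uminus[OF u] by metis
  moreover have "a v = 1" using v dist_eq_1_iff by blast
  ultimately show ?thesis using assms(1) by (simp add: neighbour_def)
qed

text \<open>In a closed walk of minimal length with steps \<open>1, u, v, w, \<dots>\<close>, any two steps may be
  taken first.\<close>
lemma four_steps:
  assumes "a u = 1" "a v = 1" "a w = 1" "a (- (1 + u + v + w)) \<le> a (- 1) - 3" "3 \<le> a (- 1)"
  shows "neighbour u" "neighbour v" "neighbour w"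
proof -
  have *: "a (- (1 + x)) \<le> a (- 1) - 1"
    if "a x = 1" "a y = 1" "a z = 1" "a (- (1 + x + y + z)) \<le> a (- 1) - 3" for x y z
  proof -
    have "a (- (1 + x)) \<le> a (y + z) + a (- (1 + x + y + z))"
      using dist_triangle[of "y + z" "- (1 + x + y + z)"] by (simp add: algebra_simps)
    moreover have "a (y + z) \<le> 2" using dist_triangle[of y z] that by simp
    ultimately show ?thesis using that(4) assms(5) by linarith
  qed
  show "neighbour u" using *[of u v w] assms by (simp add: neighbour_def)
  show "neighbour v" using *[of v u w] assms by (simp add: neighbour_def algebra_simps)
  show "neighbour w" using *[of w u v] assms by (simp add: neighbour_def algebra_simps)
qed

text \<open>Pair the first four steps of a shortest circuit as \<open>x = 1 + k2\<close> and
  \<open>y = k3 + k4\<close>. Both sums lie in the same class, so \<open>y = x * w\<close> with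
  \<open>w \<simeq> 1\<close>, and the four steps add up to \<open>x * (1 + w)\<close>. Either
  factor may be replaced by an equivalent one without leaving the class, and the new product expands
  to four steps that again start a shortest circuit.\<close>

lemma neighbour_mult:
  assumes b: "4 \<le> a (- 1)" and u: "neighbour u" and v: "neighbour v"
  shows "neighbour (u * v)"
proof -
  obtain k2 where k2: "a k2 = 1" "a (- 1 - k2) = a (-1) - 1"
    using dist_stepE[of "-1", OF refl] b by auto
  obtain k3 where k3: "a k3 = 1" "a (- 1 - k2 - k3) = a (-1) - 1 - 1"
    by (rule dist_stepE[OF k2(2)]) (use b in simp)
  obtain k4 where k4: "a k4 = 1" "a (- 1 - k2 - k3 - k4) = a (-1) - 1 - 1 - 1"
    by (rule dist_stepE[OF k3(2)]) (use b in simp)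
  define x y where "x = 1 + k2" and "y = k3 + k4"
  have nk2: "neighbour k2"
    using four_steps[of k2 k3 k4] k2 k3 k4 b by (simp add: algebra_simps)
  have "a (- y) \<le> a x + a (- (x + y))"
    using dist_triangle[of x "- (x + y)"] by (simp add: x_def y_def)
  moreover have "a x \<le> 2" using dist_triangle[of 1 k2] k2 dist_1 by (simp add: x_def)
  moreover have xy: "a (- (x + y)) = a (-1) - 3" using k4(2) by (simp add: x_def y_def algebra_simps)
  ultimately have "a (- y) \<le> a (-1) - 1" using b by linarith
  then have y: "a y = 2" "a (- y) = a (-1) - 1"
    using minimal_type_2[of k3 k4] k3 k4 by (simp_all add: y_def)
  have x: "a x = 2" "a (- x) = a (-1) - 1" "\<not> n dvd x"
    using minimal_type_2[of 1 k2] nk2 k2 dist_1 by (simp_all add: x_def neighbour_def)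
  have "x \<simeq> y" using x y by (simp add: eqv_def)
  then obtain w where w: "w \<simeq> 1" "[y = x * w] (mod n)" using eqv_ratio x(3) by blast
  have ux: "1 + u' \<simeq> x" if "neighbour u'" for u'
    using neighbour_type(1)[OF that nk2] by (simp add: x_def)
  have key: "neighbour w'" "neighbour (u' * w')"
    if u': "neighbour u'" and w': "w' \<simeq> 1" and ww: "1 + w' \<simeq> 1 + w" for u' w'
  proof -
    have "(1 + u') * (1 + w') \<simeq> x * (1 + w)" using eqv_mult2 ux[OF u'] ww by blast
    also have "x * (1 + w) \<simeq> x + y"
      unfolding distrib_left mult_1_right
      by (intro eqv_cong cong_add cong_refl cong_sym[OF w(2)])
    finally have "a (- ((1 + u') * (1 + w'))) = a (-1) - 3" using xy by (simp add: eqv_def)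
    then have *: "a (- (1 + u' + w' + u' * w')) \<le> a (-1) - 3" by (simp add: algebra_simps)
    have "u' \<simeq> 1" using u' by (rule neighbour_eqv_1)
    then have "a u' = 1" "a w' = 1" "a (u' * w') = 1"
      using w' dist_unit_mult dist_eq_1_iff by metis+
    from four_steps(2,3)[OF this *] b show "neighbour w'" "neighbour (u' * w')" by auto
  qed
  \<comment> \<open>A first use of \<open>key\<close>, with \<open>w\<close> itself, shows that
    \<open>w\<close> is a neighbour. Only then is \<open>1 + v\<close> known to be in the class of
    \<open>1 + w\<close>, so that \<open>key\<close> applies to \<open>v\<close>.\<close>
  have "neighbour w" using key(1)[OF nk2 w(1)] by simp
  then have "1 + v \<simeq> 1 + w" using neighbour_type v by blast
  then show ?thesis using key(2)[OF u neighbour_eqv_1[OF v]] by blast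
qed

lemma neighbour_exists: "\<exists>u. neighbour u \<and> a (- 1 - u) = a (- 1) - 1"
proof -
  obtain k2 where k2: "a k2 = 1" "a (- 1 - k2) = a (-1) - 1"
    using dist_stepE[of "-1", OF refl] dist_minus_one_gt_1 by auto
  then show ?thesis by (intro exI[of _ k2]) (auto simp: neighbour_def algebra_simps)
qed

lemma neighbour_1: assumes "4 \<le> a (- 1)" shows "neighbour 1"
proof -
  obtain u where u: "neighbour u" using neighbour_exists by blast
  obtain v where v: "[u * v = 1] (mod n)" using eqv_1_inverse neighbour_eqv_1[OF u] by blast
  show ?thesis using neighbour_cong[OF v] neighbour_mult[OF assms u neighbour_inverse[OF u v]] .
qed

text \<open>If \<open>1 + 1\<close> continues to a closed walk of minimal length, so does \<open>1 + u = 2 y\<close>, because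
  \<open>y\<close> times the remaining steps closes both walks.\<close>
lemma neighbour_halve:
  assumes b: "4 \<le> a (- 1)" and u: "neighbour u" and y: "[2 * y = 1 + u] (mod n)"
  shows "neighbour y"
proof -
  have 2: "1 + u \<simeq> 2" "\<not> n dvd 2" using neighbour_type[OF u neighbour_1[OF b]] neighbour_type[OF neighbour_1[OF b] neighbour_1[OF b]] by simp_all
  have "2 * y \<simeq> 2 * 1" using 2 y eqv_cong eqv_trans by (metis mult.right_neutral)
  then have y1: "y \<simeq> 1" using eqv_mult_cancel 2(2) by blast
  have "a (-2) = a (-1) - 1"
    using minimal_type_2(3)[of 1 1] neighbour_1[OF b] by (simp add: neighbour_def dist_1)
  from this obtain k where k: "a k = 1" "a (- 2 - k) = a (-1) - 1 - 1"
    by (rule dist_stepE) (use b in simp)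
  have "a (- (1 + k)) \<le> 1 + a (- 2 - k)"
    using dist_triangle[of 1 "-2 - k"] dist_1 by (simp add: algebra_simps)
  then have nk: "neighbour k" using k b by (simp add: neighbour_def)
  have yk: "a (y * k) = 1" using dist_unit_mult[OF y1] k by simp
  have "a (- (1 + y * k)) \<le> a u + a (- (1 + u + y * k))"
    using dist_triangle[of u "- (1 + u + y * k)"] by (simp add: algebra_simps)
  also have "a (- (1 + u + y * k)) = a (y * (- 2 - k))"
  proof (rule dist_cong)
    show "[- (1 + u + y * k) = y * (- 2 - k)] (mod n)"
      using y by (simp add: algebra_simps cong_iff_dvd_diff)
  qed
  also have "\<dots> = a (-1) - 2" using dist_unit_mult[OF y1] k by simp
  finally have nyk: "neighbour (y * k)" using u b yk by (simp add: neighbour_def)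
  \<comment> \<open>Both \<open>y * k\<close> and \<open>k\<close> are neighbours, and neighbours
    form a group.\<close>
  obtain l where l: "[k * l = 1] (mod n)" using eqv_1_inverse neighbour_eqv_1[OF nk] by blast
  have "neighbour (y * k * l)" by (rule neighbour_mult[OF b nyk neighbour_inverse[OF nk l]])
  moreover have "[y * k * l = y] (mod n)"
    using cong_scalar_left[OF l, of y] by (simp add: algebra_simps)
  ultimately show ?thesis using neighbour_cong by blast
qed

text \<open>Halving in the sense of \<open>neighbour_halve\<close> multiplies \<open>u - 1\<close>
  by the inverse \<open>h\<close> of 2. By Fermat's theorem \<open>h ^ (n - 2)\<close> is 2, so
  enough halvings amount to a doubling.\<close>

lemma neighbour_double:
  assumes b: "4 \<le> a (- 1)" and u: "neighbour u"
  shows "neighbour (2 * u - 1)"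
proof -
  have nd2: "\<not> n dvd 2" using neighbour_type[OF neighbour_1[OF b] neighbour_1[OF b]] by simp
  obtain h where h: "[2 * h = 1] (mod n)" using inverse_mod nd2 by blast
  have it: "neighbour (1 + (u - 1) * h ^ i)" for i
  proof (induction i)
    case (Suc i)
    have "[2 * (1 + (u - 1) * h ^ Suc i) = 1 + (1 + (u - 1) * h ^ i)] (mod n)"
      using cong_scalar_left[OF h, of "(u - 1) * h ^ i"]
      by (simp add: algebra_simps cong_iff_dvd_diff)
    then show ?case using neighbour_halve b Suc by blast
  qed (simp add: u)
  have "\<not> n dvd h"
    using h not_dvd_1 by (metis cong_dvd_iff dvd_mult)
  then have eu: "[h ^ (nat n - 1) = 1] (mod n)" by (intro fermat_int prime_n)
  have "nat n - 1 > 0" using prime_gt_1_int[OF prime_n] by simp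
  then obtain t where t: "nat n - 1 = Suc t" using gr0_implies_Suc by blast
  have "[h ^ t = 2 * (h * h ^ t)] (mod n)"
    using cong_scalar_right[OF h, of "h ^ t"] by (simp add: algebra_simps cong_sym)
  also have "[2 * (h * h ^ t) = 2 * 1] (mod n)" using eu t by (intro cong_scalar_left) simp
  finally have "[1 + (u - 1) * h ^ t = 1 + (u - 1) * 2] (mod n)"
    by (intro cong_add cong_scalar_left) auto
  then show ?thesis using neighbour_cong[OF _ it[of t]] by (simp add: algebra_simps)
qed

text \<open>By \<open>neighbour_double\<close> applied to the quotient of \<open>w\<close> by
  \<open>v\<close>, neighbours are closed under the reflection \<open>2 * w - v\<close>. Starting
  from 1 and \<open>u\<close> they contain a whole arithmetic progression; if its difference
  \<open>u - 1\<close> is invertible, the progression reaches 0, which is not a step.\<close>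

lemma neighbour_trivial:
  assumes b: "4 \<le> a (- 1)" and u: "neighbour u" shows "[u = 1] (mod n)"
proof (rule ccontr)
  assume "\<not> [u = 1] (mod n)"
  then have nd: "\<not> n dvd u - 1" by (simp add: cong_iff_dvd_diff)
  have step: "neighbour (2 * w - v)" if v: "neighbour v" and w: "neighbour w" for v w
  proof -
    obtain r where r: "[v * r = 1] (mod n)" using eqv_1_inverse neighbour_eqv_1[OF v] by blast
    have "neighbour (v * (2 * (w * r) - 1))"
      by (intro neighbour_mult[OF b] neighbour_double[OF b] neighbour_inverse[OF v r] v w)
    moreover have "[v * (2 * (w * r) - 1) = 2 * w - v] (mod n)"
      using cong_scalar_left[OF r, of "2 * w"] by (simp add: algebra_simps cong_iff_dvd_diff)
    ultimately show ?thesis using neighbour_cong by blast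
  qed
  have ap: "neighbour (1 + int i * (u - 1)) \<and> neighbour (1 + int (Suc i) * (u - 1))" for i
  proof (induction i)
    case 0 then show ?case using u neighbour_1[OF b] by simp
  next
    case (Suc i)
    then have "neighbour (2 * (1 + int (Suc i) * (u - 1)) - (1 + int i * (u - 1)))"
      using step by blast
    also have "2 * (1 + int (Suc i) * (u - 1)) - (1 + int i * (u - 1)) = 1 + int (Suc (Suc i)) * (u - 1)"
      by (simp add: algebra_simps)
    finally show ?case using Suc by blast
  qed
  obtain r where r: "[(u - 1) * r = 1] (mod n)" using inverse_mod nd by blast
  have "[1 + ((- r) mod n) * (u - 1) = 1 + (- r) * (u - 1)] (mod n)"
    by (intro cong_add cong_scalar_right) (simp_all add: cong_def)
  also have "[1 + (- r) * (u - 1) = 0] (mod n)" using r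
    by (simp add: algebra_simps cong_iff_dvd_diff dvd_diff_commute)
  finally have "n dvd 1 + ((- r) mod n) * (u - 1)" by (simp add: cong_0_iff)
  then have "n dvd 1 + int (nat ((- r) mod n)) * (u - 1)" using n_pos by simp
  moreover have "a (1 + int (nat ((- r) mod n)) * (u - 1)) = 1"
    using ap[of "nat ((- r) mod n)"] unfolding neighbour_def by blast
  ultimately show False using dist_one_not_dvd by blast
qed

lemma dist_nat_le: "a (int j) \<le> j"
proof (induction j)
  case (Suc j) then show ?case using dist_triangle[of 1 "int j"] dist_1 by simp
qed (simp add: dist_0_iff)

text \<open>If the way back from \<open>j\<close> begins with \<open>k\<close>, let \<open>k\<close>
  directly follow the first 1; the other \<open>j - 1\<close> steps 1 can be taken later. So
  \<open>k\<close> is a neighbour, that is 1, and the shortest circuit consists of ones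
  only.\<close>

lemma dist_uminus_nat:
  assumes b: "4 \<le> a (- 1)"
  shows "1 \<le> j \<Longrightarrow> j \<le> a (- 1) + 1 \<Longrightarrow> a (- int j) = a (- 1) + 1 - j"
proof (induction j rule: nat_induct_at_least)
  case base then show ?case by simp
next
  case (Suc j)
  then have "a (- int j) = a (-1) + 1 - j" "a (-1) + 1 - j > 0" by simp_all
  then obtain k where k: "a k = 1" "a (- int j - k) = a (-1) + 1 - j - 1" by (rule dist_stepE)
  have "a (- (1 + k)) \<le> a (int (j - 1)) + a (- int j - k)"
    using dist_triangle[of "int (j - 1)" "- int j - k"] Suc.hyps by (simp add: of_nat_diff)
  then have "neighbour k" using k dist_nat_le[of "j - 1"] Suc by (simp add: neighbour_def)
  then have "[k = 1] (mod n)" using neighbour_trivial b by blast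
  then have "[- int j - k = - int j - 1] (mod n)" by (intro cong_diff) auto
  then have "a (- int j - k) = a (- int j - 1)" by (rule dist_cong)
  also have "- int j - 1 = - int (Suc j)" by simp
  finally have "a (- int j - k) = a (- int (Suc j))" .
  then show ?case using k by simp
qed

text \<open>The shortest circuit of ones has length \<open>a (- 1) + 1\<close>, which is thus a
  multiple of \<open>n\<close>. A step \<open>x\<close> different from 1 would give a shorter one:
  the powers of \<open>x\<close> up to \<open>x ^ (n - 2)\<close> add up to 0 and all of them are
  steps, so \<open>- 1\<close> is a sum of \<open>n - 2\<close> steps.\<close>

lemma trivial_units:
  assumes b: "4 \<le> a (- 1)" shows "a x = 1 \<longleftrightarrow> [x = 1] (mod n)"
proof
  assume x: "a x = 1"
  show "[x = 1] (mod n)"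
  proof (rule ccontr)
    assume "\<not> [x = 1] (mod n)"
    then have nd: "\<not> n dvd x - 1" by (simp add: cong_iff_dvd_diff)
    define m where "m = nat n - 1"
    have m: "m \<ge> 1" using prime_gt_1_int[OF prime_n] by (simp add: m_def)
    have "[x ^ m = 1] (mod n)" unfolding m_def using dist_one_not_dvd[OF x] by (intro fermat_int prime_n)
    then have "n dvd (x - 1) * (\<Sum>i<m. x ^ i)"
      by (simp add: power_diff_1_eq[symmetric] cong_iff_dvd_diff)
    then have sum0: "n dvd (\<Sum>i<m. x ^ i)" using nd dvd_mult_iff by blast
    have pow: "x ^ i \<simeq> 1" for i
    proof (induction i)
      case (Suc i)
      then show ?case using eqv_mult2[of x 1 "x ^ i" 1] x dist_eq_1_iff by simp
    qed simp
    have le: "a (\<Sum>i<k. x ^ Suc i) \<le> k" for k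
    proof (induction k)
      case (Suc k)
      have "a (x ^ Suc k) = 1" using pow dist_eq_1_iff by blast
      then show ?case using Suc dist_triangle[of "\<Sum>i<k. x ^ Suc i" "x ^ Suc k"] by simp
    qed (simp add: dist_0_iff)
    have "(\<Sum>i<m. x ^ i) = 1 + (\<Sum>i<m - 1. x ^ Suc i)"
      using m sum.lessThan_Suc_shift[of "\<lambda>i. x ^ i" "m - 1"] by simp
    then have "[- 1 = (\<Sum>i<m - 1. x ^ Suc i)] (mod n)"
      using sum0 by (metis add.commute cong_iff_dvd_diff cong_sym diff_minus_eq_add)
    then have "a (- 1) \<le> m - 1" using le[of "m - 1"] dist_cong by metis
    moreover have "a (- int (a (-1) + 1)) = 0"
      using dist_uminus_nat[OF b, of "a (-1) + 1"] by simp
    then have "n dvd int (a (-1) + 1)" by (metis dist_0_iff dvd_minus_iff)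
    then have "n \<le> int (a (-1) + 1)" by (intro zdvd_imp_le) auto
    ultimately show False using m by (simp add: m_def)
  qed
qed (metis dist_1 dist_cong)

section \<open>Girth three: sums and differences of two steps\<close>

lemma eqv_1_if: "a x = 1 \<Longrightarrow> x \<simeq> 1" and eqv_1_dist: "x \<simeq> 1 \<Longrightarrow> a x = 1"
  using dist_eq_1_iff by simp_all

lemma eqv_minus_1_if: "a (- x) = 1 \<Longrightarrow> x \<simeq> - 1"
  using eqv_uminus[OF eqv_1_if, of "- x"] by simp

lemma not_dvd_1_plus:
  assumes "u \<simeq> 1" shows "\<not> n dvd 1 + u"
proof
  assume "n dvd 1 + u"
  then have "[u = - 1] (mod n)" by (simp add: cong_iff_dvd_diff add.commute)
  then have "a (- 1) = 1" using eqv_1_dist[OF assms] dist_cong by metis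
  then show False using dist_minus_one_gt_1 by simp
qed

text \<open>Going back along a step costs 2, so both distances are at most 3. They are nonzero and
  different, hence one of them is 1 or they are 2 and 3.\<close>

lemma diff_class:
  assumes b: "a (- 1) = 2" and u: "u \<simeq> 1" "\<not> n dvd 1 - u"
  shows "1 - u \<simeq> 1 \<or> 1 - u \<simeq> - 1 \<or> (a (1 - u) = 2 \<and> a (u - 1) = 3) \<or> (a (1 - u) = 3 \<and> a (u - 1) = 2)"
proof -
  have u': "a u = 1" "a (- u) = 2" using u b by (auto simp: eqv_def dist_1)
  have "a (1 - u) \<le> 3" "a (u - 1) \<le> 3"
    using dist_triangle[of 1 "-u"] dist_triangle[of u "-1"] u' b dist_1 by simp_all
  moreover have "a (1 - u) \<noteq> a (u - 1)" using dist_uminus_neq[OF u(2)] by simp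
  moreover have "3 \<le> a (1 - u) + a (u - 1)" using girth[OF u(2)] b by simp
  moreover have "1 - u \<simeq> 1" if "a (1 - u) = 1" using that by (rule eqv_1_if)
  moreover have "1 - u \<simeq> - 1" if "a (u - 1) = 1" using eqv_minus_1_if[of "1 - u"] that by simp
  moreover have "a (1 - u) \<noteq> 0" "a (u - 1) \<noteq> 0"
    using u(2) dvd_diff_commute[of n 1 u] unfolding dist_0_iff by blast+
  moreover have "(p = 2 \<and> q = 3) \<or> (p = 3 \<and> q = 2)"
    if "p \<le> 3" "q \<le> 3" "p \<noteq> q" "p \<noteq> 0" "q \<noteq> 0" "p \<noteq> 1" "q \<noteq> 1" for p q :: nat
    using that by arith
  ultimately show ?thesis by blast
qed

text \<open>Only \<open>a (- (1 + u)) \<le> 3\<close> needs an idea, as the triangle inequality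
  gives 4. If it fails, take a step \<open>w\<close> such that \<open>1, w\<close> and a third step
  form a circuit; then \<open>w - u\<close> has distances 3 and 2. The inverses \<open>r\<close> of
  \<open>u\<close> and \<open>s\<close> of \<open>w\<close> satisfy the same hypotheses, so
  \<open>s - r\<close> has distances 3 and 2 as well. But \<open>u * w * (r - s)\<close> is
  \<open>w - u\<close>, which puts \<open>r - s\<close> and not \<open>s - r\<close> into that
  class.\<close>

lemma sum_class:
  assumes b: "a (- 1) = 2" and u: "u \<simeq> 1"
  shows "1 + u \<simeq> 1 \<or> 1 + u \<simeq> - 1 \<or> (a (1 + u) = 2 \<and> a (- (1 + u)) = 3)"
proof -
  have "a (- 1) > 0" using b by simp
  then obtain w where w: "a w = 1" "a (- 1 - w) = 1"
    using dist_stepE[of "-1", OF refl] b by auto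
  have key: "a (w' - u') = 3 \<and> a (u' - w') = 2"
    if u': "u' \<simeq> 1" "4 \<le> a (- (1 + u'))" and w': "a w' = 1" "a (- 1 - w') = 1" for u' w'
  proof -
    have "a (- (1 + u')) \<le> a (- 1 - w') + a (w' - u')"
      using dist_triangle[of "- 1 - w'" "w' - u'"] by (simp add: algebra_simps)
    then have ge: "a (w' - u') \<ge> 3" using u' w' by simp
    have "a (- u') = 2" "a (- w') = 2" using u' eqv_1_if[OF w'(1)] b by (auto simp: eqv_def)
    then have le: "a (w' - u') \<le> 3" "a (u' - w') \<le> 3"
      using dist_triangle[of w' "- u'"] dist_triangle[of u' "- w'"] w' eqv_1_dist[OF u'(1)] by simp_all
    have nd: "\<not> n dvd u' - w'"
      using ge dist_0_iff[of "w' - u'"] dvd_minus_iff[of n "w' - u'"] by simp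
    have "a (u' - w') \<noteq> 1"
      using eqv_uminus[OF eqv_1_if, of "u' - w'"] b ge by (auto simp: eqv_def)
    moreover have "a (u' - w') \<noteq> 0" using nd by (simp add: dist_0_iff)
    ultimately show ?thesis using dist_uminus_neq[OF nd] ge le by simp
  qed
  have "a (- (1 + u)) \<le> 3"
  proof (rule ccontr)
    assume "\<not> a (- (1 + u)) \<le> 3"
    then have 4: "4 \<le> a (- (1 + u))" by simp
    obtain r where r: "r \<simeq> 1" "[u * r = 1] (mod n)" using eqv_1_inverse u by blast
    obtain s where s: "s \<simeq> 1" "[w * s = 1] (mod n)" using eqv_1_inverse eqv_1_if[OF w(1)] by blast
    have "a (- (1 + r)) = a (u * (- (1 + r)))" using dist_unit_mult[OF u] by simp
    also have "\<dots> = a (- (1 + u))"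
      using r(2) by (intro dist_cong) (simp add: algebra_simps cong_iff_dvd_diff dvd_diff_commute)
    finally have r4: "4 \<le> a (- (1 + r))" using 4 by simp
    have "a (- 1 - s) = a (w * (- 1 - s))" using dist_unit_mult[OF eqv_1_if[OF w(1)]] by simp
    also have "\<dots> = a (- 1 - w)"
      using s(2) by (intro dist_cong) (simp add: algebra_simps cong_iff_dvd_diff dvd_diff_commute)
    finally have s1: "a (- 1 - s) = 1" using w(2) by simp
    have "a (r - s) = 2" using key[OF r(1) r4 eqv_1_dist[OF s(1)] s1] by simp
    moreover have "a (r - s) = a (u * (w * (r - s)))"
      using dist_unit_mult[OF u] dist_unit_mult[OF eqv_1_if[OF w(1)]] by simp
    moreover have "a (u * (w * (r - s))) = a (w - u)"
    proof (rule dist_cong)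
      show "[u * (w * (r - s)) = w - u] (mod n)"
        using cong_diff[OF cong_scalar_right[OF r(2), of w] cong_scalar_right[OF s(2), of u]]
        by (simp add: algebra_simps)
    qed
    ultimately show False using key[OF u 4 w] by simp
  qed
  moreover have "a (1 + u) \<le> 2" using dist_triangle[of 1 u] dist_1 eqv_1_dist[OF u] by simp
  moreover have "a (1 + u) \<noteq> 0" "a (- (1 + u)) \<noteq> 0"
    using not_dvd_1_plus[OF u] dvd_minus_iff[of n "1 + u"] unfolding dist_0_iff by blast+
  moreover have "1 + u \<simeq> 1" if "a (1 + u) = 1" using that by (rule eqv_1_if)
  moreover have "1 + u \<simeq> - 1" if "a (- (1 + u)) = 1" using eqv_minus_1_if that .
  moreover have "a (1 + u) \<noteq> a (- (1 + u))" using dist_uminus_neq[OF not_dvd_1_plus[OF u]] .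
  ultimately show ?thesis by linarith
qed

lemma everything_by_succ:
  assumes succ: "\<And>x. Q x \<Longrightarrow> Q (1 + x)" and zero: "Q 0"
    and cong: "\<And>x y. [x = y] (mod n) \<Longrightarrow> Q x \<Longrightarrow> Q y"
  shows "Q x"
proof -
  have "Q (int j)" for j by (induction j) (use zero succ in auto)
  then have "Q (int (nat (x mod n)))" .
  then have "Q (x mod n)" using n_pos by simp
  then show ?thesis using cong[of "x mod n" x] by (simp add: cong_def)
qed

text \<open>Without a class with distances 2 and 3, \<open>sum_class\<close> and
  \<open>diff_class\<close> say that 0, K and - K together are closed under adding 1.\<close>

lemma only_two_classes:
  assumes b: "a (- 1) = 2" and noC: "\<And>x. \<not> (a x = 2 \<and> a (- x) = 3)"
  shows "n dvd x \<or> a x = 1 \<or> a (- x) = 1"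
proof (rule everything_by_succ[where Q = "\<lambda>x. n dvd x \<or> a x = 1 \<or> a (- x) = 1"])
  fix x assume Q: "n dvd x \<or> a x = 1 \<or> a (- x) = 1"
  consider "n dvd x" | "x \<simeq> 1" | "- x \<simeq> 1" "\<not> n dvd 1 + x" | "n dvd 1 + x"
    using Q eqv_1_if by blast
  then show "n dvd 1 + x \<or> a (1 + x) = 1 \<or> a (- (1 + x)) = 1"
  proof cases
    case 1
    then have "[1 + x = 1] (mod n)" by (simp add: cong_iff_dvd_diff)
    then show ?thesis using dist_cong dist_1 by metis
  next
    case 2
    have "1 + x \<simeq> 1 \<or> 1 + x \<simeq> - 1" using sum_class[OF b 2] noC by blast
    then show ?thesis by (auto simp: eqv_def dist_1)
  next
    case 3
    have neg: "- (1 + x) = - x - 1" by simp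
    have "1 - (- x) \<simeq> 1 \<or> 1 - (- x) \<simeq> - 1"
      using diff_class[OF b 3(1)] 3(2) noC[of "1 - (- x)"] noC[of "- x - 1"]
      unfolding minus_diff_eq diff_minus_eq_add neg by blast
    then show ?thesis by (auto simp: eqv_def dist_1)
  qed simp
next
  fix x y assume xy: "[x = y] (mod n)" and Q: "n dvd x \<or> a x = 1 \<or> a (- x) = 1"
  moreover have "[- x = - y] (mod n)" using xy by (simp only: cong_minus_minus_iff)
  ultimately show "n dvd y \<or> a y = 1 \<or> a (- y) = 1"
    using dist_cong[OF xy] dist_cong cong_dvd_iff[OF xy] by metis
qed simp

subsection \<open>Counting solutions of linear equations in units\<close>

definition units :: "int set" where
  "units = {x \<in> {0..<n}. x \<simeq> 1}"

text \<open>Intersection numbers in a homogeneous form: the equation for \<alpha>, \<beta>, \<gamma>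
  with the first unknown scaled to 1. In this form they are symmetric in the coefficients and depend
  only on the classes of nonzero coefficients.\<close>

definition sols :: "int \<Rightarrow> int \<Rightarrow> int \<Rightarrow> nat" where
  "sols \<alpha> \<beta> \<gamma> = card {(y, z) \<in> units \<times> units. n dvd \<alpha> + \<beta> * y + \<gamma> * z}"

lemma finite_units [simp]: "finite units"
  by (rule finite_subset[of _ "{0..<n}"]) (auto simp: units_def)

lemma one_in_units: "1 \<in> units"
  using prime_gt_1_int[OF prime_n] by (simp add: units_def)

lemma card_units_pos: "card units > 0"
  using one_in_units by (auto simp: card_gt_0_iff)

lemma units_mod: "x \<simeq> 1 \<Longrightarrow> x mod n \<in> units"
  using n_pos eqv_cong[of "x mod n" x] eqv_trans by (auto simp: units_def cong_def)

lemma units_eqI: "x \<in> units \<Longrightarrow> y \<in> units \<Longrightarrow> [x = y] (mod n) \<Longrightarrow> x = y"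
  by (simp add: units_def cong_def)

lemma units_mult_bij:
  assumes "x \<simeq> 1" shows "bij_betw (\<lambda>y. x * y mod n) units units"
proof -
  have into: "(\<lambda>y. x * y mod n) ` units \<subseteq> units"
  proof (safe, rule units_mod)
    fix y assume "y \<in> units"
    then show "x * y \<simeq> 1" using eqv_mult2[of x 1 y 1] assms by (simp add: units_def)
  qed
  obtain r where r: "[x * r = 1] (mod n)" using eqv_1_inverse[OF assms] by blast
  have "inj_on (\<lambda>y. x * y mod n) units"
  proof
    fix y z assume yz: "y \<in> units" "z \<in> units" "x * y mod n = x * z mod n"
    then have "[x * y = x * z] (mod n)" by (simp add: cong_def)
    then have "[r * (x * y) = r * (x * z)] (mod n)" by (rule cong_scalar_left)
    moreover have "[r * (x * y) = y] (mod n)" "[r * (x * z) = z] (mod n)"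
      using cong_scalar_right[OF r, of y] cong_scalar_right[OF r, of z] by (simp_all add: algebra_simps)
    ultimately have "[y = z] (mod n)" by (meson cong_sym cong_trans)
    then show "y = z" using units_eqI yz by blast
  qed
  then show ?thesis using into by (simp add: bij_betw_def endo_inj_surj)
qed

text \<open>A given \<open>y\<close> admits at most one \<open>z\<close>, and it admits one exactly
  if \<open>\<alpha> + \<beta> * y\<close> lies in the coset of \<open>- \<gamma>\<close>.\<close>

lemma sols_card:
  assumes "\<not> n dvd \<gamma>" shows "sols \<alpha> \<beta> \<gamma> = card {y \<in> units. \<alpha> + \<beta> * y \<simeq> - \<gamma>}"
  unfolding sols_def
proof (rule bij_betw_same_card[of fst], unfold bij_betw_def, intro conjI)
  obtain r where r: "[\<gamma> * r = 1] (mod n)" using inverse_mod assms by blast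
  show "inj_on fst {(y, z) \<in> units \<times> units. n dvd \<alpha> + \<beta> * y + \<gamma> * z}"
  proof (rule inj_onI, clarsimp)
    fix y z z' assume *: "n dvd \<alpha> + \<beta> * y + \<gamma> * z" "n dvd \<alpha> + \<beta> * y + \<gamma> * z'" "z \<in> units" "z' \<in> units"
    have "n dvd \<gamma> * (z - z')" using dvd_diff[OF *(1,2)] by (simp add: algebra_simps)
    then have "[z = z'] (mod n)" using assms by (simp add: dvd_mult_iff cong_iff_dvd_diff)
    then show "z = z'" using * units_eqI by blast
  qed
  show "fst ` {(y, z) \<in> units \<times> units. n dvd \<alpha> + \<beta> * y + \<gamma> * z} = {y \<in> units. \<alpha> + \<beta> * y \<simeq> - \<gamma>}"
  proof (intro subset_antisym subsetI)
    fix y assume "y \<in> fst ` {(y, z) \<in> units \<times> units. n dvd \<alpha> + \<beta> * y + \<gamma> * z}"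
    then obtain z where z: "y \<in> units" "z \<in> units" "n dvd \<alpha> + \<beta> * y + \<gamma> * z" by auto
    then have "[\<alpha> + \<beta> * y = - \<gamma> * z] (mod n)" by (simp add: cong_iff_dvd_diff)
    moreover have "- \<gamma> * z \<simeq> - \<gamma> * 1" using z(2) by (intro eqv_mult) (simp add: units_def)
    ultimately have "\<alpha> + \<beta> * y \<simeq> - \<gamma>" using eqv_cong eqv_trans by fastforce
    then show "y \<in> {y \<in> units. \<alpha> + \<beta> * y \<simeq> - \<gamma>}" using z by simp
  next
    fix y assume y: "y \<in> {y \<in> units. \<alpha> + \<beta> * y \<simeq> - \<gamma>}"
    then obtain w where w: "w \<simeq> 1" "[\<alpha> + \<beta> * y = - \<gamma> * w] (mod n)"
      using eqv_ratio[of "- \<gamma>" "\<alpha> + \<beta> * y"] eqv_sym assms by auto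
    have "[- \<gamma> * w = - \<gamma> * (w mod n)] (mod n)" by (intro cong_scalar_left) (simp add: cong_def)
    with w(2) have "[\<alpha> + \<beta> * y = - \<gamma> * (w mod n)] (mod n)" by (rule cong_trans)
    then have "n dvd \<alpha> + \<beta> * y + \<gamma> * (w mod n)" by (simp add: cong_iff_dvd_diff)
    then show "y \<in> fst ` {(y, z) \<in> units \<times> units. n dvd \<alpha> + \<beta> * y + \<gamma> * z}"
      using y units_mod[OF w(1)] by (auto intro!: rev_image_eqI[of "(y, w mod n)"])
  qed
qed

lemma sols_swap23: "sols \<alpha> \<beta> \<gamma> = sols \<alpha> \<gamma> \<beta>"
  unfolding sols_def
  by (rule bij_betw_same_card[of prod.swap], rule bij_betwI[of _ _ _ prod.swap])
     (auto simp: add.commute add.left_commute)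

text \<open>Dividing each solution by \<open>x\<close> scales the first unknown to 1. The left side
  treats all three coefficients alike, which yields \<open>sols_swap12\<close>.\<close>

lemma card_triples:
  "card {(x, y, z) \<in> units \<times> units \<times> units. n dvd \<alpha> * x + \<beta> * y + \<gamma> * z} = card units * sols \<alpha> \<beta> \<gamma>"
proof -
  let ?P = "\<lambda>x. {(y, z) \<in> units \<times> units. n dvd \<alpha> * x + \<beta> * y + \<gamma> * z}"
  have "{(x, y, z) \<in> units \<times> units \<times> units. n dvd \<alpha> * x + \<beta> * y + \<gamma> * z} = Sigma units ?P" by auto
  moreover have "finite (?P x)" for x by (rule finite_subset[of _ "units \<times> units"]) auto
  moreover have "card (?P x) = sols \<alpha> \<beta> \<gamma>" if x: "x \<in> units" for x
  proof -
    have x1: "x \<simeq> 1" using x by (simp add: units_def)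
    let ?f = "\<lambda>y. x * y mod n"
    have pair: "{(y, z) \<in> A. R y z} = {p \<in> A. R (fst p) (snd p)}" for A and R :: "int \<Rightarrow> int \<Rightarrow> bool" by auto
    have "bij_betw (map_prod ?f ?f) (units \<times> units) (units \<times> units)"
      by (intro bij_betw_map_prod units_mult_bij x1)
    moreover have "n dvd \<alpha> * x + \<beta> * (x * y mod n) + \<gamma> * (x * z mod n) \<longleftrightarrow> n dvd \<alpha> + \<beta> * y + \<gamma> * z" for y z
    proof -
      have "[\<alpha> * x + \<beta> * (x * y mod n) + \<gamma> * (x * z mod n) = \<alpha> * x + \<beta> * (x * y) + \<gamma> * (x * z)] (mod n)"
        by (intro cong_add cong_scalar_left) (auto simp: cong_def)
      then have "n dvd \<alpha> * x + \<beta> * (x * y mod n) + \<gamma> * (x * z mod n) \<longleftrightarrow> n dvd \<alpha> * x + \<beta> * (x * y) + \<gamma> * (x * z)"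
        by (rule cong_dvd_iff)
      also have "\<alpha> * x + \<beta> * (x * y) + \<gamma> * (x * z) = x * (\<alpha> + \<beta> * y + \<gamma> * z)" by (simp add: algebra_simps)
      finally show ?thesis using dist_one_not_dvd[OF eqv_1_dist[OF x1]] dvd_mult_iff by simp
    qed
    ultimately have "bij_betw (map_prod ?f ?f) {(y, z) \<in> units \<times> units. n dvd \<alpha> + \<beta> * y + \<gamma> * z} (?P x)"
      unfolding pair by (intro bij_betw_Collect) auto
    then show ?thesis unfolding sols_def by (metis (no_types, lifting) bij_betw_same_card)
  qed
  ultimately show ?thesis by simp
qed

lemma sols_swap12: "sols \<alpha> \<beta> \<gamma> = sols \<beta> \<alpha> \<gamma>"
proof -
  have "card {(x, y, z) \<in> units \<times> units \<times> units. n dvd \<alpha> * x + \<beta> * y + \<gamma> * z}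
      = card {(x, y, z) \<in> units \<times> units \<times> units. n dvd \<beta> * x + \<alpha> * y + \<gamma> * z}"
    by (rule bij_betw_same_card[of "\<lambda>(x, y, z). (y, x, z)"], rule bij_betwI[of _ _ _ "\<lambda>(x, y, z). (y, x, z)"])
       (auto simp: add.commute add.left_commute)
  then show ?thesis using card_units_pos unfolding card_triples by (metis mult_left_cancel less_numeral_extra(3))
qed

lemma sols_scale:
  assumes "\<not> n dvd t" shows "sols (t * \<alpha>) (t * \<beta>) (t * \<gamma>) = sols \<alpha> \<beta> \<gamma>"
proof -
  have "n dvd t * \<alpha> + t * \<beta> * y + t * \<gamma> * z \<longleftrightarrow> n dvd \<alpha> + \<beta> * y + \<gamma> * z" for y z
    using assms dvd_mult_iff[of t "\<alpha> + \<beta> * y + \<gamma> * z"] by (simp add: algebra_simps)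
  then show ?thesis unfolding sols_def by simp
qed

lemma sols_uminus: "sols (- \<alpha>) (- \<beta>) (- \<gamma>) = sols \<alpha> \<beta> \<gamma>"
  using sols_scale[of "-1" \<alpha> \<beta> \<gamma>] not_dvd_1 by simp

lemma sols_eqv3:
  assumes "\<gamma> \<simeq> \<gamma>'" "\<not> n dvd \<gamma>" shows "sols \<alpha> \<beta> \<gamma> = sols \<alpha> \<beta> \<gamma>'"
proof -
  have "\<not> n dvd \<gamma>'" using assms eqv_dvd_iff by blast
  moreover have "x \<simeq> - \<gamma> \<longleftrightarrow> x \<simeq> - \<gamma>'" for x
    using eqv_uminus[OF assms(1)] eqv_trans eqv_sym by blast
  ultimately show ?thesis using sols_card assms(2) by simp
qed

lemma sols_eqv1: "\<alpha> \<simeq> \<alpha>' \<Longrightarrow> \<not> n dvd \<alpha> \<Longrightarrow> sols \<alpha> \<beta> \<gamma> = sols \<alpha>' \<beta> \<gamma>"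
  and sols_eqv2: "\<beta> \<simeq> \<beta>' \<Longrightarrow> \<not> n dvd \<beta> \<Longrightarrow> sols \<alpha> \<beta> \<gamma> = sols \<alpha> \<beta>' \<gamma>"
  using sols_eqv3 sols_swap12 sols_swap23 by metis+

end

section \<open>Girth three with a further class C\<close>

text \<open>Here \<open>c\<close> represents the class C of sums of two steps outside K and - K.
  Nothing says that 0, K, - K, C and - C are everything: only sums and differences of two elements
  of K are known to lie there.\<close>

locale four_class_circulant = normalized_circulant +
  fixes c :: int
  assumes dist_minus_1: "a (- 1) = 2" and dist_c: "a c = 2" and dist_minus_c: "a (- c) = 3"
    and c_sum: "\<exists>u. u \<simeq> 1 \<and> [c = 1 + u] (mod n)"
begin

lemma distinct_classes:
  "\<not> 1 \<simeq> - 1" "\<not> - 1 \<simeq> 1" "\<not> c \<simeq> 1" "\<not> c \<simeq> - 1" "\<not> - c \<simeq> 1" "\<not> - c \<simeq> - 1"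
  "\<not> c \<simeq> - c" "\<not> - c \<simeq> c"
  "\<not> 1 \<simeq> c" "\<not> - 1 \<simeq> c" "\<not> 1 \<simeq> - c" "\<not> - 1 \<simeq> - c"
  by (auto simp: eqv_def dist_1 dist_minus_1 dist_c dist_minus_c)

lemma not_dvd_c: "\<not> n dvd c" "\<not> n dvd - c"
  using dist_c dist_minus_c by (metis dist_0_iff zero_neq_numeral)+

lemma sum_unit: "u \<simeq> 1 \<Longrightarrow> 1 + u \<simeq> 1 \<or> 1 + u \<simeq> - 1 \<or> 1 + u \<simeq> c"
  using sum_class[OF dist_minus_1, of u] by (auto simp: eqv_def dist_c dist_minus_c)

lemma diff_unit:
  assumes "u \<simeq> 1" "\<not> n dvd 1 - u"
  shows "1 - u \<simeq> 1 \<or> 1 - u \<simeq> - 1 \<or> 1 - u \<simeq> c \<or> 1 - u \<simeq> - c"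
  using diff_class[OF dist_minus_1 assms] by (auto simp: eqv_def dist_c dist_minus_c)

lemma square_inj:
  assumes "u \<simeq> 1" "v \<simeq> 1" "[u * u = v * v] (mod n)" shows "[u = v] (mod n)"
proof -
  have "n dvd (u - v) * (u + v)" using assms(3) by (simp add: cong_iff_dvd_diff algebra_simps)
  moreover have "\<not> n dvd u + v"
  proof
    assume "n dvd u + v"
    then have "[u = - v] (mod n)" by (simp add: cong_iff_dvd_diff)
    moreover have "- v \<simeq> - 1" using eqv_uminus assms(2) .
    ultimately have "1 \<simeq> - 1" using assms(1) by (meson eqv_cong eqv_sym eqv_trans)
    then show False using distinct_classes by simp
  qed
  ultimately show ?thesis by (simp add: dvd_mult_iff cong_iff_dvd_diff)
qed

lemma square_units: "u \<simeq> 1 \<Longrightarrow> u * u \<simeq> 1"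
  using eqv_mult2[of u 1 u 1] by simp

lemma square_inj_on: "inj_on (\<lambda>x. x * x mod n) units"
proof
  fix x y assume xy: "x \<in> units" "y \<in> units" "x * x mod n = y * y mod n"
  then have "x \<simeq> 1" "y \<simeq> 1" "[x * x = y * y] (mod n)" by (simp_all add: units_def cong_def)
  then have "[x = y] (mod n)" by (rule square_inj)
  then show "x = y" using units_eqI xy by blast
qed

text \<open>Since - 1 is not in K, squaring is injective on the finite set K, so every element of K
  is a square of some \<open>x\<close> in K. From \<open>c * c = x * x\<close> it would follow that
  \<open>c\<close> is \<open>x\<close> or \<open>- x\<close>.\<close>

lemma c_square_not_unit: "\<not> c * c \<simeq> 1"
proof
  assume cc: "c * c \<simeq> 1"
  have "(\<lambda>x. x * x mod n) ` units \<subseteq> units"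
    by (auto simp: units_def[symmetric] intro!: units_mod square_units) (simp add: units_def)
  then have "(\<lambda>x. x * x mod n) ` units = units"
    using square_inj_on by (simp add: endo_inj_surj)
  then obtain x where x: "x \<in> units" "c * c mod n = x * x mod n"
    using units_mod[OF cc] by (metis (no_types, lifting) imageE)
  then have "n dvd (c - x) * (c + x)"
    by (simp add: mod_eq_dvd_iff algebra_simps)
  then have "[c = x] (mod n) \<or> [c = - x] (mod n)" by (simp add: dvd_mult_iff cong_iff_dvd_diff)
  moreover have "x \<simeq> 1" "- x \<simeq> - 1" using x(1) eqv_uminus by (simp_all add: units_def)
  ultimately have "c \<simeq> 1 \<or> c \<simeq> - 1" using eqv_cong eqv_trans by blast
  then show False using distinct_classes by simp
qed

subsection \<open>Energy of the unit group\<close>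

text \<open>For \<open>u\<close> in K, the sum \<open>1 + u\<close> lies in K, - K and C for
  \<open>N\<close>, \<open>L\<close> and \<open>S\<close> values of \<open>u\<close>. The difference
  \<open>1 - u\<close> lies in K and in - K for \<open>N\<close> values each, and in C and in - C
  for \<open>D\<close> values each.\<close>

abbreviation "N \<equiv> sols 1 1 (- 1)"
abbreviation "L \<equiv> sols 1 1 1"
abbreviation "S \<equiv> sols 1 1 (- c)"
abbreviation "D \<equiv> sols 1 (- 1) c"

lemma card_sum_class: "card {u \<in> units. 1 + u \<simeq> 1} = N" "card {u \<in> units. 1 + u \<simeq> - 1} = L"
    "card {u \<in> units. 1 + u \<simeq> c} = S"
  using sols_card[of "-1" 1 1] sols_card[of 1 1 1] sols_card[of "-c" 1 1] not_dvd_1 not_dvd_c by simp_all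

lemma sols_diff: "sols 1 (- 1) (- 1) = N" "sols 1 (- 1) 1 = N" "sols 1 (- 1) (- c) = D"
  "sols (- 1) 1 1 = N" "sols (- 1) 1 (- 1) = N" "sols c 1 (- 1) = D" "sols (- c) 1 (- 1) = D"
  "sols (- c) 1 1 = S" "sols c 1 1 = sols 1 1 c"
  using sols_uminus[of 1 1 "-1"] sols_uminus[of 1 "-1" 1] sols_uminus[of 1 "-1" c]
  by (metis minus_minus sols_swap12 sols_swap23)+

lemma card_diff_class: "card {u \<in> units. 1 - u \<simeq> 1} = N" "card {u \<in> units. 1 - u \<simeq> - 1} = N"
    "card {u \<in> units. 1 - u \<simeq> c} = D" "card {u \<in> units. 1 - u \<simeq> - c} = D"
  using sols_card[of "-1" 1 "-1"] sols_card[of 1 1 "-1"] sols_card[of "-c" 1 "-1"] sols_card[of "c" 1 "-1"]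
    not_dvd_1 not_dvd_c by (simp_all add: sols_diff)

lemma sum_over_classes:
  fixes f :: "'i \<Rightarrow> nat" and g :: "'i \<Rightarrow> int" and F :: "int \<Rightarrow> nat"
  assumes fin: "finite A" and cover: "\<And>x. x \<in> A \<Longrightarrow> g x \<simeq> 1 \<or> g x \<simeq> - 1 \<or> g x \<simeq> c \<or> g x \<simeq> - c"
    and const: "\<And>x z. x \<in> A \<Longrightarrow> g x \<simeq> z \<Longrightarrow> f x = F z"
  shows "sum f A = card {x \<in> A. g x \<simeq> 1} * F 1 + card {x \<in> A. g x \<simeq> - 1} * F (- 1)
    + card {x \<in> A. g x \<simeq> c} * F c + card {x \<in> A. g x \<simeq> - c} * F (- c)"
proof -
  have A: "A = {x \<in> A. g x \<simeq> 1} \<union> {x \<in> A. g x \<simeq> - 1} \<union> {x \<in> A. g x \<simeq> c} \<union> {x \<in> A. g x \<simeq> - c}"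
    using cover by blast
  have dis: "\<not> (x \<simeq> y \<and> x \<simeq> z)" if "\<not> y \<simeq> z" for x y z
    using that eqv_sym eqv_trans by blast
  have "sum f {x \<in> A. g x \<simeq> z} = (\<Sum>x\<in>{x \<in> A. g x \<simeq> z}. F z)" for z
    by (rule sum.cong) (use const in auto)
  then have const_sum: "sum f {x \<in> A. g x \<simeq> z} = card {x \<in> A. g x \<simeq> z} * F z" for z by simp
  have disjoint: "{x \<in> A. g x \<simeq> y} \<inter> {x \<in> A. g x \<simeq> z} = {}" if "\<not> y \<simeq> z" for y z
    using dis[OF that] by blast
  have "sum f A = sum f ({x \<in> A. g x \<simeq> 1} \<union> {x \<in> A. g x \<simeq> - 1} \<union> {x \<in> A. g x \<simeq> c} \<union> {x \<in> A. g x \<simeq> - c})"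
    using A by (rule arg_cong)
  also have "\<dots> = sum f {x \<in> A. g x \<simeq> 1} + sum f {x \<in> A. g x \<simeq> - 1}
      + sum f {x \<in> A. g x \<simeq> c} + sum f {x \<in> A. g x \<simeq> - c}"
    using fin by (simp add: sum.union_disjoint Int_Un_distrib2 disjoint distinct_classes)
  finally show ?thesis unfolding const_sum .
qed

lemma card_over_classes:
  assumes "finite A" "\<And>x. x \<in> A \<Longrightarrow> g x \<simeq> 1 \<or> g x \<simeq> - 1 \<or> g x \<simeq> c \<or> g x \<simeq> - c"
  shows "card A = card {x \<in> A. g x \<simeq> 1} + card {x \<in> A. g x \<simeq> - 1}
    + card {x \<in> A. g x \<simeq> c} + card {x \<in> A. g x \<simeq> - c}"
  using sum_over_classes[of A g "\<lambda>_. 1" "\<lambda>_. 1"] assms by simp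

lemma sum_not_minus_c: "u \<simeq> 1 \<Longrightarrow> \<not> 1 + u \<simeq> - c"
  using sum_unit distinct_classes eqv_sym eqv_trans by meson

lemma card_units_sum: "card units = N + L + S"
proof -
  have "{u \<in> units. 1 + u \<simeq> - c} = {}" using sum_not_minus_c by (auto simp: units_def)
  moreover have "card units = card {u \<in> units. 1 + u \<simeq> 1} + card {u \<in> units. 1 + u \<simeq> - 1}
    + card {u \<in> units. 1 + u \<simeq> c} + card {u \<in> units. 1 + u \<simeq> - c}"
    by (rule card_over_classes[OF finite_units]) (use sum_unit in \<open>auto simp: units_def\<close>)
  ultimately show ?thesis by (simp add: card_sum_class)
qed

lemma not_dvd_1_minus: "u \<in> units \<Longrightarrow> u \<noteq> 1 \<Longrightarrow> \<not> n dvd 1 - u"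
  using units_eqI[OF one_in_units] by (auto simp: cong_iff_dvd_diff)

lemma diff_units: "u \<in> units - {1} \<Longrightarrow> 1 - u \<simeq> 1 \<or> 1 - u \<simeq> - 1 \<or> 1 - u \<simeq> c \<or> 1 - u \<simeq> - c"
  using diff_unit not_dvd_1_minus by (auto simp: units_def)

lemma Collect_units_minus_1:
  assumes "\<not> n dvd z" shows "{x \<in> units - {1}. 1 - x \<simeq> z} = {x \<in> units. 1 - x \<simeq> z}"
proof -
  have "\<not> 1 - 1 \<simeq> z" using assms eqv_dvd_iff[of 0 z] by auto
  then show ?thesis by auto
qed

lemma not_dvd_minus_1: "\<not> n dvd - 1"
  using not_dvd_1 by simp

lemmas units_minus_1_classes =
  Collect_units_minus_1[OF not_dvd_1] Collect_units_minus_1[OF not_dvd_minus_1]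
  Collect_units_minus_1[OF not_dvd_c(1)] Collect_units_minus_1[OF not_dvd_c(2)]

text \<open>The summand 1 stands for \<open>u = 1\<close>, where \<open>1 - u\<close> is 0.\<close>

lemma card_units_diff: "card units = 1 + 2 * N + 2 * D"
proof -
  have "card (units - {1}) = 2 * N + 2 * D"
    using card_over_classes[of "units - {1}" "\<lambda>u. 1 - u", OF _ diff_units] not_dvd_1
    unfolding units_minus_1_classes card_diff_class by simp
  then show ?thesis using one_in_units card_units_pos by (simp add: card_Diff_singleton)
qed

lemma finite_sols: "finite {(y, z) \<in> units \<times> units. n dvd \<alpha> + \<beta> * y + \<gamma> * z}"
  by (rule finite_subset[of _ "units \<times> units"]) auto

text \<open>Both sides count the solutions of \<open>1 + u = v + w\<close> in units, written as \<open>1 - v = w - u\<close>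
  on the right.\<close>
lemma energy: "N * N + L * L + S * S = card units + 2 * N * N + 2 * D * D"
proof -
  let ?R = "{(u, v, w) \<in> units \<times> units \<times> units. n dvd 1 + u - v - w}"
  have "?R = Sigma units (\<lambda>u. {(v, w) \<in> units \<times> units. n dvd - (1 + u) + 1 * v + 1 * w})"
  proof -
    have "n dvd 1 + u - v - w \<longleftrightarrow> n dvd - (1 + u) + 1 * v + 1 * w" for u v w
      using dvd_minus_iff[of n "1 + u - v - w"] by (simp add: algebra_simps)
    then show ?thesis by auto
  qed
  then have "card ?R = card (Sigma units (\<lambda>u. {(v, w) \<in> units \<times> units. n dvd - (1 + u) + 1 * v + 1 * w}))"
    by (rule arg_cong)
  also have "\<dots> = (\<Sum>u\<in>units. sols (- (1 + u)) 1 1)"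
    unfolding sols_def by (rule card_SigmaI) (rule finite_units, rule ballI, rule finite_sols)
  also have "\<dots> = card {u \<in> units. 1 + u \<simeq> 1} * sols (- 1) 1 1 + card {u \<in> units. 1 + u \<simeq> - 1} * sols (- (- 1)) 1 1
    + card {u \<in> units. 1 + u \<simeq> c} * sols (- c) 1 1 + card {u \<in> units. 1 + u \<simeq> - c} * sols (- (- c)) 1 1"
  proof (rule sum_over_classes[OF finite_units])
    fix u z assume u: "u \<in> units" and z: "1 + u \<simeq> z"
    then have "\<not> n dvd - (1 + u)" unfolding dvd_minus_iff by (intro not_dvd_1_plus) (simp add: units_def)
    then show "sols (- (1 + u)) 1 1 = sols (- z) 1 1" using sols_eqv1[OF eqv_uminus[OF z]] by blast
  qed (use sum_unit in \<open>auto simp: units_def\<close>)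
  also have "{u \<in> units. 1 + u \<simeq> - c} = {}" using sum_not_minus_c by (auto simp: units_def)
  finally have 1: "card ?R = N * N + L * L + S * S" by (simp add: card_sum_class sols_diff)
  have "card ?R = card {(v, u, w) \<in> units \<times> units \<times> units. n dvd (1 - v) + 1 * u + (- 1) * w}"
    by (rule bij_betw_same_card[of "\<lambda>(u, v, w). (v, u, w)"], rule bij_betwI[of _ _ _ "\<lambda>(v, u, w). (u, v, w)"])
       (auto simp: algebra_simps)
  also have "{(v, u, w) \<in> units \<times> units \<times> units. n dvd (1 - v) + 1 * u + (- 1) * w}
      = Sigma units (\<lambda>v. {(u, w) \<in> units \<times> units. n dvd (1 - v) + 1 * u + (- 1) * w})" by auto
  also have "card \<dots> = (\<Sum>v\<in>units. sols (1 - v) 1 (- 1))"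
    unfolding sols_def by (rule card_SigmaI) (rule finite_units, rule ballI, rule finite_sols)
  also have "\<dots> = sols (1 - 1) 1 (- 1) + (\<Sum>v\<in>units - {1}. sols (1 - v) 1 (- 1))"
    using one_in_units by (simp add: sum.remove)
  also have "(\<Sum>v\<in>units - {1}. sols (1 - v) 1 (- 1)) =
    card {v \<in> units - {1}. 1 - v \<simeq> 1} * sols 1 1 (- 1) + card {v \<in> units - {1}. 1 - v \<simeq> - 1} * sols (- 1) 1 (- 1)
    + card {v \<in> units - {1}. 1 - v \<simeq> c} * sols c 1 (- 1) + card {v \<in> units - {1}. 1 - v \<simeq> - c} * sols (- c) 1 (- 1)"
  proof (rule sum_over_classes)
    fix u z assume "u \<in> units - {1}" and z: "1 - u \<simeq> z"
    then have "\<not> n dvd 1 - u" using not_dvd_1_minus by auto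
    then show "sols (1 - u) 1 (- 1) = sols z 1 (- 1)" using sols_eqv1[OF z] by blast
  qed (use diff_units in auto)
  also have "\<dots> = 2 * N * N + 2 * D * D"
    unfolding units_minus_1_classes card_diff_class by (simp add: sols_diff)
  \<comment> \<open>The term for \<open>v = 1\<close> consists of the trivial solutions
    \<open>u = w\<close>.\<close>
  also have "sols (1 - 1) 1 (- 1) = card units"
    unfolding sols_def
  proof (rule bij_betw_same_card[of fst], rule bij_betwI[of _ _ _ "\<lambda>x. (x, x)"])
    show "\<And>x. x \<in> {(y, z) \<in> units \<times> units. n dvd 1 - 1 + 1 * y + - 1 * z} \<Longrightarrow> (fst x, fst x) = x"
      using units_eqI by (auto simp: cong_iff_dvd_diff)
  qed auto
  finally show ?thesis using 1 by simp
qed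


section \<open>The unit group has order three\<close>

text \<open>Let \<open>F\<close> contain the \<open>x \<noteq> 1\<close> with \<open>1 - x\<close>
  in C or - C. For \<open>x\<close> in \<open>F\<close>, \<open>1 + x\<close> in C would put
  \<open>1 - x * x\<close> into the class of \<open>c * c\<close> or its negative, which no
  difference of units can reach. So \<open>1 + x\<close> is in K or - K, \<open>x * x\<close> is in
  \<open>F\<close> again, and squaring permutes \<open>F\<close>. A \<open>u \<noteq> 1\<close> with
  \<open>1 + u\<close> in C is thus outside \<open>F\<close>, but then \<open>1 - u\<close> is in K
  or - K and the square of \<open>u\<close> falls into \<open>F\<close>, against
  injectivity.\<close>

lemma one_plus_unit_generic:
  assumes cc: "\<not> c * c \<simeq> - 1" and u: "u \<simeq> 1" "1 + u \<simeq> c"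
  shows "[u = 1] (mod n)"
proof (rule ccontr)
  assume u1: "\<not> [u = 1] (mod n)"
  define F where "F = {x \<in> units - {1}. 1 - x \<simeq> c \<or> 1 - x \<simeq> - c}"
  let ?sq = "\<lambda>x. x * x mod n"
  have Un: "x \<simeq> 1" if "x \<in> units" for x using that by (simp add: units_def)
  have factor: "1 - ?sq x \<simeq> (1 - x) * (1 + x)" for x
    by (rule eqv_cong) (simp add: cong_def mod_diff_right_eq algebra_simps)
  have sq_mem: "?sq x \<in> units - {1}" if x: "x \<in> units - {1}" for x
  proof -
    have "?sq x \<noteq> ?sq 1"
      using inj_onD[OF square_inj_on, of x 1] x one_in_units by auto
    moreover have "?sq 1 = 1" using one_in_units by (simp add: units_def)
    ultimately show ?thesis using units_mod[OF square_units[OF Un]] x by simp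
  qed
  have cc4: "\<not> c * c \<simeq> z \<and> \<not> - (c * c) \<simeq> z" if "z = 1 \<or> z = - 1 \<or> z = c \<or> z = - c" for z
  proof -
    have c1: "\<not> c * c \<simeq> c" "\<not> c * c \<simeq> - c"
      using eqv_mult_cancel[of c c 1] eqv_mult_cancel[of c c "-1"] not_dvd_c distinct_classes by auto
    then have "\<not> c * c \<simeq> z" if "z = 1 \<or> z = - 1 \<or> z = c \<or> z = - c" for z
      using that c_square_not_unit cc by auto
    from this[of z] this[of "- z"] show ?thesis
      using eqv_uminus[of "- (c * c)" z] that by auto
  qed
  have in_F: "\<not> 1 + x \<simeq> c" if x: "x \<in> F" for x
  proof
    assume "1 + x \<simeq> c"
    then have "(1 - x) * (1 + x) \<simeq> c * c \<or> (1 - x) * (1 + x) \<simeq> - c * c"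
      using x eqv_mult2 unfolding F_def by blast
    then have *: "1 - ?sq x \<simeq> c * c \<or> 1 - ?sq x \<simeq> - (c * c)"
      using factor eqv_trans by fastforce
    obtain z where "z = 1 \<or> z = - 1 \<or> z = c \<or> z = - c" "1 - ?sq x \<simeq> z"
      using diff_units[OF sq_mem, of x] x unfolding F_def by blast
    then show False using * cc4 eqv_sym eqv_trans by blast
  qed
  have "?sq ` F \<subseteq> F"
  proof
    fix y assume "y \<in> ?sq ` F"
    then obtain x where x: "x \<in> F" "y = ?sq x" by blast
    then have "1 + x \<simeq> 1 \<or> 1 + x \<simeq> - 1"
      using sum_unit[OF Un, of x] in_F unfolding F_def by blast
    moreover have "1 - x \<simeq> c \<or> 1 - x \<simeq> - c" using x unfolding F_def by blast
    ultimately have "(1 - x) * (1 + x) \<simeq> c \<or> (1 - x) * (1 + x) \<simeq> - c"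
      using eqv_mult2[of "1 - x" c "1 + x" 1] eqv_mult2[of "1 - x" "- c" "1 + x" 1]
        eqv_mult2[of "1 - x" c "1 + x" "- 1"] eqv_mult2[of "1 - x" "- c" "1 + x" "- 1"] by auto
    then have "1 - y \<simeq> c \<or> 1 - y \<simeq> - c" using factor x(2) eqv_trans by blast
    moreover have "x \<in> units - {1}" using x(1) by (auto simp: F_def)
    then have "y \<in> units - {1}" using sq_mem x(2) by metis
    ultimately show "y \<in> F" unfolding F_def by blast
  qed
  moreover have "finite F" by (simp add: F_def)
  moreover have "inj_on ?sq F" by (rule inj_on_subset[OF square_inj_on]) (auto simp: F_def)
  ultimately have sqF: "?sq ` F = F" by (simp add: endo_inj_surj)
  define v where "v = u mod n"
  have v: "v \<in> units" "v \<noteq> 1"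
    using units_mod[OF u(1)] u1 one_in_units by (auto simp: v_def cong_def units_def)
  have "1 + v \<simeq> 1 + u" by (rule eqv_cong) (simp add: v_def cong_def mod_add_right_eq)
  then have vc: "1 + v \<simeq> c" using u(2) eqv_trans by blast
  then have "v \<notin> F" using in_F by blast
  then have "1 - v \<simeq> 1 \<or> 1 - v \<simeq> - 1" using diff_units[of v] v by (auto simp: F_def)
  then have "(1 - v) * (1 + v) \<simeq> c \<or> (1 - v) * (1 + v) \<simeq> - c"
    using eqv_mult2[of "1 - v" 1 "1 + v" c] eqv_mult2[of "1 - v" "- 1" "1 + v" c] vc by auto
  then have "1 - ?sq v \<simeq> c \<or> 1 - ?sq v \<simeq> - c" using factor eqv_trans by blast
  moreover have "?sq v \<in> units - {1}" using v by (intro sq_mem) simp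
  ultimately have "?sq v \<in> F" unfolding F_def by blast
  then obtain w where w: "w \<in> F" "?sq v = ?sq w" using sqF by (metis (no_types, lifting) imageE)
  then have "w \<in> units" by (simp add: F_def)
  then have "v = w" using inj_onD[OF square_inj_on w(2) v(1)] by blast
  then show False using w(1) \<open>v \<notin> F\<close> by simp
qed

lemma sum_c_nonempty: "S > 0"
proof -
  obtain u where u: "u \<simeq> 1" "[c = 1 + u] (mod n)" using c_sum by blast
  have "1 + u mod n \<simeq> c"
    using cong_sym[OF u(2)] by (intro eqv_cong) (simp add: cong_def mod_add_right_eq)
  then have "u mod n \<in> {u \<in> units. 1 + u \<simeq> c}" using units_mod[OF u(1)] by simp
  then show ?thesis unfolding card_sum_class(3)[symmetric] by (auto simp: card_gt_0_iff)
qed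

text \<open>Here \<open>S = 1\<close>, and \<open>energy\<close> reduces to
  \<open>2 * N * D + D * D = N + D\<close>. With \<open>D > 0\<close> the left side is at least
  \<open>2 * N + D\<close>, so \<open>N = 0\<close> and \<open>D = 1\<close>. The hypothesis on
  \<open>card units\<close> excludes the solution \<open>N = D = 0\<close>.\<close>

lemma card_units_generic:
  assumes cc: "\<not> c * c \<simeq> - 1" and k: "card units > 1"
  shows "card units = 3" "N = 0"
proof -
  have "{u \<in> units. 1 + u \<simeq> c} \<subseteq> {1}"
    using one_plus_unit_generic[OF cc] units_eqI[OF _ one_in_units] by (auto simp: units_def)
  then have "S \<le> card {1::int}" unfolding card_sum_class(3)[symmetric] by (intro card_mono) auto
  then have S: "S = 1" using sum_c_nonempty by simp
  have "L = N + 2 * D" using card_units_sum card_units_diff S by simp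
  with energy S card_units_diff have "4 * (N * D) + 2 * (D * D) = 2 * N + 2 * D"
    by (simp add: algebra_simps)
  then have e: "2 * (N * D) + D * D = N + D" by simp
  have "D \<noteq> 0"
  proof
    assume "D = 0"
    then have "N = 0" using e by simp
    then show False using k card_units_diff \<open>D = 0\<close> by simp
  qed
  then have "N \<le> N * D" "D \<le> D * D" by simp_all
  then have "N * D = N" "D * D = D" "N = 0" using e by linarith+
  then show "card units = 3" "N = 0" using \<open>D \<noteq> 0\<close> card_units_diff by simp_all
qed

text \<open>Now C * C is - K, and this makes the five known sets closed under adding 1, hence
  exhaustive. Sorting the elements \<open>1 + c * y\<close> by class gives one more linear relation,
  \<open>card units = 2 * D + S\<close>. With it \<open>energy\<close> becomes
  \<open>t * t + N * N = t\<close> for \<open>t = D - N\<close>, which forces \<open>N = 0\<close>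
  and \<open>t\<close> to be 0 or 1.\<close>

lemma card_units_quartic:
  assumes cc: "c * c \<simeq> - 1" and k: "card units > 1"
  shows "card units = 3" "N = 0"
proof -
  define Q where "Q x \<longleftrightarrow> n dvd x \<or> x \<simeq> 1 \<or> x \<simeq> - 1 \<or> x \<simeq> c \<or> x \<simeq> - c" for x
  have Q_eqv: "Q x \<Longrightarrow> x \<simeq> y \<Longrightarrow> Q y" for x y
    unfolding Q_def using eqv_dvd_iff eqv_sym eqv_trans by meson
  have Q_minus: "Q (- x)" if "Q x" for x
    using that eqv_uminus[of x] unfolding Q_def by fastforce
  have Q_mult: "Q (v * x)" if "Q x" "v \<simeq> 1" for v x
    using Q_eqv[OF that(1) eqv_sym[OF eqv_1_mult[OF that(2)]]] .
  have Q_sum: "Q (v + w)" if vw: "v \<simeq> 1" "w \<simeq> 1" for v w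
  proof -
    obtain r where r: "r \<simeq> 1" "[v * r = 1] (mod n)" using eqv_1_inverse[OF vw(1)] by blast
    have "r * w \<simeq> 1" using eqv_mult2[of r 1 w 1] r vw by simp
    then have "Q (1 + r * w)" using sum_unit unfolding Q_def by blast
    then have "Q (v * (1 + r * w))" using Q_mult vw by blast
    moreover have "v * (1 + r * w) \<simeq> v + w"
      using cong_scalar_right[OF r(2), of w] by (intro eqv_cong) (simp add: algebra_simps cong_iff_dvd_diff)
    ultimately show ?thesis using Q_eqv by blast
  qed
  have Q_diff: "Q (v - w)" if vw: "v \<simeq> 1" "w \<simeq> 1" for v w
  proof -
    obtain r where r: "r \<simeq> 1" "[v * r = 1] (mod n)" using eqv_1_inverse[OF vw(1)] by blast
    have "r * w \<simeq> 1" using eqv_mult2[of r 1 w 1] r vw by simp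
    then have "Q (1 - r * w)" using diff_unit unfolding Q_def by blast
    then have "Q (v * (1 - r * w))" using Q_mult vw by blast
    moreover have "v * (1 - r * w) \<simeq> v - w"
      using cong_scalar_right[OF r(2), of w]
      by (intro eqv_cong) (simp add: algebra_simps cong_iff_dvd_diff dvd_diff_commute)
    ultimately show ?thesis using Q_eqv by blast
  qed
  obtain u where u: "u \<simeq> 1" "[c = 1 + u] (mod n)" using c_sum by blast
  \<comment> \<open>Elements of C split into two units, so \<open>1 + x\<close> can be regrouped as
    \<open>(1 + v) + v * u\<close> and the class of the first summand is known.\<close>
  have repr: "\<exists>v. v \<simeq> 1 \<and> [x = v + v * u] (mod n)" if x: "x \<simeq> c" for x
  proof -
    obtain v where v: "v \<simeq> 1" "[x = c * v] (mod n)" using eqv_ratio[OF eqv_sym[OF x] not_dvd_c(1)] by blast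
    have "[c * v = (1 + u) * v] (mod n)" using u(2) by (rule cong_scalar_right)
    with v show ?thesis by (intro exI[of _ v]) (simp add: algebra_simps cong_trans[OF v(2)])
  qed
  have Q_succ_c: "Q (1 + x)" if x: "x \<simeq> c" for x
  proof -
    obtain v where v: "v \<simeq> 1" "[x = v + v * u] (mod n)" using repr x by blast
    have vu: "v * u \<simeq> 1" using eqv_mult2[of v 1 u 1] v u by simp
    have x1: "1 + x \<simeq> (1 + v) + v * u"
      using cong_add[OF cong_refl v(2), of 1] by (intro eqv_cong) (simp add: algebra_simps)
    consider "1 + v \<simeq> 1" | "1 + v \<simeq> - 1" | "1 + v \<simeq> c" using sum_unit v by blast
    then have "Q ((1 + v) + v * u)"
    proof cases
      case 1 then show ?thesis using Q_sum vu by blast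
    next
      case 2
      then have "- (1 + v) \<simeq> 1" using eqv_uminus[OF 2] by simp
      then have "Q (v * u - (- (1 + v)))" using Q_diff vu by blast
      then show ?thesis by (simp add: algebra_simps)
    next
      case 3
      \<comment> \<open>\<open>(1 + v) * (1 + u)\<close> is in C * C and so in - K. Subtracting
        \<open>u\<close> from it leaves \<open>1 + v + v * u\<close>, the negative of a sum of two
        units.\<close>
      have "1 + u \<simeq> c" using u(2) by (intro eqv_cong) (rule cong_sym)
      with 3 have "(1 + v) * (1 + u) \<simeq> c * c" by (rule eqv_mult2)
      then have "(1 + v) * (1 + u) \<simeq> - 1" using cc eqv_trans by blast
      then have "- ((1 + v) * (1 + u)) \<simeq> 1" using eqv_uminus[of _ "- 1"] by simp
      then have "Q (- (- ((1 + v) * (1 + u)) + u))" using Q_minus Q_sum u(1) by blast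
      then show ?thesis by (simp add: algebra_simps)
    qed
    then show ?thesis using Q_eqv x1 eqv_sym by blast
  qed
  have Q_pred_c: "Q (x - 1)" if x: "x \<simeq> c" for x
  proof -
    obtain v where v: "v \<simeq> 1" "[x = v + v * u] (mod n)" using repr x by blast
    have vu: "v * u \<simeq> 1" using eqv_mult2[of v 1 u 1] v u by simp
    have x1: "x - 1 \<simeq> v * u - (1 - v)"
      using cong_diff[OF v(2) cong_refl, of 1] by (intro eqv_cong) (simp add: algebra_simps)
    show ?thesis
    proof -
      consider "n dvd 1 - v" | "1 - v \<simeq> 1" | "1 - v \<simeq> - 1" | "\<not> n dvd 1 - v" "1 - v \<simeq> c \<or> 1 - v \<simeq> - c"
        using diff_unit[OF v(1)] by blast
      then have "Q (v * u - (1 - v))"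
      proof cases
        case 1
        then have "v * u - (1 - v) \<simeq> v * u" by (intro eqv_cong) (simp add: cong_iff_dvd_diff dvd_diff_commute)
        then have "v * u - (1 - v) \<simeq> 1" using vu eqv_trans by blast
        then show ?thesis unfolding Q_def by blast
      next
        case 2 then show ?thesis using Q_diff vu by blast
      next
        case 3
        then have "- (1 - v) \<simeq> 1" using eqv_uminus[OF 3] by simp
        then have "Q (v * u + (- (1 - v)))" using Q_sum vu by blast
        then show ?thesis by (simp add: algebra_simps)
      next
        case 4
        have "1 + u \<simeq> c" using u(2) by (intro eqv_cong) (rule cong_sym)
        then have "(1 - v) * (1 + u) \<simeq> c * c \<or> (1 - v) * (1 + u) \<simeq> - c * c"
          using 4(2) eqv_mult2 by blast
        moreover have "- c * c \<simeq> 1" using eqv_uminus[OF cc] by simp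
        ultimately have "(1 - v) * (1 + u) \<simeq> - 1 \<or> (1 - v) * (1 + u) \<simeq> 1"
          using cc eqv_trans by blast
        then have "Q (u - (1 - v) * (1 + u))"
        proof
          assume "(1 - v) * (1 + u) \<simeq> - 1"
          then have "- ((1 - v) * (1 + u)) \<simeq> 1" using eqv_uminus[of _ "- 1"] by simp
          then have "Q (u + (- ((1 - v) * (1 + u))))" using Q_sum u(1) by blast
          then show ?thesis by (simp add: algebra_simps)
        next
          assume "(1 - v) * (1 + u) \<simeq> 1"
          then show ?thesis using Q_diff u(1) by blast
        qed
        moreover have "u - (1 - v) * (1 + u) = v * u - (1 - v)" by (simp add: algebra_simps)
        ultimately show ?thesis by simp
      qed
      then show ?thesis using Q_eqv x1 eqv_sym by blast
    qed
  qed
  have all: "Q x" for x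
  proof (rule everything_by_succ)
    fix x assume "Q x"
    then consider "n dvd x" | "x \<simeq> 1" | "x \<simeq> - 1" | "x \<simeq> c" | "x \<simeq> - c" unfolding Q_def by blast
    then show "Q (1 + x)"
    proof cases
      case 1
      then have "1 + x \<simeq> 1" by (intro eqv_cong) (simp add: cong_iff_dvd_diff)
      then show ?thesis unfolding Q_def by blast
    next
      case 2 then show ?thesis using Q_sum[of 1 x] by simp
    next
      case 3
      then have "- x \<simeq> 1" using eqv_uminus[OF 3] by simp
      then show ?thesis using Q_diff[of 1 "- x"] by simp
    next
      case 4 then show ?thesis by (rule Q_succ_c)
    next
      case 5
      then have "- x \<simeq> c" using eqv_uminus[OF 5] by simp
      then have "Q (- (- x - 1))" using Q_minus Q_pred_c by blast
      then show ?thesis by (simp add: add.commute)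
    qed
  next
    show "Q 0" by (simp add: Q_def)
    show "Q y" if "[x = y] (mod n)" "Q x" for x y using Q_eqv eqv_cong that by blast
  qed
  have card_c: "card {y \<in> units. 1 + c * y \<simeq> z} = sols 1 c (- z)" if "\<not> n dvd z" for z
    using sols_card[of "- z" 1 c] that by simp
  \<comment> \<open>The numbers of \<open>y\<close> with \<open>1 + c * y\<close> in K, - K, C and -
    C are \<open>D\<close>, 0, \<open>D\<close> and \<open>S\<close>. For the last two, scaling by
    \<open>- c\<close> turns the coefficient \<open>c\<close> into \<open>- c * c\<close>, which is
    in K.\<close>
  have h1: "sols 1 c (- 1) = D" using sols_diff sols_swap12 by metis
  have h2: "sols 1 c 1 = 0"
  proof -
    have "sols 1 c 1 = sols 1 1 c" by (rule sols_swap23)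
    also have "\<dots> = card {u \<in> units. 1 + 1 * u \<simeq> - c}" by (rule sols_card[OF not_dvd_c(1)])
    also have "\<dots> = card {u \<in> units. False}"
      by (intro arg_cong[of _ _ card] Collect_cong) (use sum_not_minus_c in \<open>auto simp: units_def\<close>)
    finally show ?thesis by simp
  qed
  have cm: "- c * c \<simeq> 1" using eqv_uminus[OF cc] by simp
  have nd: "\<not> n dvd - c * c" "\<not> n dvd - c * - c" using not_dvd_c by (simp_all add: dvd_mult_iff)
  have "sols 1 c (- c) = sols (- c * 1) (- c * c) (- c * - c)"
    by (rule sols_scale[OF not_dvd_c(2), symmetric])
  also have "\<dots> = sols (- c * 1) 1 (- c * - c)" by (rule sols_eqv2[OF cm nd(1)])
  also have "\<dots> = sols (- c * 1) 1 (- 1)" by (rule sols_eqv3[OF _ nd(2)]) (use cc in simp)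
  finally have h3: "sols 1 c (- c) = D" by (simp add: sols_diff)
  have h4: "sols 1 c c = S"
  proof -
    have "sols 1 c c = sols (- c * 1) (- c * c) (- c * c)"
      by (rule sols_scale[OF not_dvd_c(2), symmetric])
    also have "\<dots> = sols (- c * 1) 1 (- c * c)" by (rule sols_eqv2[OF cm nd(1)])
    also have "\<dots> = sols (- c * 1) 1 1" by (rule sols_eqv3[OF cm nd(1)])
    finally show ?thesis by (simp add: sols_diff)
  qed
  have h5: "card units = card {y \<in> units. 1 + c * y \<simeq> 1} + card {y \<in> units. 1 + c * y \<simeq> - 1}
      + card {y \<in> units. 1 + c * y \<simeq> c} + card {y \<in> units. 1 + c * y \<simeq> - c}"
  proof (rule card_over_classes[OF finite_units])
    fix y assume "y \<in> units"
    then have "c * y \<simeq> c" using eqv_mult[of y 1 c] by (simp add: units_def)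
    moreover have "c * y \<simeq> - 1" if "n dvd 1 + c * y"
      using that by (intro eqv_cong) (simp add: cong_iff_dvd_diff add.commute)
    ultimately have "\<not> n dvd 1 + c * y" using distinct_classes eqv_sym eqv_trans by blast
    then show "1 + c * y \<simeq> 1 \<or> 1 + c * y \<simeq> - 1 \<or> 1 + c * y \<simeq> c \<or> 1 + c * y \<simeq> - c"
      using all[of "1 + c * y"] unfolding Q_def by blast
  qed
  have "card units = 2 * D + S"
    unfolding h5 card_c[OF not_dvd_1] card_c[OF not_dvd_minus_1] card_c[OF not_dvd_c(1)] card_c[OF not_dvd_c(2)]
    by (simp add: h1 h2 h3 h4)
  then have S: "S = 1 + 2 * N" and L: "L + N = 2 * D"
    using card_units_sum card_units_diff by simp_all
  have "int N * N + int L * L + int S * S = int (card units) + 2 * int N * N + 2 * int D * D"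
    using arg_cong[OF energy, of int] by simp
  moreover have "int L = 2 * int D - int N" "int S = 1 + 2 * int N" "int (card units) = 1 + 2 * int N + 2 * int D"
    using L S card_units_diff by linarith+
  ultimately have e: "(int D - int N) * (int D - int N) + int N * int N = int D - int N"
    by (simp add: algebra_simps)
  have "int D - int N = 0 \<or> int D - int N = 1"
  proof (rule ccontr)
    define t where "t = int D - int N"
    assume "\<not> ?thesis"
    then have "t < 0 \<or> t > 1" by (auto simp: t_def)
    then have "t * t > t"
      using mult_neg_neg[of t t] mult_strict_right_mono[of 1 t t] by auto
    moreover have "t * t + int N * int N = t" using e by (simp add: t_def)
    moreover have "int N * int N \<ge> 0" by simp
    ultimately show False by linarith
  qed
  then have "N = 0" using e by auto
  moreover from this have "D = 0 \<or> D = 1" using \<open>int D - int N = 0 \<or> int D - int N = 1\<close> by auto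
  ultimately show "card units = 3" "N = 0" using k card_units_diff by auto
qed

text \<open>The units are the cube roots of unity \<open>1, w, w\<^sup>2\<close>. As \<open>(1 - w)\<^sup>6 = -27\<close> and
  \<open>1 - w\<close> is \<open>\<plusminus>2\<close> times a unit, \<open>n\<close> divides \<open>64 + 27 = 7 \<cdot> 13\<close>.\<close>
lemma card_units_3:
  assumes k: "card units = 3" and N: "N = 0"
  shows "n = 13 \<and> (\<forall>x. a x = 1 \<longleftrightarrow> x mod 13 \<in> {1, 3, 9})"
proof -
  have Un: "x \<simeq> 1" if "x \<in> units" for x using that by (simp add: units_def)
  have "units \<noteq> {1}" using k by auto
  then obtain w where w: "w \<in> units" "w \<noteq> 1" using one_in_units by blast
  let ?w2 = "w * w mod n"
  have w1: "w \<simeq> 1" using Un w by blast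
  have nw: "\<not> n dvd w" "\<not> n dvd 1 - w"
    using dist_one_not_dvd[OF eqv_1_dist[OF w1]] not_dvd_1_minus w by auto
  have w2: "?w2 \<in> units" using units_mod square_units w1 by blast
  have w2_1: "?w2 \<noteq> 1"
    using inj_onD[OF square_inj_on, of w 1] w one_in_units by (auto simp: units_def)
  have w2_w: "?w2 \<noteq> w"
  proof
    assume "?w2 = w"
    then have "n dvd w * w - w" by (metis mod_mod_trivial mod_eq_dvd_iff)
    then have "n dvd w * (1 - w)" using dvd_minus_iff[of n "w * (1 - w)"] by (simp add: algebra_simps)
    then show False using nw by (simp add: dvd_mult_iff)
  qed
  have units: "units = {1, w, ?w2}"
    using w w2 one_in_units w2_1 w2_w k by (intro card_subset_eq[symmetric]) auto
  have "w * w * w \<simeq> 1" using eqv_mult2[OF square_units[OF w1] w1] by simp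
  then have "w * w * w mod n \<in> {1, w, ?w2}" using units_mod units by blast
  moreover have "w * w * w mod n \<noteq> w"
  proof
    assume "w * w * w mod n = w"
    then have "n dvd w * w * w - w" by (metis mod_mod_trivial mod_eq_dvd_iff)
    then have "n dvd w * (w * w - 1)" by (simp add: algebra_simps)
    then have "?w2 = 1 mod n" using nw by (simp add: dvd_mult_iff mod_eq_dvd_iff)
    then show False using w2_1 one_in_units by (simp add: units_def)
  qed
  moreover have "w * w * w mod n \<noteq> ?w2"
  proof
    assume "w * w * w mod n = ?w2"
    then have "n dvd (w * w) * (1 - w)"
      using dvd_minus_iff[of n "(w * w) * (1 - w)"] by (simp add: mod_eq_dvd_iff algebra_simps)
    then show False using nw by (simp add: dvd_mult_iff)
  qed
  ultimately have "w * w * w mod n = 1 mod n" using one_in_units by (simp add: units_def)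
  then have "n dvd (1 - w) * (1 + w + w * w)"
    using dvd_minus_iff[of n "(1 - w) * (1 + w + w * w)"] by (simp add: mod_eq_dvd_iff algebra_simps)
  then have q: "n dvd 1 + w + w * w" using nw by (simp add: dvd_mult_iff)
  \<comment> \<open>As \<open>1 + w + w * w\<close> is 0, adding 1 to \<open>w\<close> or to its
    square leads into - K. The only element of C of the form \<open>1 + u\<close> is therefore
    2.\<close>
  have minus: "1 + x \<simeq> - 1" if x: "x = w \<or> x = ?w2" for x
  proof -
    have "1 + ?w2 \<simeq> - w"
      using q by (intro eqv_cong) (simp add: cong_def mod_eq_dvd_iff mod_add_right_eq algebra_simps)
    moreover have "1 + w \<simeq> - (w * w)"
      using q by (intro eqv_cong) (simp add: cong_iff_dvd_diff algebra_simps)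
    moreover have "- w \<simeq> - 1" "- (w * w) \<simeq> - 1" using eqv_uminus w1 square_units by blast+
    ultimately show ?thesis using x eqv_trans by blast
  qed
  obtain u where u: "u \<in> units" "1 + u \<simeq> c"
    using sum_c_nonempty unfolding card_sum_class(3)[symmetric] by (auto simp: card_gt_0_iff)
  then have "u = 1" using units minus distinct_classes eqv_sym eqv_trans by blast
  then have c2: "2 \<simeq> c" using u by simp
  \<comment> \<open>\<open>N = 0\<close> excludes K and - K for \<open>1 - w\<close>, which leaves C
    and - C, the cosets of 2 and - 2.\<close>
  have "{u \<in> units. 1 - u \<simeq> 1} = {}" "{u \<in> units. 1 - u \<simeq> - 1} = {}"
    using card_diff_class(1,2) N by auto
  then have "1 - w \<simeq> c \<or> 1 - w \<simeq> - c" using diff_unit[OF w1 nw(2)] w(1) by blast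
  then have "2 \<simeq> 1 - w \<or> 2 \<simeq> - (1 - w)"
  proof
    assume "1 - w \<simeq> c" then show ?thesis using c2 eqv_sym eqv_trans by blast
  next
    assume "1 - w \<simeq> - c"
    then have "- (1 - w) \<simeq> c" using eqv_uminus[of "1 - w" "- c"] by simp
    then show ?thesis using c2 eqv_sym eqv_trans by blast
  qed
  moreover have nd2: "\<not> n dvd 2" using c2 eqv_dvd_iff not_dvd_c by blast
  have "\<exists>v. v \<simeq> 1 \<and> [x = 2 * v] (mod n)" if "2 \<simeq> x" for x
    using eqv_ratio[OF that nd2] by blast
  ultimately obtain v where v: "v \<simeq> 1" "[1 - w = 2 * v] (mod n) \<or> [- (1 - w) = 2 * v] (mod n)"
    by blast
  have "[(1 - w) ^ 6 = (2 * v) ^ 6] (mod n)"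
    using v(2)
  proof
    assume "[- (1 - w) = 2 * v] (mod n)"
    then have "[(- (1 - w)) ^ 6 = (2 * v) ^ 6] (mod n)" by (rule cong_pow)
    moreover have "(- (1 - w)) ^ 6 = (1 - w) ^ 6" by (rule power_minus_even) simp
    ultimately show ?thesis by (simp only:)
  qed (rule cong_pow)
  moreover have "[(1 - w) ^ 6 = - 27] (mod n)"
  proof -
    have "[(1 - w) * (1 - w) = - 3 * w] (mod n)"
      using q by (simp add: cong_iff_dvd_diff algebra_simps)
    then have cube: "[((1 - w) * (1 - w)) ^ 3 = (- 3 * w) ^ 3] (mod n)" by (rule cong_pow)
    have e1: "((1 - w) * (1 - w)) ^ 3 = (1 - w) ^ 6" by (simp add: power2_eq_square[symmetric] power_mult[symmetric])
    have e2: "(- 3 * w) ^ 3 = - 27 * (w * w * w)" by (simp add: power3_eq_cube)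
    have "[- 27 * (w * w * w) = - 27 * 1] (mod n)"
      using \<open>w * w * w mod n = 1 mod n\<close> by (intro cong_scalar_left) (simp add: cong_def)
    from cong_trans[OF cube[unfolded e1 e2] this] show ?thesis by simp
  qed
  moreover have "[(2 * v) ^ 6 = 64] (mod n)"
  proof -
    have "v mod n \<in> {1, w, ?w2}" using units_mod v(1) units by blast
    then have "[v ^ 3 = 1] (mod n)"
    proof (elim insertE emptyE)
      have w3: "[w ^ 3 = 1] (mod n)"
        using \<open>w * w * w mod n = 1 mod n\<close> by (simp add: cong_def power3_eq_cube)
      have red: "[v ^ 3 = x ^ 3] (mod n)" if "v mod n = x mod n" for x
        using that by (intro cong_pow) (simp add: cong_def)
      show ?thesis if "v mod n = 1"
        using red[of 1] that prime_gt_1_int[OF prime_n] by simp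
      show ?thesis if "v mod n = w"
      proof -
        have "v mod n = w mod n" using that by (metis mod_mod_trivial)
        from cong_trans[OF red[OF this] w3] show ?thesis .
      qed
      show ?thesis if "v mod n = ?w2"
      proof -
        have "[(w ^ 3) ^ 2 = 1 ^ 2] (mod n)" using w3 by (rule cong_pow)
        moreover have "(w * w) ^ 3 = (w ^ 3) ^ 2" by (simp add: power_mult[symmetric] power2_eq_square[symmetric])
        ultimately have "[(w * w) ^ 3 = 1] (mod n)" by simp
        with red[OF that] show ?thesis by (rule cong_trans)
      qed
    qed
    then have "[(v ^ 3) ^ 2 = 1 ^ 2] (mod n)" by (rule cong_pow)
    then have "[64 * (v ^ 3) ^ 2 = 64 * 1] (mod n)" by (intro cong_scalar_left) simp
    moreover have "64 * (v ^ 3) ^ 2 = (2 * v) ^ 6" by (simp add: power_mult_distrib power_mult[symmetric])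
    ultimately show ?thesis by simp
  qed
  ultimately have "[- 27 = 64] (mod n)" by (meson cong_sym cong_trans)
  then have "n dvd 7 * 13" using dvd_minus_iff[of n "91::int"] by (simp add: cong_iff_dvd_diff)
  then have "n dvd 7 \<or> n dvd 13" by (simp only: dvd_mult_iff)
  moreover have "prime (7::int)" "prime (13::int)" by simp_all
  ultimately have n: "n = 7 \<or> n = 13"
    using prime_n by (metis primes_dvd_imp_eq)
  have wr: "0 \<le> w" "w < n" using w by (simp_all add: units_def)
  \<comment> \<open>Modulo 7 the cube roots of unity are 1, 2 and 4, so 2 would belong to K and not
    to C.\<close>
  have "n \<noteq> 7"
  proof
    assume n7: "n = 7"
    have "w \<in> {0, 1, 2, 3, 4, 5, 6}" using wr n7 by auto
    then have "w = 2 \<or> w = 4" using q n7 by auto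
    then have "w = 2 \<or> ?w2 = 2" using n7 by auto
    then have "2 \<in> units" using w(1) w2 by metis
    then have "2 \<simeq> 1" by (rule Un)
    then show False using c2 distinct_classes eqv_sym eqv_trans by blast
  qed
  then have n13: "n = 13" using n by simp
  have "w \<in> {0, 1, 2, 3, 4, 5, 6, 7, 8, 9, 10, 11, 12}"
    using wr unfolding n13 insert_iff empty_iff by presburger
  then have "w = 3 \<or> w = 9" using q n13 by auto
  then have "{1, w, w * w mod 13} = {1, 3, 9}" by auto
  then have "{1, w, ?w2} = {1, 3, 9}" by (simp only: n13)
  with units have U: "units = {1, 3, 9}" by (rule trans)
  have "a x = 1 \<longleftrightarrow> x mod 13 \<in> {1, 3, 9}" for x
  proof -
    have "a x = 1 \<longleftrightarrow> x mod n \<simeq> 1"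
      using dist_eq_1_iff[of "x mod n"] dist_cong[of "x mod n" x] by (simp add: cong_def)
    also have "\<dots> \<longleftrightarrow> x mod n \<in> units" using n_pos by (simp add: units_def)
    finally have "a x = 1 \<longleftrightarrow> x mod n \<in> {1, 3, 9}" by (simp only: U)
    then show ?thesis by (simp only: n13)
  qed
  with n13 show ?thesis by blast
qed

end

section \<open>The possible connection sets\<close>

context normalized_circulant
begin

theorem classification:
  "(\<forall>x. a x = 1 \<longleftrightarrow> [x = 1] (mod n)) \<or> (\<forall>x. n dvd x \<or> a x = 1 \<or> a (- x) = 1) \<or>
   (n = 13 \<and> (\<forall>x. a x = 1 \<longleftrightarrow> x mod 13 \<in> {1, 3, 9}))"
proof (cases "a (- 1) = 2")
  case False
  then have "4 \<le> a (- 1)" using dist_minus_one_gt_1 dist_minus_one_neq_3 by linarith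
  then show ?thesis using trivial_units by blast
next
  case b: True
  show ?thesis
  proof (cases "\<exists>x. a x = 2 \<and> a (- x) = 3")
    case False
    then show ?thesis using only_two_classes[OF b] by blast
  next
    case True
    then obtain x where x: "a x = 2" "a (- x) = 3" by blast
    then obtain s where s: "a s = 1" "a (x - s) = 1" using dist_stepE[OF x(1)] by auto
    \<comment> \<open>Dividing \<open>x = s + (x - s)\<close> by \<open>s\<close> gives a
      representative of the same class of the form \<open>1 + u\<close>, as
      \<open>four_class_circulant\<close> demands.\<close>
    obtain r where r: "r \<simeq> 1" "[s * r = 1] (mod n)" using eqv_1_inverse[OF eqv_1_if[OF s(1)]] by blast
    define u where "u = r * (x - s)"
    have u1: "u \<simeq> 1" using eqv_mult2[OF r(1) eqv_1_if[OF s(2)]] by (simp add: u_def)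
    have "[s * (1 + u) = x] (mod n)"
      using cong_scalar_right[OF r(2), of "x - s"] by (simp add: u_def algebra_simps cong_iff_dvd_diff)
    then have "s * (1 + u) \<simeq> x" by (rule eqv_cong)
    moreover have "s * (1 + u) \<simeq> 1 + u" using eqv_1_mult[OF eqv_1_if[OF s(1)]] .
    ultimately have "1 + u \<simeq> x" using eqv_sym eqv_trans by blast
    then have c: "a (1 + u) = 2" "a (- (1 + u)) = 3" using x by (simp_all add: eqv_def)
    interpret four_class_circulant n a "1 + u"
      by unfold_locales (use b c u1 in auto)
    show ?thesis
    proof (cases "card units > 1")
      case True
      then have "card units = 3 \<and> N = 0" using card_units_generic card_units_quartic by blast
      then show ?thesis using card_units_3 by blast
    next
      case False
      \<comment> \<open>The counting arguments do not exclude a trivial K, but that is the first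
        alternative.\<close>
      then have "card units = 1" using card_units_pos by linarith
      then have U: "units = {1}" using one_in_units by (metis card_1_singletonE singletonD)
      have "a x = 1 \<longleftrightarrow> [x = 1] (mod n)" for x
      proof
        assume "a x = 1"
        then have "x mod n = 1" using units_mod[OF eqv_1_if] U by blast
        then show "[x = 1] (mod n)" using prime_gt_1_int[OF prime_n] by (simp add: cong_def)
      next
        assume "[x = 1] (mod n)" then show "a x = 1" using dist_cong dist_1 by metis
      qed
      then show ?thesis by blast
    qed
  qed
qed

end

subsection \<open>Polynomials acting on functions by translation\<close>

text \<open>A model of the group ring: the variable acts as translation by 1. Acting on functions
  that are periodic modulo \<open>n\<close> takes the place of the quotient by X^n - 1.\<close>

definition shift_action :: "int poly \<Rightarrow> (int \<Rightarrow> int) \<Rightarrow> int \<Rightarrow> int" where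
  "shift_action P \<phi> z = (\<Sum>i\<le>degree P. coeff P i * \<phi> (z - int i))"

lemma shift_action_bound:
  assumes "degree P \<le> N" shows "shift_action P \<phi> z = (\<Sum>i\<le>N. coeff P i * \<phi> (z - int i))"
  unfolding shift_action_def
  by (rule sum.mono_neutral_left) (use assms in \<open>auto simp: coeff_eq_0\<close>)

lemma shift_action_add: "shift_action (P + Q) \<phi> z = shift_action P \<phi> z + shift_action Q \<phi> z"
proof -
  let ?N = "max (degree P) (degree Q)"
  show ?thesis
    using degree_add_le_max[of P Q]
    by (simp add: shift_action_bound[of _ ?N] sum.distrib algebra_simps)
qed

lemma shift_action_0 [simp]: "shift_action 0 \<phi> z = 0"
  by (simp add: shift_action_def)

lemma shift_action_smult: "shift_action (smult c P) \<phi> z = c * shift_action P \<phi> z"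
  by (simp add: shift_action_bound[of _ "degree P"] degree_smult_le sum_distrib_left mult.assoc)

lemma shift_action_pCons: "shift_action (pCons c P) \<phi> z = c * \<phi> z + shift_action P \<phi> (z - 1)"
proof -
  have "degree (pCons c P) \<le> Suc (degree P)" by (simp add: degree_pCons_le)
  then show ?thesis
    by (simp add: shift_action_bound[of _ "Suc (degree P)"] shift_action_def sum.atMost_Suc_shift algebra_simps
        del: sum.atMost_Suc)
qed

lemma shift_action_mult: "shift_action (P * Q) \<phi> z = shift_action P (shift_action Q \<phi>) z"
  by (induction P arbitrary: z)
     (simp_all add: shift_action_add shift_action_smult shift_action_pCons)

lemma shift_action_monom: "shift_action (monom 1 k) \<phi> z = \<phi> (z - int k)"
proof (induction k arbitrary: z)
  case 0
  have "monom (1::int) 0 = pCons 1 0" by (simp add: monom_0)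
  then show ?case by (simp only: shift_action_pCons) simp
qed (simp add: monom_Suc shift_action_pCons algebra_simps)

lemma shift_action_sum: "shift_action (\<Sum>w\<in>W. P w) \<phi> z = (\<Sum>w\<in>W. shift_action (P w) \<phi> z)"
  by (induction W rule: infinite_finite_induct) (simp_all add: shift_action_add)

text \<open>The Frobenius identity modulo \<open>q\<close>, with the error kept as an explicit
  multiple of \<open>q\<close> because it is used over the integers.\<close>

lemma binomial_prime_power:
  fixes x y :: "'r::comm_ring_1"
  assumes "prime q" shows "\<exists>r. (x + y) ^ q = x ^ q + y ^ q + of_nat q * r"
proof -
  have "\<exists>r. of_nat (q choose k) * x ^ k * y ^ (q - k) = of_nat q * r" if k: "k \<in> {1..<q}" for k
  proof -
    have "q dvd q choose k" by (rule dvd_choose_prime) (use k assms in auto)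
    then obtain t where "q choose k = q * t" by (elim dvdE)
    then show ?thesis by (intro exI[of _ "of_nat t * x ^ k * y ^ (q - k)"]) (simp add: algebra_simps)
  qed
  then obtain r where r: "\<And>k. k \<in> {1..<q} \<Longrightarrow> of_nat (q choose k) * x ^ k * y ^ (q - k) = of_nat q * r k" by metis
  have q0: "q > 0" using assms by (rule prime_gt_0_nat)
  then have "{..q} = insert 0 (insert q {1..<q})" by auto
  then have "(x + y) ^ q = (\<Sum>k\<in>insert 0 (insert q {1..<q}). of_nat (q choose k) * x ^ k * y ^ (q - k))"
    by (simp only: binomial_ring)
  also have "\<dots> = y ^ q + x ^ q + (\<Sum>k\<in>{1..<q}. of_nat (q choose k) * x ^ k * y ^ (q - k))"
    using q0 by simp
  also have "(\<Sum>k\<in>{1..<q}. of_nat (q choose k) * x ^ k * y ^ (q - k)) = of_nat q * (\<Sum>k\<in>{1..<q}. r k)"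
    using r by (simp add: sum_distrib_left)
  finally show ?thesis by (intro exI[of _ "\<Sum>k\<in>{1..<q}. r k"]) (simp add: algebra_simps)
qed

lemma sum_prime_power:
  fixes f :: "'i \<Rightarrow> 'r::comm_ring_1"
  assumes "prime q" "finite W"
  shows "\<exists>r. (\<Sum>w\<in>W. f w) ^ q = (\<Sum>w\<in>W. f w ^ q) + of_nat q * r"
  using assms(2)
proof induction
  case empty
  show ?case using prime_gt_0_nat[OF assms(1)] by (intro exI[of _ 0]) (simp add: zero_power)
next
  case (insert w W)
  obtain r where r: "(\<Sum>w\<in>W. f w) ^ q = (\<Sum>w\<in>W. f w ^ q) + of_nat q * r" using insert by blast
  obtain t where t: "(f w + (\<Sum>w\<in>W. f w)) ^ q = f w ^ q + (\<Sum>w\<in>W. f w) ^ q + of_nat q * t"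
    using binomial_prime_power[OF assms(1)] by blast
  show ?case using insert r t by (intro exI[of _ "r + t"]) (simp add: algebra_simps)
qed

subsection \<open>Primitive translation schemes on a cyclic group\<close>

lemma int_div_less:
  fixes w :: int
  assumes "w < q * m" "m > 0" shows "w div m < q"
proof -
  have "w div m * m < q * m"
    using assms by (intro le_less_trans[OF _ assms(1)]) (simp add: minus_mod_eq_div_mult[symmetric])
  then show ?thesis using assms(2) by simp
qed

text \<open>\<open>S\<close> is a union of cosets of the subgroup of multiples of \<open>m\<close>.
  Writing \<open>w = r + m * i\<close> splits off a factor with \<open>q\<close> values.\<close>

lemma dvd_card_translation_invariant:
  fixes m n q :: int
  assumes n: "n = q * m" and pos: "m > 0" "q > 0"
    and S: "S \<subseteq> {0..<n}" and inv: "\<And>w. w \<in> S \<Longrightarrow> (w + m) mod n \<in> S"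
  shows "nat q dvd card S"
proof -
  have it: "(w + m * int j) mod n \<in> S" if "w \<in> S" for w j
  proof (induction j)
    case 0
    have "w mod n = w" using S that by auto
    then show ?case using that by simp
  next
    case (Suc j)
    have "((w + m * int j) mod n + m) mod n = (w + m * int (Suc j)) mod n"
      unfolding mod_add_left_eq by (simp add: algebra_simps)
    then show ?case using inv[OF Suc] by simp
  qed
  let ?R = "(\<lambda>w. w mod m) ` S"
  have "bij_betw (\<lambda>(r, i). r + m * i) (?R \<times> {0..<q}) S"
  proof (rule bij_betwI[of _ _ _ "\<lambda>w. (w mod m, w div m)"])
    show "(\<lambda>(r, i). r + m * i) \<in> ?R \<times> {0..<q} \<rightarrow> S"
    proof clarsimp
      fix w i assume w: "w \<in> S" and i: "0 \<le> i" "i < q"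
      \<comment> \<open>The wanted number of translations by \<open>m\<close> is
        \<open>i - w div m\<close>; adding a multiple of the period \<open>q\<close> makes it
        nonnegative.\<close>
      define j where "j = i - w div m + q * \<bar>w div m\<bar>"
      have "\<bar>w div m\<bar> \<le> q * \<bar>w div m\<bar>" using pos by (simp add: mult_le_cancel_right1)
      then have "0 \<le> j" using i by (simp add: j_def)
      then have "(w + m * j) mod n \<in> S" using it[OF w, of "nat j"] by simp
      also have "w + m * j = (w mod m + m * i) + n * \<bar>w div m\<bar>"
        using mod_div_mult_eq[of w m] by (simp add: j_def n algebra_simps)
      also have "\<dots> mod n = w mod m + m * i"
      proof -
        have "m * (i + 1) \<le> m * q" using i pos by (intro mult_left_mono) auto
        then have "m * i + m \<le> n" by (simp add: n algebra_simps)
        moreover have "w mod m \<ge> 0" "w mod m < m" "0 \<le> m * i" using pos i by simp_all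
        ultimately have "0 \<le> w mod m + m * i" "w mod m + m * i < n" by linarith+
        then show ?thesis by simp
      qed
      finally show "w mod m + m * i \<in> S" .
    qed
    show "(\<lambda>w. (w mod m, w div m)) \<in> S \<rightarrow> ?R \<times> {0..<q}"
    proof
      fix w assume w: "w \<in> S"
      then have "0 \<le> w" "w < q * m" using S n by auto
      then have "0 \<le> w div m" "w div m < q"
        using pos int_div_less by (simp_all add: pos_imp_zdiv_nonneg_iff)
      then show "(w mod m, w div m) \<in> ?R \<times> {0..<q}" using w by auto
    qed
  qed (use pos in auto)
  then have "card S = card (?R \<times> {0..<q})" by (metis bij_betw_same_card)
  then have "card S = card ?R * nat q" by (simp add: card_cartesian_product)
  then show ?thesis by (metis dvd_triv_right)
qed

text \<open>The scheme axiom in translation-invariant form: the cardinality is the number of paths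
  from 0 to \<open>z\<close> through some \<open>w\<close>, an intersection number.\<close>

locale circulant_scheme = circulant_distance +
  assumes intersection: "z \<simeq> z' \<Longrightarrow>
      card {w \<in> {0..<n}. w \<simeq> u \<and> z - w \<simeq> v} = card {w \<in> {0..<n}. w \<simeq> u \<and> z' - w \<simeq> v}"
begin

definition rel :: "int \<Rightarrow> int set" where
  "rel u = {w \<in> {0..<n}. w \<simeq> u}"

lemma finite_rel [simp]: "finite (rel u)"
  by (rule finite_subset[of _ "{0..<n}"]) (auto simp: rel_def)

definition class_function :: "(int \<Rightarrow> int) \<Rightarrow> bool" where
  "class_function \<phi> \<longleftrightarrow> (\<forall>z z'. z \<simeq> z' \<longrightarrow> \<phi> z = \<phi> z')"

definition class_poly :: "int \<Rightarrow> int poly" where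
  "class_poly u = (\<Sum>w\<in>rel u. monom 1 (nat w))"

lemma shift_action_class_poly: "shift_action (class_poly u) \<phi> z = (\<Sum>w\<in>rel u. \<phi> (z - w))"
  unfolding class_poly_def shift_action_sum shift_action_monom
  by (rule sum.cong) (auto simp: rel_def)

lemma eqv_mod [simp]: "x mod n \<simeq> y \<longleftrightarrow> x \<simeq> y"
proof -
  have "x mod n \<simeq> x" by (rule eqv_cong) (simp add: cong_def)
  then show ?thesis using eqv_sym eqv_trans by blast
qed

lemma diff_mod_eqv [simp]: "x - y mod n \<simeq> z \<longleftrightarrow> x - y \<simeq> z"
proof -
  have "x - y mod n \<simeq> x - y" by (intro eqv_cong cong_diff) (auto simp: cong_def)
  then show ?thesis using eqv_sym eqv_trans by blast
qed

text \<open>Group the sum over \<open>w\<close> by the class of \<open>y - w\<close>; the sizes of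
  the groups are intersection numbers. This is the closure of a Schur ring under products.\<close>

lemma class_function_convolution:
  assumes \<phi>: "class_function \<phi>" shows "class_function (shift_action (class_poly u) \<phi>)"
  unfolding class_function_def shift_action_class_poly
proof (intro allI impI)
  fix z z' assume zz: "z \<simeq> z'"
  define \<kappa> where "\<kappa> x = (a x, a (- x))" for x
  have \<kappa>: "\<kappa> x = \<kappa> y \<longleftrightarrow> x \<simeq> y" for x y by (auto simp: \<kappa>_def eqv_def)
  define T where "T = \<kappa> ` {0..<n}"
  have in_T: "\<kappa> x \<in> T" for x
  proof -
    have "\<kappa> x = \<kappa> (x mod n)" using \<kappa> by (metis eqv_mod eqv_refl)
    then show ?thesis using n_pos by (auto simp: T_def)
  qed
  have eq: "(\<Sum>w\<in>rel u. \<phi> (y - w)) = (\<Sum>t\<in>T. \<Sum>w\<in>{w \<in> rel u. \<kappa> (y - w) = t}. \<phi> (y - w))" for y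
    by (rule sum.group[symmetric]) (use in_T in \<open>auto simp: T_def\<close>)
  show "(\<Sum>w\<in>rel u. \<phi> (z - w)) = (\<Sum>w\<in>rel u. \<phi> (z' - w))"
    unfolding eq
  proof (rule sum.cong[OF refl])
    fix t assume "t \<in> T"
    then obtain v where v: "t = \<kappa> v" by (auto simp: T_def)
    have "(\<Sum>w\<in>{w \<in> rel u. \<kappa> (y - w) = t}. \<phi> (y - w)) = int (card {w \<in> {0..<n}. w \<simeq> u \<and> y - w \<simeq> v}) * \<phi> v" for y
    proof -
      have "{w \<in> rel u. \<kappa> (y - w) = t} = {w \<in> {0..<n}. w \<simeq> u \<and> y - w \<simeq> v}"
        by (auto simp: rel_def v \<kappa>)
      moreover have "(\<Sum>w\<in>{w \<in> {0..<n}. w \<simeq> u \<and> y - w \<simeq> v}. \<phi> (y - w)) = (\<Sum>w\<in>{w \<in> {0..<n}. w \<simeq> u \<and> y - w \<simeq> v}. \<phi> v)"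
        by (rule sum.cong[OF refl]) (use \<phi> in \<open>auto simp: class_function_def\<close>)
      ultimately show ?thesis by simp
    qed
    then show "(\<Sum>w\<in>{w \<in> rel u. \<kappa> (z - w) = t}. \<phi> (z - w)) = (\<Sum>w\<in>{w \<in> rel u. \<kappa> (z' - w) = t}. \<phi> (z' - w))"
      using intersection[OF zz] by simp
  qed
qed

text \<open>In the group ring, the \<open>q\<close>-th power of the class sum of \<open>u\<close> agrees modulo \<open>q\<close> with the
  sum of the multiples \<open>q w\<close> of its elements.\<close>
lemma card_multiples_cong:
  assumes q: "prime q" and zz: "z \<simeq> z'"
  shows "[card {w \<in> rel u. n dvd z - int q * w} = card {w \<in> rel u. n dvd z' - int q * w}] (mod q)"
proof -
  \<comment> \<open>The indicator of 0 is a class function because 0 is a class of its own. Acting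
    on it reads off the coefficients of a group ring element.\<close>
  define \<delta> :: "int \<Rightarrow> int" where "\<delta> x = of_bool (n dvd x)" for x
  have "class_function (shift_action (class_poly u ^ k) \<delta>)" for k
  proof (induction k)
    case 0
    have "shift_action 1 \<delta> = \<delta>"
      using shift_action_monom[of 0 \<delta>] by (auto simp: monom_0 one_pCons)
    moreover have "class_function \<delta>" using eqv_dvd_iff by (auto simp: class_function_def \<delta>_def)
    ultimately show ?case by simp
  next
    case (Suc k)
    have "shift_action (class_poly u ^ Suc k) \<delta> = shift_action (class_poly u) (shift_action (class_poly u ^ k) \<delta>)"
      by (rule ext) (simp add: shift_action_mult)
    then show ?case using class_function_convolution[OF Suc] by simp
  qed
  then have 1: "shift_action (class_poly u ^ q) \<delta> z = shift_action (class_poly u ^ q) \<delta> z'"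
    using zz by (simp add: class_function_def)
  obtain R where R: "class_poly u ^ q = (\<Sum>w\<in>rel u. monom 1 (nat w) ^ q) + of_nat q * R"
    using sum_prime_power[OF q, of "rel u" "\<lambda>w. monom 1 (nat w)"] unfolding class_poly_def by auto
  have 2: "shift_action (class_poly u ^ q) \<delta> y = int (card {w \<in> rel u. n dvd y - int q * w}) + int q * shift_action R \<delta> y" for y
  proof -
    have "of_nat q * R = smult (int q) R" by (simp add: of_nat_poly)
    then have "shift_action (class_poly u ^ q) \<delta> y
        = (\<Sum>w\<in>rel u. shift_action (monom 1 (nat w) ^ q) \<delta> y) + int q * shift_action R \<delta> y"
      by (simp add: R shift_action_add shift_action_sum shift_action_smult)
    also have "(\<Sum>w\<in>rel u. shift_action (monom 1 (nat w) ^ q) \<delta> y) = (\<Sum>w\<in>rel u. of_bool (n dvd y - int q * w))"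
      by (rule sum.cong[OF refl]) (auto simp: monom_power shift_action_monom \<delta>_def rel_def mult.commute)
    also have "\<dots> = int (card {w \<in> rel u. n dvd y - int q * w})"
      by (simp add: sum.If_cases of_bool_def Int_def)
    finally show ?thesis .
  qed
  have "int q dvd int (card {w \<in> rel u. n dvd z - int q * w}) - int (card {w \<in> rel u. n dvd z' - int q * w})"
    using 1 unfolding 2 by (intro dvdI[of _ _ "shift_action R \<delta> z' - shift_action R \<delta> z"]) (simp add: algebra_simps)
  then show ?thesis by (simp add: cong_iff_dvd_diff flip: cong_int_iff)
qed

text \<open>For \<open>int q * x\<close> the count in \<open>card_multiples_cong\<close> is 1, since
  \<open>q\<close> is invertible. For \<open>z\<close> it is then 1 modulo \<open>q\<close> and
  cannot be 0.\<close>

lemma eqv_multiple: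
  assumes n: "prime n" and q: "prime q" "\<not> n dvd int q" and z: "z \<simeq> int q * x"
  shows "\<exists>x'. x' \<simeq> x \<and> [z = int q * x'] (mod n)"
proof -
  let ?M = "\<lambda>z. {w \<in> rel x. n dvd z - int q * w}"
  have "?M (int q * x) = {x mod n}"
  proof (intro subset_antisym subsetI)
    fix w assume w: "w \<in> ?M (int q * x)"
    then have "n dvd int q * (x - w)" by (simp add: algebra_simps)
    then have "n dvd x - w" using n q(2) by (simp add: prime_dvd_mult_iff)
    then have "x mod n = w mod n" by (simp add: mod_eq_dvd_iff)
    then show "w \<in> {x mod n}" using w by (simp add: rel_def)
  next
    fix w assume "w \<in> {x mod n}"
    then have w: "w = x mod n" by simp
    have "n dvd x - x mod n" by (simp add: mod_eq_dvd_iff[symmetric])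
    then have "n dvd int q * (x - x mod n)" by (rule dvd_mult)
    then show "w \<in> ?M (int q * x)" using n_pos by (simp add: w rel_def algebra_simps)
  qed
  then have "[card (?M z) = 1] (mod q)" using card_multiples_cong[OF q(1) z, of x] by simp
  moreover have "\<not> [0 = 1] (mod q)" using prime_gt_1_nat[OF q(1)] by (simp add: cong_def)
  ultimately have "card (?M z) \<noteq> 0" by metis
  then obtain w where "w \<in> ?M z" by (metis card.empty ex_in_conv)
  then show ?thesis by (intro exI[of _ w]) (auto simp: rel_def cong_iff_dvd_diff)
qed

text \<open>\<open>eqv_multiple\<close>, used for one prime factor of a natural number
  \<open>k\<close> after another, divides a class by \<open>k\<close>. Multiplication by
  \<open>t\<close> is division by a natural number inverse to \<open>t\<close>.\<close>

lemma eqv_mult_of_prime: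
  assumes n: "prime n" and xy: "x \<simeq> y" shows "t * x \<simeq> t * y"
proof (cases "n dvd t")
  case True
  then show ?thesis using eqv_0_iff[of "t * x"] eqv_0_iff[of "t * y"] eqv_sym eqv_trans dvd_mult2 by meson
next
  case False
  have multiple: "\<exists>x'. x' \<simeq> x \<and> [z = int k * x'] (mod n)"
    if "\<not> n dvd int k" "z \<simeq> int k * x" for k z x
    using that
  proof (induction k arbitrary: z x rule: prime_divisors_induct)
    case zero then show ?case by simp
  next
    case (unit k)
    then show ?case by (intro exI[of _ z]) simp
  next
    case (factor q k)
    then have nd: "\<not> n dvd int q" "\<not> n dvd int k" by (auto simp: dvd_mult2)
    have "z \<simeq> int q * (int k * x)" using factor.prems by (simp add: mult.assoc)
    then obtain y where y: "y \<simeq> int k * x" "[z = int q * y] (mod n)"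
      using eqv_multiple[OF n factor.hyps nd(1)] by blast
    then obtain x' where x': "x' \<simeq> x" "[y = int k * x'] (mod n)" using factor.IH[OF nd(2)] by blast
    have "[int q * y = int q * (int k * x')] (mod n)" using x'(2) by (rule cong_scalar_left)
    with y(2) have "[z = int q * (int k * x')] (mod n)" by (rule cong_trans)
    then show ?case using x'(1) by (intro exI[of _ x']) (simp add: mult.assoc)
  qed
  obtain r where r: "[t * r = 1] (mod n)" using prime_inverse_mod[OF n False] .
  define k where "k = nat (r mod n)"
  have k: "[int k * t = 1] (mod n)"
  proof -
    have "[r mod n * t = r * t] (mod n)" by (intro cong_scalar_right) (simp add: cong_def)
    then show ?thesis using r n_pos cong_trans by (simp add: k_def mult.commute) blast
  qed
  then have "\<not> n dvd int k"
    using n cong_dvd_iff[OF k] by (metis dvd_mult2 not_prime_unit)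
  moreover have red: "[int k * (t * z) = z] (mod n)" for z
    using cong_scalar_right[OF k, of z] by (simp add: mult.assoc)
  then have "y \<simeq> int k * (t * x)" using xy by (meson cong_sym eqv_cong eqv_sym eqv_trans)
  ultimately obtain x' where x': "x' \<simeq> t * x" "[y = int k * x'] (mod n)" using multiple by blast
  have "[t * y = t * (int k * x')] (mod n)" using x'(2) by (rule cong_scalar_left)
  also have "t * (int k * x') = int k * (t * x')" by (simp add: algebra_simps)
  also note red
  finally have "t * y \<simeq> x'" by (rule eqv_cong)
  then show ?thesis using x'(1) eqv_sym eqv_trans by blast
qed

end

text \<open>Primitivity in terms of subgroups of Z_n: a subgroup \<open>H\<close> that contains one
  entire nonzero class is everything. \<open>H\<close> may cut through other classes;
  \<open>primitive_circulant_schemeI\<close> derives this form.\<close>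

locale primitive_circulant_scheme = circulant_scheme +
  assumes primitive: "\<lbrakk>\<And>x y. H x \<Longrightarrow> H y \<Longrightarrow> H (y - x); \<And>x y. [x = y] (mod n) \<Longrightarrow> H x \<Longrightarrow> H y;
      \<not> n dvd z; \<And>z'. z' \<simeq> z \<Longrightarrow> H z'\<rbrakk> \<Longrightarrow> H x"
    and not_symmetric: "\<exists>s. a s = 1 \<and> a (- s) \<noteq> 1"
begin

lemma n_not_1: "n \<noteq> 1"
proof
  assume "n = 1"
  then have "a x = a y" for x y by (intro dist_cong) simp
  then show False using not_symmetric by metis
qed

section \<open>Composite order is impossible\<close>

context
  fixes q m :: int
  assumes n: "n = q * m" and q: "prime q" and m: "m > 1"
begin

lemma q_pos: "q > 1" using prime_gt_1_int[OF q] .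

lemma m_dvd_iff: "n dvd q * x \<longleftrightarrow> m dvd x"
  using q_pos by (simp add: n)

lemma m_dvd_if: "n dvd x \<Longrightarrow> m dvd x"
  using n dvd_mult_right by blast

text \<open>These are the cosets of the kernel of multiplication by \<open>q\<close>, the subgroup
  of multiples of \<open>m\<close>, which has order \<open>q\<close>. It is the subgroup meant in
  all that follows.\<close>

lemma card_coset: "card {w \<in> {0..<n}. m dvd x - w} = nat q"
proof -
  have "bij_betw (\<lambda>i. x mod m + m * i) {0..<q} {w \<in> {0..<n}. m dvd x - w}"
  proof (rule bij_betwI[of _ _ _ "\<lambda>w. w div m"])
    show "(\<lambda>i. x mod m + m * i) \<in> {0..<q} \<rightarrow> {w \<in> {0..<n}. m dvd x - w}"
    proof
      fix i assume i: "i \<in> {0..<q}"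
      then have "m * i \<le> m * (q - 1)" "m * i \<ge> 0" using m by simp_all
      moreover have "x mod m \<ge> 0" "x mod m < m" using m by simp_all
      ultimately have "0 \<le> x mod m + m * i" "x mod m + m * i < n" by (simp_all add: n algebra_simps)
      moreover have "m dvd x - (x mod m + m * i)"
        by (simp add: mod_eq_dvd_iff[symmetric])
      ultimately show "x mod m + m * i \<in> {w \<in> {0..<n}. m dvd x - w}" by simp
    qed
    show "(\<lambda>w. w div m) \<in> {w \<in> {0..<n}. m dvd x - w} \<rightarrow> {0..<q}"
    proof
      fix w assume "w \<in> {w \<in> {0..<n}. m dvd x - w}"
      then have w: "0 \<le> w" "w < q * m" by (simp_all add: n)
      then have "w div m < q" using m int_div_less by simp
      then show "w div m \<in> {0..<q}" using w m by (simp add: pos_imp_zdiv_nonneg_iff)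
    qed
    show "x mod m + m * (w div m) = w" if "w \<in> {w \<in> {0..<n}. m dvd x - w}" for w
    proof -
      have "x mod m = w mod m" using that by (simp add: mod_eq_dvd_iff)
      then show ?thesis by simp
    qed
  qed (use m in auto)
  from bij_betw_same_card[OF this] show ?thesis by simp
qed

text \<open>If the coset of \<open>x\<close> were not contained in its class, the elements of the class of \<open>q x\<close>
  would all be multiples of \<open>q\<close>.\<close>
lemma eqv_coset:
  assumes x: "\<not> m dvd x" and y: "m dvd x - y" shows "y \<simeq> x"
proof -
  let ?M = "\<lambda>z. {w \<in> rel x. n dvd z - int (nat q) * w}"
  have M: "?M (q * x) = {w \<in> rel x. m dvd x - w}"
    using q_pos m_dvd_iff by (simp add: right_diff_distrib[symmetric])
  have "nat q dvd card (?M (q * x))"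
  proof (rule ccontr)
    assume nd: "\<not> nat q dvd card (?M (q * x))"
    have H: "q dvd z'" if z': "z' \<simeq> q * x" for z'
    proof -
      have "[card (?M z') = card (?M (q * x))] (mod nat q)"
        using q z' by (intro card_multiples_cong) simp_all
      then have "\<not> nat q dvd card (?M z')" using nd cong_dvd_iff by blast
      then have "?M z' \<noteq> {}" by (metis card.empty dvd_0_right)
      then obtain w where "n dvd z' - q * w" using q_pos by auto
      then have "q dvd z' - q * w" using n dvd_mult_left by blast
      then have "q dvd z' - q * w + q * w" by (intro dvd_add) auto
      then show ?thesis by simp
    qed
    \<comment> \<open>The multiples of \<open>q\<close> would be a proper subgroup containing the
      whole class of \<open>q * x\<close>.\<close>
    have "q dvd 1"
    proof (rule primitive[of "\<lambda>x. q dvd x" "q * x"])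
      show "q dvd y" if "[x = y] (mod n)" "q dvd x" for x y
        using that cong_dvd_iff cong_modulus_mult[of x y q m] n by blast
    qed (use x m_dvd_iff H in auto)
    then show False using q_pos by simp
  qed
  moreover have "n dvd x - x mod n" by (simp add: mod_eq_dvd_iff[symmetric])
  then have "x mod n \<in> ?M (q * x)"
    using m_dvd_if[of "x - x mod n"] n_pos unfolding M by (simp add: rel_def)
  then have "card (?M (q * x)) > 0" by (auto simp: card_gt_0_iff M)
  moreover have sub: "?M (q * x) \<subseteq> {w \<in> {0..<n}. m dvd x - w}" unfolding M by (auto simp: rel_def)
  moreover have fin: "finite {w \<in> {0..<n}. m dvd x - w}" by (rule finite_subset[of _ "{0..<n}"]) auto
  \<comment> \<open>The class of \<open>x\<close> meets the coset of \<open>x\<close> in a positive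
    multiple of \<open>q\<close> elements, and the coset has only \<open>q\<close>.\<close>
  ultimately have "card {w \<in> {0..<n}. m dvd x - w} \<le> card (?M (q * x))"
    unfolding card_coset by (intro dvd_imp_le) auto
  then have eq: "?M (q * x) = {w \<in> {0..<n}. m dvd x - w}" using sub fin by (intro card_seteq) auto
  have "m dvd (y - y mod n)" by (rule m_dvd_if) (simp add: mod_eq_dvd_iff[symmetric])
  then have "m dvd (x - y) + (y - y mod n)" using y by (intro dvd_add)
  then have "y mod n \<in> {w \<in> {0..<n}. m dvd x - w}" using n_pos by simp
  then have "y mod n \<in> rel x" using eq by blast
  then show ?thesis by (simp add: rel_def)
qed

text \<open>A class that avoids the subgroup is invariant under it by \<open>eqv_coset\<close>, so
  its stabiliser \<open>H\<close> contains \<open>m\<close>. In terms of intersection numbers this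
  is a property of the class of \<open>m\<close>: all \<open>w\<close> in the class of
  \<open>x\<close> have \<open>m - w\<close> in the class of \<open>- x\<close>. Hence
  \<open>H\<close> contains the whole class of \<open>m\<close>, is everything by primitivity, and
  moves \<open>x\<close> to 0.\<close>

lemma class_meets_subgroup:
  assumes x: "\<not> n dvd x" shows "\<exists>y. y \<simeq> x \<and> m dvd y"
proof (rule ccontr)
  assume no: "\<not> ?thesis"
  define H where "H t \<longleftrightarrow> (\<forall>y. y \<simeq> x \<longleftrightarrow> y + t \<simeq> x)" for t
  have shift: "y + t \<simeq> x" if "y \<simeq> x" "m dvd t" for y t
    using eqv_coset[of y "y + t"] no that eqv_trans by auto
  have "H (- x)"
  proof (rule primitive[of H m])
    fix s t assume st: "H s" "H t"
    show "H (t - s)" unfolding H_def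
    proof
      fix y
      have "y \<simeq> x \<longleftrightarrow> y - s \<simeq> x" using st(1) unfolding H_def by (metis diff_add_cancel)
      also have "\<dots> \<longleftrightarrow> y - s + t \<simeq> x" using st(2) unfolding H_def by blast
      also have "y - s + t = y + (t - s)" by simp
      finally show "y \<simeq> x \<longleftrightarrow> y + (t - s) \<simeq> x" .
    qed
  next
    fix s t assume st: "[s = t] (mod n)" "H s"
    have "y + s \<simeq> y + t" for y using st(1) by (intro eqv_cong cong_add) auto
    then show "H t" using st(2) eqv_sym eqv_trans unfolding H_def by meson
  next
    show "\<not> n dvd m" using m q_pos by (auto simp: n zdvd_not_zless dest: zdvd_imp_le)
  next
    fix z assume z: "z \<simeq> m"
    have mem: "m - w \<simeq> - x" if "w \<simeq> x" for w
      using eqv_uminus[OF shift[OF that, of "- m"]] by simp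
    have "card {w \<in> {0..<n}. w \<simeq> x \<and> z - w \<simeq> - x} = card {w \<in> {0..<n}. w \<simeq> x \<and> m - w \<simeq> - x}"
      using intersection[OF z] .
    also have "{w \<in> {0..<n}. w \<simeq> x \<and> m - w \<simeq> - x} = rel x" using mem by (auto simp: rel_def)
    finally have "card {w \<in> {0..<n}. w \<simeq> x \<and> z - w \<simeq> - x} = card (rel x)" .
    moreover have "{w \<in> {0..<n}. w \<simeq> x \<and> z - w \<simeq> - x} \<subseteq> rel x" by (auto simp: rel_def)
    ultimately have all: "{w \<in> {0..<n}. w \<simeq> x \<and> z - w \<simeq> - x} = rel x"
      using card_subset_eq[OF finite_rel] by blast
    then have "z - w mod n \<simeq> - x" if "w \<simeq> x" for w
    proof -
      have "w mod n \<in> rel x" using that n_pos by (simp add: rel_def)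
      then show ?thesis using all by blast
    qed
    then have zw: "w mod n - z \<simeq> x" if "w \<simeq> x" for w
      using eqv_uminus[of "z - w mod n" "- x"] that by simp
    have sub: "w - z \<simeq> x" if "w \<simeq> x" for w
    proof -
      have "w - z \<simeq> w mod n - z" by (intro eqv_cong cong_diff) (auto simp: cong_def)
      then show ?thesis using zw[OF that] eqv_trans by blast
    qed
    have subs: "w - int i * z \<simeq> x" if "w \<simeq> x" for w i
    proof (induction i)
      case (Suc i)
      then show ?case using sub[OF Suc] by (simp add: algebra_simps)
    qed (simp add: that)
    show "H z" unfolding H_def
    proof (intro allI iffI)
      fix y assume "y + z \<simeq> x" then show "y \<simeq> x" using sub[of "y + z"] by simp
    next
      fix y assume "y \<simeq> x"
      \<comment> \<open>Only subtraction of \<open>z\<close> is available so far; subtracting it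
        \<open>n - 1\<close> times adds it once.\<close>
      then have "y - int (nat n - 1) * z \<simeq> x" by (rule subs)
      moreover have "y - int (nat n - 1) * z \<simeq> y + z"
        using n_pos by (intro eqv_cong) (simp add: of_nat_diff cong_iff_dvd_diff algebra_simps)
      ultimately show "y + z \<simeq> x" using eqv_sym eqv_trans by blast
    qed
  qed
  then have "x + - x \<simeq> x" unfolding H_def by (meson eqv_refl)
  then show False using x eqv_0_iff eqv_sym by auto
qed

lemma class_leaves_subgroup:
  assumes x: "\<not> n dvd x" shows "\<exists>y. y \<simeq> x \<and> \<not> m dvd y"
proof (rule ccontr)
  assume no: "\<not> ?thesis"
  have "m dvd 1"
  proof (rule primitive[of "\<lambda>x. m dvd x" x])
    show "m dvd y" if "[x = y] (mod n)" "m dvd x" for x y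
      using that cong_dvd_iff cong_modulus_mult[of x y m q] n by (metis mult.commute)
  qed (use no x in auto)
  then show False using m by simp
qed

text \<open>Off the subgroup the classes are unions of cosets by \<open>eqv_coset\<close>, and both
  \<open>w\<close> and \<open>z - w\<close> are off it, so translation by \<open>m\<close> preserves
  the set.\<close>

lemma dvd_card_off_subgroup:
  "nat q dvd card {w \<in> {0..<n}. \<not> m dvd w \<and> \<not> m dvd z - w \<and> w \<simeq> u \<and> z - w \<simeq> v}" (is "_ dvd card ?S")
proof (rule dvd_card_translation_invariant[OF n])
  fix w assume w: "w \<in> ?S"
  have mm: "m dvd x - (x + m) mod n" for x
  proof -
    have "m dvd (x + m) - (x + m) mod n" by (rule m_dvd_if) (simp add: mod_eq_dvd_iff[symmetric])
    from dvd_diff[OF this dvd_refl] have "m dvd (x + m) - (x + m) mod n - m" .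
    moreover have "(x + m) - (x + m) mod n - m = x - (x + m) mod n" by simp
    ultimately show ?thesis by (simp only:)
  qed
  let ?w = "(w + m) mod n"
  have d: "m dvd w - ?w" by (rule mm)
  then have "m dvd w \<longleftrightarrow> m dvd ?w" by (metis dvd_add_left_iff diff_add_cancel dvd_add_right_iff)
  moreover have "m dvd z - w \<longleftrightarrow> m dvd z - ?w"
  proof -
    have "z - ?w = (z - w) + (w - ?w)" by simp
    then show ?thesis using d by (metis dvd_add_left_iff)
  qed
  moreover have "?w \<simeq> w" using eqv_coset[of w ?w] d w by simp
  moreover have "z - ?w \<simeq> z - w"
    using eqv_coset[of "z - w" "z - ?w"] d w dvd_diff_commute[of m w ?w] by simp
  ultimately show "?w \<in> ?S" using w n_pos eqv_trans by auto
qed (use m q_pos in auto)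

text \<open>With \<open>V\<close> the part of the class of \<open>- s\<close> in the subgroup, count the \<open>w\<close> in the class of \<open>s\<close>
  with \<open>z - w\<close> in the class of \<open>- s\<close>, modulo \<open>q\<close>: for \<open>z\<close> outside the subgroup their number is
  \<open>card V\<close>, for \<open>z = x\<close> inside it is the number of \<open>v\<close> in \<open>V\<close> with \<open>x - v\<close> in the class of \<open>s\<close>.\<close>
lemma diff_in_subgroup:
  assumes neq: "\<not> s \<simeq> - s" and nd: "\<not> n dvd s"
    and x: "x \<simeq> s" "m dvd x" and v: "v \<simeq> - s" "m dvd v"
  shows "x - v \<simeq> s"
proof -
  obtain z where z: "z \<simeq> s" "\<not> m dvd z" using class_leaves_subgroup nd by blast
  let ?C = "\<lambda>z. {w \<in> {0..<n}. w \<simeq> s \<and> z - w \<simeq> - s}"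
  let ?P = "\<lambda>z. {w \<in> {0..<n}. \<not> m dvd w \<and> \<not> m dvd z - w \<and> w \<simeq> s \<and> z - w \<simeq> - s}"
  define V where "V = {w \<in> {0..<n}. m dvd w \<and> w \<simeq> - s}"
  define W where "W = {w \<in> {0..<n}. m dvd w \<and> w \<simeq> s \<and> x - w \<simeq> - s}"
  have bij: "card {w \<in> {0..<n}. P w} = card {w \<in> {0..<n}. Q w}"
    if "\<And>w. w \<in> {0..<n} \<Longrightarrow> Q ((y - w) mod n) \<longleftrightarrow> P w" for y P Q
  proof (rule bij_betw_same_card)
    have b: "bij_betw (\<lambda>w. (y - w) mod n) {0..<n} {0..<n}"
      by (rule bij_betwI[of _ _ _ "\<lambda>w. (y - w) mod n"])
         (use n_pos in \<open>auto simp: mod_diff_right_eq\<close>)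
    show "bij_betw (\<lambda>w. (y - w) mod n) {w \<in> {0..<n}. P w} {w \<in> {0..<n}. Q w}"
      by (rule bij_betw_Collect[OF b]) (use that in auto)
  qed
  have m_mod: "m dvd y mod n \<longleftrightarrow> m dvd y" for y
    using n by (simp add: dvd_mod_iff)
  have m_diff: "m dvd y - y' mod n \<longleftrightarrow> m dvd y - y'" for y y'
    by (metis m_mod mod_diff_right_eq)
  have "card (?C x) = card (?C z)"
    using intersection z(1) x(1) eqv_sym eqv_trans by blast
  moreover have "card (?C x) = card (?P x) + card W"
  proof -
    have "?C x = ?P x \<union> W" using x(2) by (auto simp: W_def dvd_diff_right_iff)
    moreover have "?P x \<inter> W = {}" by (auto simp: W_def)
    moreover have "finite (?P x)" "finite W" unfolding W_def by (rule finite_subset[of _ "{0..<n}"]; auto)+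
    ultimately show ?thesis by (simp only: card_Un_disjoint)
  qed
  moreover have "card (?C z) = card (?P z) + card V"
  proof -
    have "?C z = ?P z \<union> {w \<in> {0..<n}. m dvd z - w \<and> z - w \<simeq> - s}"
    proof (intro subset_antisym subsetI)
      fix w assume w: "w \<in> ?C z"
      \<comment> \<open>A \<open>w\<close> in the subgroup would keep \<open>z - w\<close> in the
        coset of \<open>z\<close>, hence in the class of \<open>s\<close> and not of
        \<open>- s\<close>.\<close>
      have "\<not> m dvd w"
      proof
        assume "m dvd w"
        then have "z - w \<simeq> z" using eqv_coset[of z "z - w"] z by simp
        then show False using w z neq eqv_sym eqv_trans by blast
      qed
      then show "w \<in> ?P z \<union> {w \<in> {0..<n}. m dvd z - w \<and> z - w \<simeq> - s}" using w by blast
    next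
      fix w assume w: "w \<in> ?P z \<union> {w \<in> {0..<n}. m dvd z - w \<and> z - w \<simeq> - s}"
      moreover have "w \<simeq> s" if "m dvd z - w" using eqv_coset[OF z(2) that] z(1) eqv_trans by blast
      ultimately show "w \<in> ?C z" by blast
    qed
    moreover have "?P z \<inter> {w \<in> {0..<n}. m dvd z - w \<and> z - w \<simeq> - s} = {}" by auto
    moreover have "finite (?P z)" "finite {w \<in> {0..<n}. m dvd z - w \<and> z - w \<simeq> - s}"
      by (rule finite_subset[of _ "{0..<n}"]; auto)+
    ultimately have "card (?C z) = card (?P z) + card {w \<in> {0..<n}. m dvd z - w \<and> z - w \<simeq> - s}"
      by (simp only: card_Un_disjoint)
    also have "card {w \<in> {0..<n}. m dvd z - w \<and> z - w \<simeq> - s} = card V"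
      unfolding V_def by (rule bij[of _ z]) (simp add: m_mod)
    finally show ?thesis .
  qed
  moreover have "[card (?P y) = 0] (mod nat q)" for y
    using dvd_card_off_subgroup[of y s "- s"] by (simp add: cong_0_iff)
  then have "[card (?P x) + card W = 0 + card W] (mod nat q)" "[card (?P z) + card V = 0 + card V] (mod nat q)"
    by (intro cong_add cong_refl; simp)+
  ultimately have WV: "[card W = card V] (mod nat q)"
    by (metis add_0 cong_sym cong_trans)
  have cW: "card W = card {w \<in> V. x - w \<simeq> s}"
  proof -
    have "card W = card {w \<in> {0..<n}. m dvd x - w \<and> x - w \<simeq> s \<and> w \<simeq> - s}"
      unfolding W_def by (rule bij[of _ x]) (simp add: m_mod m_diff)
    also have "{w \<in> {0..<n}. m dvd x - w \<and> x - w \<simeq> s \<and> w \<simeq> - s} = {w \<in> V. x - w \<simeq> s}"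
      using x(2) by (auto simp: V_def dvd_diff_right_iff)
    finally show ?thesis .
  qed
  have finV: "finite V" unfolding V_def by (rule finite_subset[of _ "{0..<n}"]) auto
  then have "card W \<le> card V" unfolding cW by (intro card_mono) auto
  \<comment> \<open>\<open>V\<close> lies in the subgroup and misses 0. As \<open>card W\<close> is
    at most \<open>card V\<close>, the congruence modulo \<open>q\<close> is then an
    equality.\<close>
  moreover have "card V < nat q"
  proof -
    have "0 \<notin> V" using nd eqv_0_iff[of "- s"] eqv_sym by (auto simp: V_def)
    then have "V \<subset> {w \<in> {0..<n}. m dvd 0 - w}"
      using n_pos by (auto simp: V_def psubset_eq)
    moreover have "finite {w \<in> {0..<n}. m dvd 0 - w}" by (rule finite_subset[of _ "{0..<n}"]) auto
    ultimately have "card V < card {w \<in> {0..<n}. m dvd 0 - w}" by (intro psubset_card_mono)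
    then show ?thesis unfolding card_coset .
  qed
  ultimately have "card {w \<in> V. x - w \<simeq> s} = card V" using WV cW by (simp add: cong_def)
  then have "{w \<in> V. x - w \<simeq> s} = V" by (intro card_subset_eq[OF finV]) auto
  moreover have "v mod n \<in> V" using v n_pos by (simp add: V_def m_mod)
  ultimately have "x - v mod n \<simeq> s" by blast
  then show ?thesis by (simp add: diff_mod_eqv)
qed

text \<open>The classes of \<open>s\<close> and \<open>- s\<close> meet the subgroup in some
  \<open>z\<close> and \<open>v\<close>. Subtracting \<open>v\<close> from \<open>z\<close> again
  and again never leaves the class of \<open>s\<close>; but the subgroup has prime order, so
  \<open>v\<close> generates it and 0 is reached.\<close>

lemma not_composite: False
proof -
  obtain s where s: "a s = 1" "a (- s) \<noteq> 1" using not_symmetric by blast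
  then have nd: "\<not> n dvd s" by (metis dist_0_iff zero_neq_one)
  then have nd': "\<not> n dvd - s" by simp
  have neq: "\<not> s \<simeq> - s" using s by (simp add: eqv_def)
  obtain z where z: "z \<simeq> s" "m dvd z" using class_meets_subgroup nd by blast
  obtain v where v: "v \<simeq> - s" "m dvd v" using class_meets_subgroup nd' by blast
  note step = diff_in_subgroup[OF neq nd _ _ v]
  have steps: "z - int i * v \<simeq> s \<and> m dvd z - int i * v" for i
  proof (induction i)
    case (Suc i)
    then have "z - int i * v - v \<simeq> s" "m dvd z - int i * v - v" using step v(2) by auto
    then show ?case by (simp add: algebra_simps)
  qed (use z in simp)
  obtain v1 z1 where v1: "v = m * v1" and z1: "z = m * z1" using v(2) z(2) by (auto elim!: dvdE)
  have "\<not> q dvd v1"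
  proof
    assume "q dvd v1"
    then have "n dvd v" by (simp add: n v1)
    then show False using eqv_dvd_iff v(1) nd' by blast
  qed
  then obtain r where r: "[v1 * r = 1] (mod q)" using prime_inverse_mod q by blast
  define i where "i = nat ((r * z1) mod q)"
  have "[int i * v1 = z1] (mod q)"
  proof -
    have "[(r * z1) mod q * v1 = r * z1 * v1] (mod q)" by (intro cong_scalar_right) (simp add: cong_def)
    also have "[r * z1 * v1 = z1] (mod q)" using cong_scalar_right[OF r, of z1] by (simp add: algebra_simps)
    finally show ?thesis using q_pos by (simp add: i_def)
  qed
  then have "q dvd z1 - int i * v1" by (simp add: cong_iff_dvd_diff dvd_diff_commute)
  then have "n dvd m * (z1 - int i * v1)" by (simp add: n mult.commute)
  then have "n dvd z - int i * v" by (simp add: v1 z1 algebra_simps)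
  then show False using steps eqv_dvd_iff nd by blast
qed

end

section \<open>Prime order, and the connection set up to scaling\<close>

theorem prime_order: "prime n"
proof (rule ccontr)
  assume np: "\<not> prime n"
  have "n > 1" using n_pos n_not_1 by linarith
  then obtain q where q: "prime q" "q dvd n" using prime_divisor_exists[of n] by auto
  then obtain m where n: "n = q * m" by (elim dvdE)
  have "m \<noteq> 1" using np q(1) n by auto
  moreover have "m > 0" using n n_pos prime_gt_0_int[OF q(1)] by (simp add: zero_less_mult_iff)
  ultimately show False using not_composite[OF n q(1)] by simp
qed

text \<open>Scaling a step \<open>s\<close> with the shortest way back to 1 leads into
  \<open>normalized_circulant\<close>. In the second case closure under products is recorded too,
  since \<open>half_units_even_power\<close> needs it to recognise K.\<close>

theorem connection_set_classification:
  "prime n \<and> (\<exists>s. a s = 1 \<and> a (- s) \<noteq> 1 \<and>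
    ((\<forall>x. a (s * x) = 1 \<longleftrightarrow> [x = 1] (mod n)) \<or>
     ((\<forall>x. n dvd x \<or> a (s * x) = 1 \<or> a (- (s * x)) = 1) \<and>
      (\<forall>x y. a (s * x) = 1 \<longrightarrow> a (s * y) = 1 \<longrightarrow> a (s * (x * y)) = 1)) \<or>
     (n = 13 \<and> (\<forall>x. a (s * x) = 1 \<longleftrightarrow> x mod 13 \<in> {1, 3, 9}))))"
proof -
  obtain s0 where s0: "a s0 = 1" "a (- s0) \<noteq> 1" using not_symmetric by blast
  obtain s where s: "a s = 1" "\<And>t. a t = 1 \<Longrightarrow> a (- s) \<le> a (- t)"
    using ex_has_least_nat[of "\<lambda>t. a t = 1" s0 "\<lambda>t. a (- t)"] s0 by blast
  have nd: "\<not> n dvd s" using s(1) by (metis dist_0_iff zero_neq_one)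
  interpret P: prime_circulant n a
    by unfold_locales (use prime_order eqv_mult_of_prime not_symmetric in auto)
  obtain r where r: "[s * r = 1] (mod n)" using P.inverse_mod nd by blast
  have sr: "[s * (r * x) = x] (mod n)" for x
    using cong_scalar_right[OF r, of x] by (simp add: mult.assoc)
  have asr: "a (s * (r * x)) = a x" for x using sr dist_cong by blast
  interpret D: circulant_distance n "\<lambda>x. a (s * x)"
  proof
    show "a (s * x) = a (s * y)" if "[x = y] (mod n)" for x y
      using cong_scalar_left[OF that] dist_cong by blast
    show "a (s * x) = 0 \<longleftrightarrow> n dvd x" for x using P.dvd_mult_iff nd by (simp add: dist_0_iff)
    show "a (s * (x + y)) \<le> a (s * x) + a (s * y)" for x y
      using dist_triangle[of "s * x" "s * y"] by (simp add: distrib_left)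
    show "\<exists>t. a (s * t) = 1 \<and> a (s * (x - t)) = d" if sx: "a (s * x) = Suc d" for x d
    proof -
      obtain t where t: "a t = 1" "a (s * x - t) = d" using dist_step[OF sx] by blast
      have "a (s * (x - r * t)) = a (s * x - t)"
        unfolding right_diff_distrib by (intro dist_cong cong_diff cong_refl sr)
      then show ?thesis using t asr by (intro exI[of _ "r * t"]) simp
    qed
  qed (rule n_pos)
  interpret N: normalized_circulant n "\<lambda>x. a (s * x)"
  proof
    show "prime n" by (rule prime_order)
    show "D.eqv (t * x) (t * y)" if "D.eqv x y" for x y t
    proof -
      have "s * x \<simeq> s * y" using that by (simp add: D.eqv_def eqv_def)
      then have "t * (s * x) \<simeq> t * (s * y)" using eqv_mult_of_prime prime_order by blast
      then show ?thesis by (simp add: D.eqv_def eqv_def mult.left_commute)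
    qed
    show "\<exists>x. a (s * x) = 1 \<and> a (s * - x) \<noteq> 1"
      using s0 asr[of s0] asr[of "- s0"] by (intro exI[of _ "r * s0"]) simp
    show "a (s * 1) = 1" using s by simp
    show "a (s * - 1) \<le> a (s * - x)" if "a (s * x) = 1" for x using s(2) that by simp
  qed
  have "a (s * (x * y)) = 1" if "a (s * x) = 1" "a (s * y) = 1" for x y
    using N.dist_unit_mult[OF N.eqv_1_if[OF that(1)], of y] that(2) by simp
  moreover have "a (- s) \<noteq> 1" using N.dist_minus_one_gt_1 by simp
  ultimately show ?thesis using prime_order s(1) N.classification by auto
qed

end

subsection \<open>Digraphs labelled by a cyclic group\<close>

text \<open>The vertices carry residues such that adjacency depends on the difference of labels
  only. \<open>P\<close> is a periodic predicate on all integers, so that differences need not be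
  reduced modulo \<open>n\<close>.\<close>

locale circulant_labelling = digraph G
  for G :: "('a, 'b) pre_digraph" +
  fixes n :: int and f :: "'a \<Rightarrow> int" and P :: "int \<Rightarrow> bool"
  assumes order_pos: "n > 0"
    and labels: "bij_betw f (verts G) {0..<n}"
    and steps_cong: "[x = y] (mod n) \<Longrightarrow> P x = P y"
    and arcs_iff: "u \<in> verts G \<Longrightarrow> v \<in> verts G \<Longrightarrow> u \<rightarrow>\<^bsub>G\<^esub> v \<longleftrightarrow> P (f v - f u)"
begin

lemma vertex_with_label:
  obtains u where "u \<in> verts G" "[f u = x] (mod n)" "f u = x mod n"
proof -
  have "x mod n \<in> f ` verts G" using labels order_pos by (simp add: bij_betw_def)
  then obtain u where "u \<in> verts G" "f u = x mod n" by (metis imageE)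
  then show ?thesis using that by (simp add: cong_def)
qed

lemma no_zero_step: "\<not> P 0"
proof
  assume "P 0"
  obtain u where "u \<in> verts G" using vertex_with_label by blast
  then have "u \<rightarrow>\<^bsub>G\<^esub> u" using arcs_iff \<open>P 0\<close> by simp
  then show False using adj_not_same by blast
qed

fun reach :: "nat \<Rightarrow> int \<Rightarrow> bool" where
  "reach 0 z = (n dvd z)"
| "reach (Suc k) z = (\<exists>s. P s \<and> reach k (z - s))"

lemma reach_cong: "[x = y] (mod n) \<Longrightarrow> reach k x = reach k y"
proof (induction k arbitrary: x y)
  case 0 then show ?case using cong_dvd_iff by auto
next
  case (Suc k)
  have "reach k (x - s) = reach k (y - s)" for s using Suc by (intro Suc.IH cong_diff) auto
  then show ?case by simp
qed

lemma reach_add: "reach k x \<Longrightarrow> reach l y \<Longrightarrow> reach (k + l) (x + y)"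
proof (induction k arbitrary: x)
  case 0
  then have "reach l (x + y) = reach l y" by (intro reach_cong) (simp add: cong_iff_dvd_diff)
  then show ?case using 0 by simp
next
  case (Suc k)
  then obtain s where s: "P s" "reach k (x - s)" by auto
  from Suc.IH[OF this(2) Suc.prems(2)] have "reach (k + l) (x + y - s)" by (simp add: algebra_simps)
  then show ?case using s by auto
qed

lemma reach_1_iff: "reach 1 z \<longleftrightarrow> P z"
proof
  assume "reach 1 z"
  then obtain s where "P s" "n dvd z - s" by auto
  then show "P z" using steps_cong[of z s] by (simp add: cong_iff_dvd_diff)
next
  assume "P z" then show "reach 1 z" by (auto intro!: exI[of _ z])
qed

lemma walk_iff_reach:
  assumes "u \<in> verts G" "v \<in> verts G"
  shows "(\<exists>p. awalk u p v \<and> length p = k) \<longleftrightarrow> reach k (f v - f u)"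
  using assms
proof (induction k arbitrary: u)
  case 0
  have "u = v \<longleftrightarrow> n dvd f v - f u"
  proof
    assume "n dvd f v - f u"
    then have "[f v = f u] (mod n)" by (simp add: cong_iff_dvd_diff)
    moreover have "f v \<in> {0..<n}" "f u \<in> {0..<n}" using 0 labels by (auto simp: bij_betw_def)
    ultimately have "f v = f u" by (simp add: cong_def)
    then show "u = v" using labels 0 by (auto simp: bij_betw_def inj_on_def)
  qed simp
  then show ?case using 0 by (auto simp: awalk_Nil_iff)
next
  case (Suc k)
  show ?case
  proof
    assume "\<exists>p. awalk u p v \<and> length p = Suc k"
    then obtain e p where p: "awalk u (e # p) v" "length p = k" by (metis length_Suc_conv)
    then have e: "e \<in> arcs G" "tail G e = u" "awalk (head G e) p v" by (auto simp: awalk_Cons_iff)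
    then have "u \<rightarrow>\<^bsub>G\<^esub> head G e" using in_arcs_imp_in_arcs_ends by blast
    then have "P (f (head G e) - f u)" using arcs_iff Suc.prems e(1) head_in_verts by blast
    moreover have "reach k (f v - f (head G e))" using Suc.IH[of "head G e"] Suc.prems e p head_in_verts by blast
    ultimately show "reach (Suc k) (f v - f u)" by (auto intro!: exI[of _ "f (head G e) - f u"])
  next
    assume "reach (Suc k) (f v - f u)"
    then obtain s where s: "P s" "reach k (f v - f u - s)" by auto
    obtain x where x: "x \<in> verts G" "[f x = f u + s] (mod n)" using vertex_with_label by blast
    have "P (f x - f u)" using s(1) steps_cong[of "f x - f u" s] cong_diff[OF x(2) cong_refl, of "f u"] by simp
    then have "u \<rightarrow>\<^bsub>G\<^esub> x" using arcs_iff Suc.prems x by blast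
    then obtain e where e: "e \<in> arcs G" "tail G e = u" "head G e = x" by blast
    have "reach k (f v - f x)"
      using s(2) reach_cong[of "f v - f x" "f v - f u - s"] cong_diff[OF cong_refl x(2), of "f v"]
      by (simp add: algebra_simps)
    then obtain p where "awalk x p v" "length p = k" using Suc.IH[OF x(1)] Suc.prems by blast
    then have "awalk u (e # p) v \<and> length (e # p) = Suc k" using e by (simp add: awalk_Cons_iff)
    then show "\<exists>p. awalk u p v \<and> length p = Suc k" by blast
  qed
qed

lemma strongly_connected_iff: "strongly_connected G \<longleftrightarrow> (\<forall>z. \<exists>k. reach k z)"
proof
  assume G: "strongly_connected G"
  show "\<forall>z. \<exists>k. reach k z"
  proof
    fix z
    obtain u where u: "u \<in> verts G" "[f u = 0] (mod n)" using vertex_with_label by blast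
    obtain v where v: "v \<in> verts G" "[f v = z] (mod n)" using vertex_with_label by blast
    have "u \<rightarrow>\<^sup>*\<^bsub>G\<^esub> v" using G u v by (auto simp: strongly_connected_def)
    then obtain p where "awalk u p v" by (auto simp: reachable_awalk)
    then have "reach (length p) (f v - f u)" using walk_iff_reach u v by blast
    moreover have "[f v - f u = z] (mod n)" using cong_diff[OF v(2) u(2)] by simp
    ultimately show "\<exists>k. reach k z" using reach_cong by blast
  qed
next
  assume r: "\<forall>z. \<exists>k. reach k z"
  obtain u where "u \<in> verts G" using vertex_with_label by blast
  then show "strongly_connected G"
    unfolding strongly_connected_def using r walk_iff_reach by (auto simp: reachable_awalk) metis
qed

text \<open>Meaningful only if \<open>z\<close> can be reached, which
  \<open>connected_labelling\<close> ensures.\<close>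

definition dist :: "int \<Rightarrow> nat" where
  "dist z = (LEAST k. reach k z)"

lemma dist_eqI: "(\<And>k. reach k x \<longleftrightarrow> reach k y) \<Longrightarrow> dist x = dist y"
  by (simp add: dist_def)

end

section \<open>The distance scheme in terms of labels\<close>

locale connected_labelling = circulant_labelling +
  assumes reachable: "\<And>z. \<exists>k. reach k z"
begin

lemma reach_dist: "reach (dist z) z"
  unfolding dist_def using reachable by (rule LeastI_ex)

lemma dist_le: "reach k z \<Longrightarrow> dist z \<le> k"
  unfolding dist_def by (rule Least_le)

sublocale circulant_distance n dist
proof
  show "n > 0" by (rule order_pos)
  show "dist x = dist y" if "[x = y] (mod n)" for x y using reach_cong[OF that] by (rule dist_eqI)
  show "dist x = 0 \<longleftrightarrow> n dvd x" for x using reach_dist[of x] dist_le[of 0 x] by auto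
  show tri: "dist (x + y) \<le> dist x + dist y" for x y by (intro dist_le reach_add reach_dist)
  show "\<exists>s. dist s = 1 \<and> dist (x - s) = d" if x: "dist x = Suc d" for x d
  proof -
    have "reach (Suc d) x" using reach_dist[of x] x by simp
    then obtain s where s: "P s" "reach d (x - s)" by auto
    then have "dist s \<le> 1" "dist (x - s) \<le> d" using dist_le reach_1_iff by blast+
    moreover have "Suc d \<le> dist s + dist (x - s)" using tri[of s "x - s"] x by simp
    ultimately have "dist s = 1" "dist (x - s) = d" by linarith+
    then show ?thesis by blast
  qed
qed

notation eqv (infix \<open>\<simeq>\<close> 50)

lemma dist_eq_1_iff_step: "dist z = 1 \<longleftrightarrow> P z"
proof
  assume "dist z = 1" then show "P z" using reach_dist[of z] reach_1_iff by simp
next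
  assume z: "P z"
  then have "dist z \<le> 1" using dist_le reach_1_iff by blast
  moreover have "\<not> n dvd z" using z no_zero_step steps_cong[of z 0] by (auto simp: cong_0_iff)
  then have "dist z \<noteq> 0" unfolding dist_0_iff .
  ultimately show "dist z = 1" by linarith
qed

lemma ddist_eq:
  assumes "u \<in> verts G" "v \<in> verts G" shows "ddist G u v = ereal (dist (f v - f u))"
proof -
  have cost: "awalk_cost (\<lambda>_. 1) p = length p" for p :: "'b list"
    by (simp add: awalk_cost_def sum_list_triv)
  obtain p where p: "awalk u p v" "length p = dist (f v - f u)"
    using walk_iff_reach[OF assms] reach_dist by blast
  show ?thesis
    unfolding ddist_def \<mu>_def
  proof (rule antisym)
    show "(INF p\<in>{p. awalk u p v}. ereal (awalk_cost (\<lambda>_. 1) p)) \<le> ereal (dist (f v - f u))"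
      by (rule INF_lower2[of p]) (use p cost in auto)
    show "ereal (dist (f v - f u)) \<le> (INF p\<in>{p. awalk u p v}. ereal (awalk_cost (\<lambda>_. 1) p))"
    proof (rule INF_greatest)
      fix p assume "p \<in> {p. awalk u p v}"
      then have "reach (length p) (f v - f u)" using walk_iff_reach[OF assms] by blast
      then show "ereal (dist (f v - f u)) \<le> ereal (awalk_cost (\<lambda>_. 1) p)" using dist_le cost by simp
    qed
  qed
qed

definition ttype :: "int \<Rightarrow> ereal \<times> ereal" where
  "ttype z = (ereal (dist z), ereal (dist (- z)))"

lemma two_way_dist_eq:
  "u \<in> verts G \<Longrightarrow> v \<in> verts G \<Longrightarrow> two_way_dist G u v = ttype (f v - f u)"
  by (simp add: two_way_dist_def ttype_def ddist_eq)

lemma ttype_eq_iff: "ttype x = ttype y \<longleftrightarrow> x \<simeq> y"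
  by (simp add: ttype_def eqv_def)

lemma ttype_cong: "[x = y] (mod n) \<Longrightarrow> ttype x = ttype y"
  using ttype_eq_iff eqv_cong by blast

lemma two_way_dists_eq: "two_way_dists G = range ttype"
proof (intro subset_antisym subsetI)
  fix i assume "i \<in> two_way_dists G"
  then show "i \<in> range ttype" by (auto simp: two_way_dists_def two_way_dist_eq)
next
  fix i assume "i \<in> range ttype"
  then obtain z where z: "i = ttype z" by blast
  obtain u where u: "u \<in> verts G" "[f u = 0] (mod n)" using vertex_with_label by blast
  obtain v where v: "v \<in> verts G" "[f v = z] (mod n)" using vertex_with_label by blast
  have "ttype (f v - f u) = i" unfolding z using cong_diff[OF v(2) u(2)] by (intro ttype_cong) simp
  then have "two_way_dist G u v = i" using two_way_dist_eq u(1) v(1) by simp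
  then show "i \<in> two_way_dists G" using u(1) v(1) unfolding two_way_dists_def by blast
qed

lemma dist_relation_iff:
  "(u, v) \<in> dist_relation G i \<longleftrightarrow> u \<in> verts G \<and> v \<in> verts G \<and> ttype (f v - f u) = i"
  by (auto simp: dist_relation_def two_way_dist_eq)

lemma ex_pair:
  obtains u v where "u \<in> verts G" "v \<in> verts G" "[f v - f u = z] (mod n)" "(u, v) \<in> dist_relation G (ttype z)"
proof -
  obtain u where u: "u \<in> verts G" "[f u = 0] (mod n)" using vertex_with_label by blast
  obtain v where v: "v \<in> verts G" "[f v = z] (mod n)" using vertex_with_label by blast
  have "[f v - f u = z] (mod n)" using cong_diff[OF v(2) u(2)] by simp
  then show ?thesis using that u(1) v(1) ttype_cong by (simp add: dist_relation_iff)
qed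

lemma card_path_set:
  assumes u: "u \<in> verts G" and v: "v \<in> verts G"
  shows "card (path_set (verts G) (dist_relation G) i j u v)
    = card {w \<in> {0..<n}. ttype w = i \<and> ttype (f v - f u - w) = j}"
proof (rule bij_betw_same_card)
  have "bij_betw ((\<lambda>x. (x - f u) mod n) \<circ> f) (verts G) {0..<n}"
  proof (rule bij_betw_trans[OF labels], rule bij_betwI[of _ _ _ "\<lambda>x. (x + f u) mod n"])
    show "(\<lambda>x. (x - f u) mod n) \<in> {0..<n} \<rightarrow> {0..<n}" "(\<lambda>x. (x + f u) mod n) \<in> {0..<n} \<rightarrow> {0..<n}"
      using order_pos by auto
  qed (auto simp: mod_simps)
  then have "bij_betw ((\<lambda>x. (x - f u) mod n) \<circ> f)
      {x \<in> verts G. (u, x) \<in> dist_relation G i \<and> (x, v) \<in> dist_relation G j}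
      {w \<in> {0..<n}. ttype w = i \<and> ttype (f v - f u - w) = j}"
  proof (rule bij_betw_Collect)
    fix x assume x: "x \<in> verts G"
    have "ttype ((f x - f u) mod n) = ttype (f x - f u)" by (rule ttype_cong) (simp add: cong_def)
    moreover have "ttype (f v - f u - (f x - f u) mod n) = ttype (f v - f x)"
      by (rule ttype_cong) (simp add: cong_def mod_diff_right_eq)
    ultimately show "ttype (((\<lambda>x. (x - f u) mod n) \<circ> f) x) = i \<and> ttype (f v - f u - ((\<lambda>x. (x - f u) mod n) \<circ> f) x) = j
       \<longleftrightarrow> (u, x) \<in> dist_relation G i \<and> (x, v) \<in> dist_relation G j"
      using x u v by (simp add: dist_relation_iff)
  qed
  then show "bij_betw ((\<lambda>x. (x - f u) mod n) \<circ> f) (path_set (verts G) (dist_relation G) i j u v)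
      {w \<in> {0..<n}. ttype w = i \<and> ttype (f v - f u - w) = j}"
    by (simp add: path_set_def)
qed

lemma dist_relation_0: "dist_relation G (ttype 0) = Id_on (verts G)"
proof -
  have "n dvd f v - f u \<longleftrightarrow> u = v" if "u \<in> verts G" "v \<in> verts G" for u v
    using walk_iff_reach[OF that, of 0] that by (auto simp: awalk_Nil_iff)
  then show ?thesis by (auto simp: dist_relation_iff ttype_eq_iff eqv_0_iff)
qed

lemma dist_relation_uminus: "(dist_relation G (ttype z))\<inverse> = dist_relation G (ttype (- z))"
proof -
  have "x - y \<simeq> z \<longleftrightarrow> y - x \<simeq> - z" for x y
    using eqv_uminus[of "x - y" z] eqv_uminus[of "y - x" "- z"] by auto
  then show ?thesis by (auto simp: dist_relation_iff ttype_eq_iff)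
qed

lemma inj_on_dist_relation: "inj_on (dist_relation G) (two_way_dists G)"
proof
  fix i j assume i: "i \<in> two_way_dists G" and eq: "dist_relation G i = dist_relation G j"
  then obtain z where "i = ttype z" unfolding two_way_dists_eq by blast
  then obtain u v where "(u, v) \<in> dist_relation G i" using ex_pair by metis
  then show "i = j" using eq dist_relation_iff by metis
qed

text \<open>For a labelled digraph all axioms except constancy of the intersection numbers hold by
  construction. Translating the first vertex to 0 turns these numbers into counts of
  residues.\<close>

lemma association_scheme_iff:
  "association_scheme (verts G) (two_way_dists G) (dist_relation G) \<longleftrightarrow>
    (\<forall>z z' u v. z \<simeq> z' \<longrightarrow> card {w \<in> {0..<n}. w \<simeq> u \<and> z - w \<simeq> v} = card {w \<in> {0..<n}. w \<simeq> u \<and> z' - w \<simeq> v})"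
  (is "?A \<longleftrightarrow> ?B")
proof
  assume A: ?A
  show ?B
  proof (intro allI impI)
    fix z z' u v assume zz: "z \<simeq> z'"
    obtain p where p: "\<forall>(x, y)\<in>dist_relation G (ttype z).
        card (path_set (verts G) (dist_relation G) (ttype u) (ttype v) x y) = p"
      using A unfolding association_scheme_def two_way_dists_eq by blast
    have p': "card {w \<in> {0..<n}. w \<simeq> u \<and> y - w \<simeq> v} = p" if y: "z \<simeq> y" for y
    proof -
      obtain b c where bc: "b \<in> verts G" "c \<in> verts G" "[f c - f b = y] (mod n)" "(b, c) \<in> dist_relation G (ttype y)"
        by (rule ex_pair)
      have "f c - f b - w \<simeq> y - w" for w using bc(3) by (intro eqv_cong cong_diff) auto
      then have "f c - f b - w \<simeq> v \<longleftrightarrow> y - w \<simeq> v" for w using eqv_sym eqv_trans by blast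
      moreover have "ttype y = ttype z" using eqv_sym[OF y] ttype_eq_iff by blast
      ultimately have "card (path_set (verts G) (dist_relation G) (ttype u) (ttype v) b c) = p"
        using p bc(4) by fastforce
      then show ?thesis
        unfolding card_path_set[OF bc(1,2)] ttype_eq_iff \<open>\<And>w. f c - f b - w \<simeq> v \<longleftrightarrow> y - w \<simeq> v\<close> .
    qed
    show "card {w \<in> {0..<n}. w \<simeq> u \<and> z - w \<simeq> v} = card {w \<in> {0..<n}. w \<simeq> u \<and> z' - w \<simeq> v}"
      unfolding p'[OF zz] p'[OF eqv_refl] by (rule refl)
  qed
next
  assume B: ?B
  show ?A unfolding association_scheme_def
  proof (intro conjI ballI)
    show "finite (verts G)" by simp
    show "verts G \<noteq> {}" using vertex_with_label by blast
    show "inj_on (dist_relation G) (two_way_dists G)" by (rule inj_on_dist_relation)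
    show "partition_on (verts G \<times> verts G) (dist_relation G ` two_way_dists G)"
    proof (rule partition_onI)
      show "\<Union> (dist_relation G ` two_way_dists G) = verts G \<times> verts G"
        by (auto simp: two_way_dists_eq dist_relation_iff)
      show "disjnt p q" if pq: "p \<in> dist_relation G ` two_way_dists G" "q \<in> dist_relation G ` two_way_dists G" "p \<noteq> q" for p q
      proof -
        obtain i j where ij: "p = dist_relation G i" "q = dist_relation G j" "i \<noteq> j" using pq by blast
        show ?thesis unfolding disjnt_def ij(1,2) using ij(3) by (auto simp: dist_relation_iff)
      qed
      show "{} \<notin> dist_relation G ` two_way_dists G"
      proof
        assume "{} \<in> dist_relation G ` two_way_dists G"
        then obtain z where "dist_relation G (ttype z) = {}" unfolding two_way_dists_eq by (metis imageE)
        then show False using ex_pair[of z] by blast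
      qed
    qed
    show "\<exists>i\<in>two_way_dists G. dist_relation G i = Id_on (verts G)"
      using dist_relation_0 two_way_dists_eq by blast
    show "\<exists>j\<in>two_way_dists G. dist_relation G j = (dist_relation G i)\<inverse>" if "i \<in> two_way_dists G" for i
      using that dist_relation_uminus unfolding two_way_dists_eq by blast
    show "\<exists>p. \<forall>(x, y)\<in>dist_relation G l. card (path_set (verts G) (dist_relation G) i j x y) = p"
      if ijl: "i \<in> two_way_dists G" "j \<in> two_way_dists G" "l \<in> two_way_dists G" for i j l
    proof -
      obtain u v z where t: "i = ttype u" "j = ttype v" "l = ttype z" using ijl unfolding two_way_dists_eq by blast
      have "card (path_set (verts G) (dist_relation G) i j x y) = card {w \<in> {0..<n}. w \<simeq> u \<and> z - w \<simeq> v}"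
        if "(x, y) \<in> dist_relation G l" for x y
      proof -
        have xy: "x \<in> verts G" "y \<in> verts G" "f y - f x \<simeq> z"
          using that by (simp_all add: t dist_relation_iff ttype_eq_iff)
        show ?thesis unfolding card_path_set[OF xy(1,2)] t ttype_eq_iff using B xy(3) by blast
      qed
      then show ?thesis by blast
    qed
  qed
qed

lemma transpose_index_ttype:
  "transpose_index (two_way_dists G) (dist_relation G) (ttype z) = ttype (- z)"
  unfolding transpose_index_def
proof (rule the_equality)
  show "ttype (- z) \<in> two_way_dists G \<and> dist_relation G (ttype (- z)) = (dist_relation G (ttype z))\<inverse>"
    using dist_relation_uminus two_way_dists_eq by blast
next
  fix j assume "j \<in> two_way_dists G \<and> dist_relation G j = (dist_relation G (ttype z))\<inverse>"
  then show "j = ttype (- z)"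
    using inj_onD[OF inj_on_dist_relation, of j "ttype (- z)"] dist_relation_uminus two_way_dists_eq by auto
qed

lemma complex_product_iff:
  assumes "association_scheme (verts G) (two_way_dists G) (dist_relation G)"
  shows "ttype z \<in> complex_product (verts G) (two_way_dists G) (dist_relation G) (ttype u) (ttype v)
    \<longleftrightarrow> (\<exists>w. w \<simeq> u \<and> z - w \<simeq> v)"
proof -
  let ?p = "card {w \<in> {0..<n}. w \<simeq> u \<and> z - w \<simeq> v}"
  have B: "x \<simeq> z \<Longrightarrow> card {w \<in> {0..<n}. w \<simeq> u \<and> x - w \<simeq> v} = ?p" for x
    using assms unfolding association_scheme_iff by blast
  have all: "\<forall>(x, y)\<in>dist_relation G (ttype z). card (path_set (verts G) (dist_relation G) (ttype u) (ttype v) x y) = ?p"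
  proof clarify
    fix x y assume "(x, y) \<in> dist_relation G (ttype z)"
    then have xy: "x \<in> verts G" "y \<in> verts G" "f y - f x \<simeq> z"
      by (simp_all add: dist_relation_iff ttype_eq_iff)
    show "card (path_set (verts G) (dist_relation G) (ttype u) (ttype v) x y) = ?p"
      unfolding card_path_set[OF xy(1,2)] ttype_eq_iff by (rule B[OF xy(3)])
  qed
  obtain b c where bc: "(b, c) \<in> dist_relation G (ttype z)" using ex_pair[of z] by blast
  have "intersection_number (verts G) (dist_relation G) (ttype u) (ttype v) (ttype z) = ?p"
    unfolding intersection_number_def
  proof (rule the_equality)
    fix p assume "\<forall>(x, y)\<in>dist_relation G (ttype z). card (path_set (verts G) (dist_relation G) (ttype u) (ttype v) x y) = p"
    then show "p = ?p" using all bc by fastforce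
  qed (rule all)
  moreover have "?p \<noteq> 0 \<longleftrightarrow> (\<exists>w. w \<simeq> u \<and> z - w \<simeq> v)"
  proof
    assume "\<exists>w. w \<simeq> u \<and> z - w \<simeq> v"
    then obtain w where w: "w \<simeq> u" "z - w \<simeq> v" by blast
    have "w mod n \<simeq> w" "z - w mod n \<simeq> z - w"
      by (rule eqv_cong; simp add: cong_def mod_diff_right_eq)+
    then have "w mod n \<simeq> u" "z - w mod n \<simeq> v" using w eqv_trans by blast+
    then have "w mod n \<in> {w \<in> {0..<n}. w \<simeq> u \<and> z - w \<simeq> v}" using order_pos by simp
    moreover have "finite {w \<in> {0..<n}. w \<simeq> u \<and> z - w \<simeq> v}" by (rule finite_subset[of _ "{0..<n}"]) auto
    ultimately show "?p \<noteq> 0" by (metis card_0_eq empty_iff)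
  next
    assume "?p \<noteq> 0"
    then have "{w \<in> {0..<n}. w \<simeq> u \<and> z - w \<simeq> v} \<noteq> {}" by (metis card.empty)
    then show "\<exists>w. w \<simeq> u \<and> z - w \<simeq> v" by blast
  qed
  ultimately show ?thesis by (simp add: complex_product_def two_way_dists_eq)
qed

text \<open>By \<open>complex_product_iff\<close>, closedness means that the union of the classes in
  \<open>F\<close> contains all differences of its elements. Nonempty closed sets are thus the
  subgroups that are unions of classes.\<close>

lemma closed_subset_iff:
  assumes "association_scheme (verts G) (two_way_dists G) (dist_relation G)"
  shows "closed_subset (verts G) (two_way_dists G) (dist_relation G) F \<longleftrightarrow>
    F \<subseteq> range ttype \<and> (\<forall>x y. ttype x \<in> F \<longrightarrow> ttype y \<in> F \<longrightarrow> ttype (y - x) \<in> F)"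
  (is "?C \<longleftrightarrow> _ \<and> ?D")
proof (cases "F \<subseteq> range ttype")
  case F: True
  have "?C \<longleftrightarrow> (\<forall>x y z w. ttype x \<in> F \<longrightarrow> ttype y \<in> F \<longrightarrow> w \<simeq> - x \<longrightarrow> z - w \<simeq> y \<longrightarrow> ttype z \<in> F)"
  proof
    assume C: ?C
    show "\<forall>x y z w. ttype x \<in> F \<longrightarrow> ttype y \<in> F \<longrightarrow> w \<simeq> - x \<longrightarrow> z - w \<simeq> y \<longrightarrow> ttype z \<in> F"
    proof (intro allI impI)
      fix x y z w assume xy: "ttype x \<in> F" "ttype y \<in> F" and w: "w \<simeq> - x" "z - w \<simeq> y"
      have "complex_product (verts G) (two_way_dists G) (dist_relation G) (ttype (- x)) (ttype y) \<subseteq> F"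
        using C xy unfolding closed_subset_def transpose_index_ttype[symmetric] by blast
      then show "ttype z \<in> F" using complex_product_iff[OF assms] w by blast
    qed
  next
    assume R: "\<forall>x y z w. ttype x \<in> F \<longrightarrow> ttype y \<in> F \<longrightarrow> w \<simeq> - x \<longrightarrow> z - w \<simeq> y \<longrightarrow> ttype z \<in> F"
    have "complex_product (verts G) (two_way_dists G) (dist_relation G)
        (transpose_index (two_way_dists G) (dist_relation G) i) j \<subseteq> F" if ij: "i \<in> F" "j \<in> F" for i j
    proof
      fix l assume l: "l \<in> complex_product (verts G) (two_way_dists G) (dist_relation G)
        (transpose_index (two_way_dists G) (dist_relation G) i) j"
      then have "l \<in> two_way_dists G" by (simp add: complex_product_def)
      then obtain x y z where t: "i = ttype x" "j = ttype y" "l = ttype z"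
        using ij F unfolding two_way_dists_eq by blast
      then obtain w where "w \<simeq> - x" "z - w \<simeq> y"
        using l complex_product_iff[OF assms] unfolding t transpose_index_ttype by blast
      then show "l \<in> F" using R ij unfolding t by blast
    qed
    then show ?C using F by (simp add: closed_subset_def two_way_dists_eq)
  qed
  also have "\<dots> \<longleftrightarrow> ?D"
  proof
    assume "\<forall>x y z w. ttype x \<in> F \<longrightarrow> ttype y \<in> F \<longrightarrow> w \<simeq> - x \<longrightarrow> z - w \<simeq> y \<longrightarrow> ttype z \<in> F"
    from this[rule_format, of _ _ "- x" "y - x" for x y] show ?D by simp
  next
    assume D: ?D
    show "\<forall>x y z w. ttype x \<in> F \<longrightarrow> ttype y \<in> F \<longrightarrow> w \<simeq> - x \<longrightarrow> z - w \<simeq> y \<longrightarrow> ttype z \<in> F"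
    proof (intro allI impI)
      fix x y z w assume xy: "ttype x \<in> F" "ttype y \<in> F" and w: "w \<simeq> - x" "z - w \<simeq> y"
      have "- w \<simeq> x" using eqv_uminus[OF w(1)] by simp
      then have "ttype (- w) \<in> F" "ttype (z - w) \<in> F" using xy w(2) ttype_eq_iff by metis+
      then have "ttype (z - w - - w) \<in> F" using D by blast
      then show "ttype z \<in> F" by simp
    qed
  qed
  finally show ?thesis using F by simp
qed (auto simp: closed_subset_def two_way_dists_eq)


lemma primitive_circulant_schemeI:
  assumes wdr: "weakly_distance_regular G" and prim: "primitive_digraph G"
    and ns: "\<exists>s. P s \<and> \<not> P (- s)"
  shows "primitive_circulant_scheme n dist"
proof
  have A: "association_scheme (verts G) (two_way_dists G) (dist_relation G)"
    using wdr by (simp add: weakly_distance_regular_def)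
  have B: "z \<simeq> z' \<Longrightarrow> card {w \<in> {0..<n}. w \<simeq> u \<and> z - w \<simeq> v} = card {w \<in> {0..<n}. w \<simeq> u \<and> z' - w \<simeq> v}" for z z' u v
    using A unfolding association_scheme_iff by blast
  then show "z \<simeq> z' \<Longrightarrow> card {w \<in> {0..<n}. w \<simeq> u \<and> z - w \<simeq> v} = card {w \<in> {0..<n}. w \<simeq> u \<and> z' - w \<simeq> v}" for z z' u v .
  show "\<exists>s. dist s = 1 \<and> dist (- s) \<noteq> 1" using ns unfolding dist_eq_1_iff_step .
  fix H z x
  assume H: "\<And>x y. H x \<Longrightarrow> H y \<Longrightarrow> H (y - x)" and H_cong: "\<And>x y. [x = y] (mod n) \<Longrightarrow> H x \<Longrightarrow> H y"
    and z: "\<not> n dvd z" "\<And>z'. z' \<simeq> z \<Longrightarrow> H z'"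
  \<comment> \<open>The classes lying entirely in \<open>H\<close>. They form a closed set, because
    constancy of the intersection numbers makes every \<open>w \<simeq> y - x\<close> a difference
    of elements of the classes of \<open>y\<close> and \<open>x\<close>.\<close>
  define F where "F = {ttype y | y. \<forall>w. w \<simeq> y \<longrightarrow> H w}"
  have F_iff: "ttype y \<in> F \<longleftrightarrow> (\<forall>w. w \<simeq> y \<longrightarrow> H w)" for y
    unfolding F_def using ttype_eq_iff eqv_trans by blast
  have "closed_subset (verts G) (two_way_dists G) (dist_relation G) F"
    unfolding closed_subset_iff[OF A]
  proof (intro conjI allI impI)
    show "F \<subseteq> range ttype" by (auto simp: F_def)
    fix x y assume xy: "ttype x \<in> F" "ttype y \<in> F"
    show "ttype (y - x) \<in> F" unfolding F_iff
    proof (intro allI impI)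
      fix w assume w: "w \<simeq> y - x"
      have fin: "finite {v \<in> {0..<n}. v \<simeq> - x \<and> t - v \<simeq> y}" for t
        by (rule finite_subset[of _ "{0..<n}"]) auto
      have "- x mod n \<simeq> - x" by (rule eqv_cong) (simp add: cong_def)
      moreover have "y - x - (- x mod n) \<simeq> y"
        by (rule eqv_cong) (simp add: cong_def mod_diff_right_eq)
      ultimately have "- x mod n \<in> {v \<in> {0..<n}. v \<simeq> - x \<and> y - x - v \<simeq> y}" using order_pos by simp
      then have "card {v \<in> {0..<n}. v \<simeq> - x \<and> y - x - v \<simeq> y} \<noteq> 0" using fin by (metis card_0_eq empty_iff)
      then have "card {v \<in> {0..<n}. v \<simeq> - x \<and> w - v \<simeq> y} \<noteq> 0" unfolding B[OF w] .
      then have "{v \<in> {0..<n}. v \<simeq> - x \<and> w - v \<simeq> y} \<noteq> {}" by (metis card.empty)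
      then obtain v where v: "v \<simeq> - x" "w - v \<simeq> y" by blast
      have "- v \<simeq> x" using eqv_uminus[OF v(1)] by simp
      then have "H (w - v - - v)" using xy v(2) H unfolding F_iff by blast
      then show "H w" by simp
    qed
  qed
  moreover have "ttype z \<in> F" using z(2) by (simp add: F_iff)
  moreover have "dist_relation G (ttype z) \<noteq> Id_on (verts G)"
    using inj_onD[OF inj_on_dist_relation, of "ttype z" "ttype 0"] z(1)
    unfolding dist_relation_0[symmetric] two_way_dists_eq by (auto simp: ttype_eq_iff eqv_0_iff)
  then have "closed_span (verts G) (two_way_dists G) (dist_relation G) (ttype z) = two_way_dists G"
    using prim unfolding primitive_digraph_def primitive_scheme_def two_way_dists_eq by blast
  ultimately have "two_way_dists G \<subseteq> F" unfolding closed_span_def by blast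
  then have "ttype x \<in> F" unfolding two_way_dists_eq by blast
  then show "H x" by (simp add: F_iff)
qed

section \<open>Sufficient conditions through multipliers\<close>

lemma dist_mult_invariant:
  assumes r: "[t * r = 1] (mod n)" and t: "\<And>x. P (t * x) \<longleftrightarrow> P x"
  shows "dist (t * x) = dist x"
proof (rule dist_eqI)
  fix k show "reach k (t * x) \<longleftrightarrow> reach k x"
  proof (induction k arbitrary: x)
    case 0
    have "n dvd x" if "n dvd t * x"
    proof -
      have "[r * (t * x) = x] (mod n)" using cong_scalar_right[OF r, of x] by (simp add: algebra_simps)
      then show ?thesis using cong_dvd_iff that by (metis dvd_mult)
    qed
    then show ?case by auto
  next
    case (Suc k)
    show ?case
    proof
      assume "reach (Suc k) (t * x)"
      then obtain s where s: "P s" "reach k (t * x - s)" by auto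
      have ts: "[t * (r * s) = s] (mod n)" using cong_scalar_right[OF r, of s] by (simp add: mult.assoc)
      have "P (r * s)" using s(1) t steps_cong[OF ts] by simp
      moreover have "reach k (t * (x - r * s))"
        using s(2) reach_cong[OF cong_diff[OF cong_refl ts, of "t * x"]] by (simp add: right_diff_distrib)
      ultimately show "reach (Suc k) x" using Suc.IH by auto
    next
      assume "reach (Suc k) x"
      then obtain s where "P s" "reach k (x - s)" by auto
      then have "P (t * s)" "reach k (t * x - t * s)"
        using t Suc.IH[of "x - s"] by (simp_all add: right_diff_distrib)
      then show "reach (Suc k) (t * x)" by auto
    qed
  qed
qed

text \<open>Multiplication by a \<open>t\<close> that preserves \<open>P\<close> is an automorphism
  fixing 0, so it matches the counts for \<open>z\<close> and \<open>z'\<close>. Primitivity follows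
  from the prime order: a closed set with a nonzero class contains all multiples of an invertible
  residue.\<close>

lemma primitive_wdr_of_prime:
  assumes prime: "prime n"
    and orbits: "\<And>z z'. z \<simeq> z' \<Longrightarrow> \<exists>t. \<not> n dvd t \<and> [z' = t * z] (mod n) \<and> (\<forall>x. P (t * x) \<longleftrightarrow> P x)"
  shows "weakly_distance_regular G" "primitive_digraph G"
proof -
  have A: "association_scheme (verts G) (two_way_dists G) (dist_relation G)"
    unfolding association_scheme_iff
  proof (intro allI impI)
    fix z z' u v assume "z \<simeq> z'"
    then obtain t where t: "\<not> n dvd t" "[z' = t * z] (mod n)" "\<And>x. P (t * x) \<longleftrightarrow> P x"
      using orbits by blast
    obtain r where r: "[t * r = 1] (mod n)" using prime_inverse_mod[OF prime t(1)] .
    have te: "t * x \<simeq> y \<longleftrightarrow> x \<simeq> y" for x y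
      using dist_mult_invariant[OF r t(3), of x] dist_mult_invariant[OF r t(3), of "- x"] by (simp add: eqv_def)
    have "bij_betw (\<lambda>w. (t * w) mod n) {0..<n} {0..<n}"
      using bij_betw_mult_mod[OF r order_pos] .
    then have "bij_betw (\<lambda>w. (t * w) mod n) {w \<in> {0..<n}. w \<simeq> u \<and> z - w \<simeq> v} {w \<in> {0..<n}. w \<simeq> u \<and> z' - w \<simeq> v}"
    proof (rule bij_betw_Collect)
      fix w
      have "(t * w) mod n \<simeq> t * w" by (rule eqv_cong) (simp add: cong_def)
      moreover have "z' - (t * w) mod n \<simeq> t * (z - w)"
        unfolding right_diff_distrib using t(2) by (intro eqv_cong cong_diff) (simp_all add: cong_def)
      ultimately show "(t * w) mod n \<simeq> u \<and> z' - (t * w) mod n \<simeq> v \<longleftrightarrow> w \<simeq> u \<and> z - w \<simeq> v"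
        using te eqv_sym eqv_trans by blast
    qed
    then show "card {w \<in> {0..<n}. w \<simeq> u \<and> z - w \<simeq> v} = card {w \<in> {0..<n}. w \<simeq> u \<and> z' - w \<simeq> v}"
      by (rule bij_betw_same_card)
  qed
  then show "weakly_distance_regular G"
    using reachable strongly_connected_iff by (simp add: weakly_distance_regular_def)
  have "closed_span (verts G) (two_way_dists G) (dist_relation G) i = two_way_dists G"
    if i: "i \<in> two_way_dists G" "dist_relation G i \<noteq> Id_on (verts G)" for i
  proof -
    obtain z where z: "i = ttype z" using i(1) unfolding two_way_dists_eq by blast
    have nd: "\<not> n dvd z"
      using i(2) eqv_0_iff[of z] unfolding z dist_relation_0[symmetric] ttype_eq_iff[symmetric] by auto
    have full: "F = range ttype" if F: "closed_subset (verts G) (two_way_dists G) (dist_relation G) F" "i \<in> F" for F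
    proof -
      have sub: "F \<subseteq> range ttype" and D: "\<And>x y. ttype x \<in> F \<Longrightarrow> ttype y \<in> F \<Longrightarrow> ttype (y - x) \<in> F"
        using F(1) unfolding closed_subset_iff[OF A] by blast+
      have z0: "ttype z \<in> F" using F(2) z by simp
      have 0: "ttype 0 \<in> F" using D[OF z0 z0] by simp
      have neg: "ttype (- z) \<in> F" using D[OF z0 0] by simp
      have mult: "ttype (int k * z) \<in> F" for k
      proof (induction k)
        case (Suc k)
        then show ?case using D[OF neg Suc] by (simp add: algebra_simps)
      qed (simp add: 0)
      have "ttype x \<in> F" for x
      proof -
        obtain r where r: "[z * r = 1] (mod n)" using prime_inverse_mod[OF prime nd] .
        have "[(r * x) mod n * z = r * x * z] (mod n)" by (intro cong_scalar_right) (simp add: cong_def)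
        also have "[r * x * z = x] (mod n)" using cong_scalar_right[OF r, of x] by (simp add: algebra_simps)
        finally have "ttype ((r * x) mod n * z) = ttype x" by (rule ttype_cong)
        then show ?thesis using mult[of "nat ((r * x) mod n)"] order_pos by simp
      qed
      then show ?thesis using sub by blast
    qed
    have "closed_subset (verts G) (two_way_dists G) (dist_relation G) (range ttype)"
      unfolding closed_subset_iff[OF A] by blast
    then have "{F. closed_subset (verts G) (two_way_dists G) (dist_relation G) F \<and> i \<in> F} = {range ttype}"
      using full z by blast
    then show ?thesis by (simp add: closed_span_def two_way_dists_eq)
  qed
  then show "primitive_digraph G" using A by (simp add: primitive_digraph_def primitive_scheme_def)
qed

end

lemma connected_labelling_of_one:
  assumes "circulant_labelling G n f P" "P 1"
  shows "connected_labelling G n f P"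
proof -
  interpret circulant_labelling G n f P by fact
  show ?thesis
  proof
    fix z
    have "reach k (int k)" for k
      by (induction k) (use assms(2) in \<open>auto intro!: exI[of _ 1]\<close>)
    then have "reach (nat (z mod n)) (z mod n)" using order_pos by (metis nat_0_le pos_mod_sign)
    then show "\<exists>k. reach k z" using reach_cong[of "z mod n" z] by (auto simp: cong_def)
  qed
qed

text \<open>It suffices to check that the two-way distances separate the cosets of the connection set,
  when that is a group of units.\<close>
lemma primitive_wdr_of_unit_group:
  assumes L: "circulant_labelling G n f P" and prime: "prime n"
    and one: "P 1" and mult: "\<And>x y. P x \<Longrightarrow> P y \<Longrightarrow> P (x * y)"
    and cosets: "\<And>z z'. \<lbrakk>circulant_distance.eqv (circulant_labelling.dist n P) z z'; \<not> n dvd z\<rbrakk> \<Longrightarrow>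
      \<exists>c k k'. P k \<and> P k' \<and> [z = c * k] (mod n) \<and> [z' = c * k'] (mod n)"
  shows "weakly_distance_regular G" "primitive_digraph G"
proof -
  interpret connected_labelling G n f P by (rule connected_labelling_of_one[OF L one])
  have nd: "\<not> n dvd k" if "P k" for k
    using that no_zero_step steps_cong[of k 0] by (auto simp: cong_0_iff)
  have inv: "\<exists>r. P r \<and> [k * r = 1] (mod n)" if k: "P k" for k
  proof -
    have 1: "[k ^ (nat n - 1) = 1] (mod n)" by (rule fermat_int[OF prime nd[OF k]])
    have "nat n - 1 > 0" using prime_gt_1_int[OF prime] by simp
    then obtain e where e: "nat n - 1 = Suc e" using gr0_implies_Suc by blast
    have "P (k ^ e)" for e by (induction e) (use one mult k in auto)
    then show ?thesis using 1 unfolding e by auto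
  qed
  have orbits: "\<exists>t. \<not> n dvd t \<and> [z' = t * z] (mod n) \<and> (\<forall>x. P (t * x) \<longleftrightarrow> P x)" if zz: "z \<simeq> z'" for z z'
  proof (cases "n dvd z")
    case True
    then have "[z' = 1 * z] (mod n)" using eqv_dvd_iff[OF zz] by (simp add: cong_iff_dvd_diff)
    moreover have "\<not> n dvd 1" using nd one by blast
    ultimately show ?thesis by (intro exI[of _ 1]) simp
  next
    case False
    then obtain c k k' where c: "P k" "P k'" "[z = c * k] (mod n)" "[z' = c * k'] (mod n)"
      using cosets zz by blast
    obtain r where r: "P r" "[k * r = 1] (mod n)" using inv c(1) by blast
    obtain r' where r': "P r'" "[k' * r' = 1] (mod n)" using inv c(2) by blast
    define t where "t = k' * r"
    have Pt: "P t" using mult c(2) r(1) by (simp add: t_def)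
    obtain s where s: "P s" "[t * s = 1] (mod n)" using inv Pt by blast
    have "[t * z = t * (c * k)] (mod n)" using c(3) by (rule cong_scalar_left)
    also have "t * (c * k) = c * k' * (k * r)" by (simp add: t_def algebra_simps)
    also have "[c * k' * (k * r) = c * k' * 1] (mod n)" using r(2) by (rule cong_scalar_left)
    also have "[c * k' * 1 = z'] (mod n)" using c(4) by (simp add: cong_sym)
    finally have "[z' = t * z] (mod n)" by (rule cong_sym)
    moreover have "P (t * x) \<longleftrightarrow> P x" for x
    proof
      assume "P (t * x)"
      then have "P (s * (t * x))" using mult s(1) by blast
      moreover have "[s * (t * x) = x] (mod n)" using cong_scalar_right[OF s(2), of x] by (simp add: algebra_simps)
      ultimately show "P x" using steps_cong by blast
    qed (use mult Pt in blast)
    ultimately show ?thesis using nd[OF Pt] by blast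
  qed
  show "weakly_distance_regular G" "primitive_digraph G"
    using primitive_wdr_of_prime[OF prime orbits] by blast+
qed

subsection \<open>Isomorphisms with labelled digraphs\<close>

text \<open>The arcs of \<open>with_proj H\<close> are pairs of vertices and \<open>G\<close> has no
  parallel arcs, so an isomorphism is determined by its vertex map.\<close>

lemma (in digraph) digraph_iso_with_proj_iff:
  "digraph_iso G (with_proj H) \<longleftrightarrow>
    (\<exists>\<phi>. bij_betw \<phi> (verts G) (pverts H) \<and> parcs H = (\<lambda>(u, v). (\<phi> u, \<phi> v)) ` arcs_ends G)"
proof
  assume "digraph_iso G (with_proj H)"
  then obtain h where h: "digraph_isomorphism h" "with_proj H = app_iso h G"
    unfolding digraph_iso_def by blast
  have "bij_betw (iso_verts h) (verts G) (verts (with_proj H))"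
    using digraph_isomorphism_inj_on_verts[OF h(1)] unfolding h(2) by (simp add: bij_betw_def)
  moreover have "arcs_ends (with_proj H) = (\<lambda>(u, v). (iso_verts h u, iso_verts h v)) ` arcs_ends G"
    unfolding h(2) by (rule arcs_ends_app_iso_eq[OF h(1)])
  ultimately show "\<exists>\<phi>. bij_betw \<phi> (verts G) (pverts H) \<and> parcs H = (\<lambda>(u, v). (\<phi> u, \<phi> v)) ` arcs_ends G"
    by auto
next
  assume "\<exists>\<phi>. bij_betw \<phi> (verts G) (pverts H) \<and> parcs H = (\<lambda>(u, v). (\<phi> u, \<phi> v)) ` arcs_ends G"
  then obtain \<phi> where \<phi>: "bij_betw \<phi> (verts G) (pverts H)" "parcs H = (\<lambda>(u, v). (\<phi> u, \<phi> v)) ` arcs_ends G"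
    by blast
  define h where "h = \<lparr>iso_verts = \<phi>, iso_arcs = (\<lambda>e. (\<phi> (tail G e), \<phi> (head G e))), iso_head = snd, iso_tail = fst\<rparr>"
  have inj: "inj_on \<phi> (verts G)" using \<phi>(1) by (simp add: bij_betw_def)
  have "inj_on (\<lambda>e. (\<phi> (tail G e), \<phi> (head G e))) (arcs G)"
  proof
    fix d e assume de: "d \<in> arcs G" "e \<in> arcs G" "(\<phi> (tail G d), \<phi> (head G d)) = (\<phi> (tail G e), \<phi> (head G e))"
    then have "arc_to_ends G d = arc_to_ends G e"
      using inj_onD[OF inj] by (simp add: arc_to_ends_def)
    then show "d = e" using no_multi_arcs de by blast
  qed
  then have "digraph_isomorphism h"
    unfolding digraph_isomorphism_def using wf_digraph inj by (simp add: h_def)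
  moreover have "with_proj H = app_iso h G"
    using \<phi> by (simp add: with_proj_def app_iso_def h_def bij_betw_def arcs_ends_conv image_image)
  ultimately show "digraph_iso G (with_proj H)" unfolding digraph_iso_def by blast
qed

text \<open>Labels are carried along an isomorphism, and back. Through this lemma the three families
  and all Cayley digraphs of finite cyclic groups are treated as labellings.\<close>

lemma (in digraph) digraph_iso_labelled_iff:
  assumes n: "n > 0" and g: "bij_betw g (pverts H) {0..<n}"
    and P: "\<And>x y. [x = y] (mod n) \<Longrightarrow> P x = P y"
    and H: "parcs H = {(x, y). x \<in> pverts H \<and> y \<in> pverts H \<and> P (g y - g x)}"
  shows "digraph_iso G (with_proj H) \<longleftrightarrow> (\<exists>f. circulant_labelling G n f P)"
proof
  assume "digraph_iso G (with_proj H)"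
  then obtain \<phi> where \<phi>: "bij_betw \<phi> (verts G) (pverts H)" "parcs H = (\<lambda>(u, v). (\<phi> u, \<phi> v)) ` arcs_ends G"
    unfolding digraph_iso_with_proj_iff by blast
  have "circulant_labelling G n (g \<circ> \<phi>) P"
  proof
    show "bij_betw (g \<circ> \<phi>) (verts G) {0..<n}" using bij_betw_trans[OF \<phi>(1) g] .
    fix u v assume uv: "u \<in> verts G" "v \<in> verts G"
    have "u \<rightarrow>\<^bsub>G\<^esub> v \<longleftrightarrow> (\<phi> u, \<phi> v) \<in> parcs H"
    proof
      assume "(\<phi> u, \<phi> v) \<in> parcs H"
      then obtain u' v' where uv': "u' \<rightarrow>\<^bsub>G\<^esub> v'" "\<phi> u = \<phi> u'" "\<phi> v = \<phi> v'" unfolding \<phi>(2) by auto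
      then have "u' \<in> verts G" "v' \<in> verts G" using adj_in_verts by blast+
      then have "u = u'" "v = v'" using uv uv' \<phi>(1) by (auto simp: bij_betw_def inj_on_def)
      then show "u \<rightarrow>\<^bsub>G\<^esub> v" using uv'(1) by simp
    qed (auto simp: \<phi>(2))
    also have "\<dots> \<longleftrightarrow> P ((g \<circ> \<phi>) v - (g \<circ> \<phi>) u)"
      unfolding H using uv \<phi>(1) by (auto simp: bij_betw_def)
    finally show "u \<rightarrow>\<^bsub>G\<^esub> v \<longleftrightarrow> P ((g \<circ> \<phi>) v - (g \<circ> \<phi>) u)" .
  qed (use n P in auto)
  then show "\<exists>f. circulant_labelling G n f P" by blast
next
  assume "\<exists>f. circulant_labelling G n f P"
  then obtain f where f: "circulant_labelling G n f P" by blast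
  then interpret L: circulant_labelling G n f P .
  define h where "h = the_inv_into (pverts H) g"
  have h: "bij_betw h {0..<n} (pverts H)" unfolding h_def using g by (rule bij_betw_the_inv_into)
  have gh: "g (h i) = i" if "i \<in> {0..<n}" for i
    unfolding h_def using f_the_inv_into_f_bij_betw[OF g] that by blast
  have bij: "bij_betw (h \<circ> f) (verts G) (pverts H)" using bij_betw_trans[OF L.labels h] .
  have fr: "f u \<in> {0..<n}" if "u \<in> verts G" for u using that L.labels by (auto simp: bij_betw_def)
  have "parcs H = (\<lambda>(u, v). ((h \<circ> f) u, (h \<circ> f) v)) ` arcs_ends G"
  proof (intro subset_antisym subsetI)
    fix e assume "e \<in> parcs H"
    then obtain x y where e: "e = (x, y)" "x \<in> pverts H" "y \<in> pverts H" "P (g y - g x)" unfolding H by blast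
    obtain u v where uv: "u \<in> verts G" "v \<in> verts G" "x = (h \<circ> f) u" "y = (h \<circ> f) v"
      using e(2,3) bij unfolding bij_betw_def by blast
    have "P (f v - f u)" using e(4) uv fr gh by simp
    then have "u \<rightarrow>\<^bsub>G\<^esub> v" using L.arcs_iff uv by blast
    then show "e \<in> (\<lambda>(u, v). ((h \<circ> f) u, (h \<circ> f) v)) ` arcs_ends G" unfolding e(1) uv(3,4) by (rule rev_image_eqI) simp
  next
    fix e assume "e \<in> (\<lambda>(u, v). ((h \<circ> f) u, (h \<circ> f) v)) ` arcs_ends G"
    then obtain u v where e: "u \<rightarrow>\<^bsub>G\<^esub> v" "e = ((h \<circ> f) u, (h \<circ> f) v)" by auto
    then have uv: "u \<in> verts G" "v \<in> verts G" using adj_in_verts by blast+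
    then have "P (f v - f u)" using L.arcs_iff e(1) by blast
    then have "P (g (h (f v)) - g (h (f u)))" using gh fr uv by simp
    then show "e \<in> parcs H" unfolding H e(2) using bij uv by (auto simp: bij_betw_def)
  qed
  then show "digraph_iso G (with_proj H)" unfolding digraph_iso_with_proj_iff using bij by blast
qed

text \<open>Multiplying the labels by the inverse of \<open>s\<close> divides all steps by
  \<open>s\<close>, so a connection set \<open>s\<close> K becomes K.\<close>

lemma circulant_labelling_scale:
  assumes "circulant_labelling G n f P" and r: "[s * r = 1] (mod n)"
  shows "circulant_labelling G n (\<lambda>v. (r * f v) mod n) (\<lambda>x. P (s * x))"
proof -
  interpret L: circulant_labelling G n f P by fact
  show ?thesis
  proof
    have "[r * s = 1] (mod n)" using r by (simp add: mult.commute)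
    then have "bij_betw (\<lambda>x. (r * x) mod n) {0..<n} {0..<n}" using L.order_pos by (rule bij_betw_mult_mod)
    from bij_betw_trans[OF L.labels this] show "bij_betw (\<lambda>v. (r * f v) mod n) (verts G) {0..<n}"
      by (simp add: comp_def)
    show "P (s * x) = P (s * y)" if "[x = y] (mod n)" for x y
      using cong_scalar_left[OF that] by (rule L.steps_cong)
    fix u v assume uv: "u \<in> verts G" "v \<in> verts G"
    have "[s * (r * x mod n) = x] (mod n)" for x
    proof -
      have "[s * (r * x mod n) = s * (r * x)] (mod n)" by (intro cong_scalar_left) (simp add: cong_def)
      also have "[s * (r * x) = x] (mod n)" using cong_scalar_right[OF r, of x] by (simp add: mult.assoc)
      finally show ?thesis .
    qed
    then have "[s * ((r * f v) mod n - (r * f u) mod n) = f v - f u] (mod n)"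
      unfolding right_diff_distrib by (intro cong_diff)
    then show "u \<rightarrow>\<^bsub>G\<^esub> v \<longleftrightarrow> P (s * ((r * f v) mod n - (r * f u) mod n))"
      using L.arcs_iff[OF uv] L.steps_cong by blast
  qed (rule L.order_pos)
qed

subsection \<open>The three families and circulant digraphs as labelled digraphs\<close>

lemma (in digraph) cayley_mod_iso_iff:
  assumes k: "k > 0"
  shows "digraph_iso G (with_proj (cayley_digraph (integer_mod_group k) S)) \<longleftrightarrow>
    (\<exists>f. circulant_labelling G (int k) f (\<lambda>z. z mod int k \<in> S))"
proof (rule digraph_iso_labelled_iff[where g = id])
  let ?H = "cayley_digraph (integer_mod_group k) S"
  have car: "carrier (integer_mod_group k) = {0..<int k}" using k by (simp add: carrier_integer_mod_group)
  show "bij_betw id (pverts ?H) {0..<int k}" by (simp add: cayley_digraph_def car)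
  show "parcs ?H = {(x, y). x \<in> pverts ?H \<and> y \<in> pverts ?H \<and> (id y - id x) mod int k \<in> S}"
    using k by (auto simp: cayley_digraph_def car carrier_integer_mod_group mod_add_right_eq)
qed (use k in \<open>auto simp: cong_def\<close>)

lemma (in digraph) directed_circuit_iso_iff:
  assumes k: "k > 0"
  shows "digraph_iso G (with_proj (directed_circuit k)) \<longleftrightarrow>
    (\<exists>f. circulant_labelling G (int k) f (\<lambda>z. [z = 1] (mod int k)))"
proof (rule digraph_iso_labelled_iff[where g = int])
  let ?H = "directed_circuit k"
  show "bij_betw int (pverts ?H) {0..<int k}"
    by (rule bij_betwI[of _ _ _ nat]) (auto simp: directed_circuit_def)
  have "y = (x + 1) mod k \<longleftrightarrow> [int y - int x = 1] (mod int k)" if "y < k" for x y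
  proof -
    have "[int y - int x = 1] (mod int k) \<longleftrightarrow> [int y = int (x + 1)] (mod int k)"
      by (simp add: cong_iff_dvd_diff algebra_simps)
    also have "\<dots> \<longleftrightarrow> [y = x + 1] (mod k)" by (simp only: cong_int_iff)
    also have "\<dots> \<longleftrightarrow> y = (x + 1) mod k" using that by (simp add: cong_def)
    finally show ?thesis by blast
  qed
  moreover have "parcs ?H = {(x, y). x < k \<and> y < k \<and> y = (x + 1) mod k}"
    using k by (auto simp: directed_circuit_def)
  ultimately show "parcs ?H = {(x, y). x \<in> pverts ?H \<and> y \<in> pverts ?H \<and> [int y - int x = 1] (mod int k)}"
    by (auto simp: directed_circuit_def)
qed (use k in \<open>auto simp: cong_def mod_simps\<close>)

lemma (in digraph) circulant_imp_labelling:
  assumes "circulant G" and ne: "verts G \<noteq> {}"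
  shows "\<exists>n f P. circulant_labelling G n f P"
proof -
  obtain H :: "int monoid" and S where H: "group H" "cyclic_group H"
    and iso: "digraph_iso G (with_proj (cayley_digraph H S))"
    using assms(1) unfolding circulant_def by blast
  interpret H: group H by fact
  obtain x where x: "x \<in> carrier H" "carrier H = range (\<lambda>i::int. x [^]\<^bsub>H\<^esub> i)"
    using H(2) H.cyclic_group by blast
  obtain \<phi> where "bij_betw \<phi> (verts G) (pverts (cayley_digraph H S))"
    using iso unfolding digraph_iso_with_proj_iff by blast
  \<comment> \<open>Finiteness of the digraph excludes the infinite cyclic group, so the generator
    \<open>x\<close> has positive order.\<close>
  then have "finite (carrier H)" using bij_betw_finite finite_verts by (fastforce simp: cayley_digraph_def)
  then have ord: "H.ord x \<ge> 1" using H.ord_ge_1 x(1) by blast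
  define n where "n = int (H.ord x)"
  have n: "n > 0" using ord by (simp add: n_def)
  have pow_eq: "x [^]\<^bsub>H\<^esub> i = x [^]\<^bsub>H\<^esub> j \<longleftrightarrow> [i = j] (mod n)" for i j :: int
    using H.int_pow_eq[OF x(1)] by (auto simp: n_def cong_iff_dvd_diff dvd_diff_commute)
  define e where "e i = x [^]\<^bsub>H\<^esub> i" for i :: int
  have e: "bij_betw e {0..<n} (carrier H)"
  proof -
    have "inj_on e {0..<n}" by (rule inj_onI) (simp add: e_def pow_eq cong_def)
    moreover have "e ` {0..<n} = carrier H"
    proof (intro subset_antisym subsetI)
      fix y assume "y \<in> carrier H"
      then obtain i where "y = x [^]\<^bsub>H\<^esub> (i::int)" using x(2) by blast
      also have "\<dots> = e (i mod n)" by (simp add: e_def pow_eq cong_def)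
      finally show "y \<in> e ` {0..<n}" using n by auto
    qed (use x in \<open>auto simp: e_def\<close>)
    ultimately show ?thesis by (simp add: bij_betw_def)
  qed
  define g where "g = the_inv_into {0..<n} e"
  have g: "bij_betw g (carrier H) {0..<n}" unfolding g_def using e by (rule bij_betw_the_inv_into)
  have eg: "x [^]\<^bsub>H\<^esub> g y = y" if "y \<in> carrier H" for y
    using f_the_inv_into_f_bij_betw[OF e] that by (simp add: g_def e_def)
  have "digraph_iso G (with_proj (cayley_digraph H S)) \<longleftrightarrow>
    (\<exists>f. circulant_labelling G n f (\<lambda>z. x [^]\<^bsub>H\<^esub> z \<in> S))"
  proof (rule digraph_iso_labelled_iff[OF n])
    show "bij_betw g (pverts (cayley_digraph H S)) {0..<n}" using g by (simp add: cayley_digraph_def)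
    show "x [^]\<^bsub>H\<^esub> i \<in> S \<longleftrightarrow> x [^]\<^bsub>H\<^esub> j \<in> S" if "[i = j] (mod n)" for i j :: int
      using pow_eq that by metis
    have "x [^]\<^bsub>H\<^esub> (g v - g u) = v \<otimes>\<^bsub>H\<^esub> inv\<^bsub>H\<^esub> u" if "u \<in> carrier H" "v \<in> carrier H" for u v
      using H.int_pow_diff[OF x(1), of "g v" "g u"] that by (simp add: eg)
    then show "parcs (cayley_digraph H S) = {(u, v). u \<in> pverts (cayley_digraph H S) \<and>
        v \<in> pverts (cayley_digraph H S) \<and> x [^]\<^bsub>H\<^esub> (g v - g u) \<in> S}"
      by (auto simp: cayley_digraph_def)
  qed
  then show ?thesis using iso by blast
qed

text \<open>The step 1 alone generates Z_n, and \<open>s\<close> is the witness of asymmetry that a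
  connection set must have.\<close>

lemma circulant_of_labelling:
  assumes L: "circulant_labelling G n f P" and n: "n > 1" and one: "P 1" and ns: "P s" "\<not> P (- s)"
  shows "circulant G"
proof -
  interpret circulant_labelling G n f P by fact
  define k where "k = nat n"
  have k: "k > 0" "int k = n" using n by (simp_all add: k_def)
  let ?H = "integer_mod_group k"
  interpret H: group ?H by simp
  have car: "carrier ?H = {0..<n}" using k by (simp add: carrier_integer_mod_group)
  define S where "S = {z \<in> {0..<n}. P z}"
  have P_mod: "P (z mod n) \<longleftrightarrow> P z" for z by (rule steps_cong) (simp add: cong_def)
  have gen: "generate ?H {1} = carrier ?H"
  proof -
    have 1: "1 \<in> carrier ?H" using n by (simp add: car)
    have "generate ?H {1} = {1 [^]\<^bsub>?H\<^esub> i | i::int. i \<in> UNIV}" using 1 by (rule H.generate_pow)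
    also have "\<dots> = range (\<lambda>i::int. i mod n)" unfolding int_pow_integer_mod_group k by auto
    also have "\<dots> = carrier ?H"
    proof (intro subset_antisym subsetI)
      fix x assume "x \<in> carrier ?H"
      then have "x = x mod n" by (simp add: car)
      then show "x \<in> range (\<lambda>i::int. i mod n)" by blast
    qed (use n in \<open>auto simp: car\<close>)
    finally show ?thesis .
  qed
  have "(\<lambda>z. z mod int k \<in> S) = P"
    using order_pos by (auto simp: S_def k P_mod)
  then have "digraph_iso G (with_proj (cayley_digraph ?H S))"
    using cayley_mod_iso_iff[OF k(1)] L k(2) by auto
  moreover have "cyclic_group ?H"
  proof -
    have "subgroup_generated ?H {1} = ?H"
      using gen n by (auto simp: subgroup_generated_def car intro!: monoid.equality)
    then show ?thesis unfolding H.cyclic_group_alt by blast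
  qed
  moreover have "cayley_connection_set ?H S"
    unfolding cayley_connection_set_def
  proof (intro conjI)
    show "S \<subseteq> carrier ?H - {\<one>\<^bsub>?H\<^esub>}" using no_zero_step by (auto simp: S_def car)
    then have "generate ?H S \<subseteq> carrier ?H" by (intro H.generate_incl) auto
    moreover have "{1} \<subseteq> S" using n one by (simp add: S_def)
    then have "generate ?H {1} \<subseteq> generate ?H S" by (rule H.mono_generate)
    ultimately show "generate ?H S = carrier ?H" using gen by blast
    have "s mod n \<in> S" using ns P_mod order_pos by (simp add: S_def)
    moreover have "inv\<^bsub>?H\<^esub> (s mod n) = (- s) mod n"
      using order_pos by (simp add: car k mod_minus_eq)
    ultimately show "\<exists>s\<in>S. inv\<^bsub>?H\<^esub> s \<notin> S" using ns P_mod by (metis (mono_tags, lifting) S_def mem_Collect_eq)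
  qed
  ultimately show ?thesis unfolding circulant_def using H.group_axioms by blast
qed

subsection \<open>Powers of a primitive element\<close>

locale primitive_root_mod =
  fixes p :: nat and \<alpha> :: int
  assumes p: "prime p" and odd_p: "odd p"
    and alpha: "\<not> int p dvd \<alpha>"
    and gen: "\<And>x. \<not> int p dvd x \<Longrightarrow> \<exists>i. [x = \<alpha> ^ i] (mod int p)"
begin

definition e where "e = (p - 1) div 2"

lemma two_e: "2 * e = p - 1" "e > 0"
proof -
  have "p \<ge> 3" using odd_p prime_ge_2_nat[OF p] by (cases "p = 2") auto
  then show "2 * e = p - 1" "e > 0" using odd_p by (auto simp: e_def)
qed

text \<open>By Fermat's theorem this power is a square root of 1. It is not 1, as otherwise the
  powers of \<alpha> would take at most \<open>e\<close> of the \<open>2 * e\<close> nonzero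
  values.\<close>

lemma power_e: "[\<alpha> ^ e = - 1] (mod int p)"
proof -
  have pi: "prime (int p)" using p by simp
  have "[\<alpha> ^ (2 * e) = 1] (mod int p)" using fermat_int[OF pi alpha] two_e by simp
  moreover have "\<alpha> ^ (2 * e) - 1 = (\<alpha> ^ e - 1) * (\<alpha> ^ e - - 1)"
    unfolding mult_2 power_add by (simp add: algebra_simps)
  ultimately have "int p dvd (\<alpha> ^ e - 1) * (\<alpha> ^ e - - 1)" by (simp only: cong_iff_dvd_diff)
  then have "int p dvd \<alpha> ^ e - 1 \<or> int p dvd \<alpha> ^ e - - 1" using pi by (simp only: prime_dvd_mult_iff)
  moreover have "\<not> int p dvd \<alpha> ^ e - 1"
  proof
    assume "int p dvd \<alpha> ^ e - 1"
    then have e1: "[\<alpha> ^ e = 1] (mod int p)" by (simp add: cong_iff_dvd_diff)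
    have "{1..<int p} \<subseteq> (\<lambda>i. \<alpha> ^ i mod int p) ` {..<e}"
    proof
      fix x assume x: "x \<in> {1..<int p}"
      then have "\<not> int p dvd x" by (auto dest: zdvd_imp_le)
      then obtain i where i: "[x = \<alpha> ^ i] (mod int p)" using gen by blast
      have "\<alpha> ^ i = (\<alpha> ^ e) ^ (i div e) * \<alpha> ^ (i mod e)"
        by (simp add: power_mult[symmetric] power_add[symmetric])
      moreover have "[(\<alpha> ^ e) ^ (i div e) * \<alpha> ^ (i mod e) = 1 ^ (i div e) * \<alpha> ^ (i mod e)] (mod int p)"
        by (intro cong_scalar_right cong_pow e1)
      ultimately have "[x = \<alpha> ^ (i mod e)] (mod int p)" using i cong_trans by fastforce
      then have "x = \<alpha> ^ (i mod e) mod int p" using x by (simp add: cong_def)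
      then show "x \<in> (\<lambda>i. \<alpha> ^ i mod int p) ` {..<e}" using two_e(2) by auto
    qed
    then have "card {1..<int p} \<le> card {..<e}" by (meson card_image_le card_mono finite_imageI finite_lessThan le_trans)
    then show False using two_e by simp
  qed
  ultimately show ?thesis unfolding cong_iff_dvd_diff by blast
qed

definition even_power :: "int \<Rightarrow> bool" where
  "even_power z \<longleftrightarrow> (\<exists>i. [z = \<alpha> ^ (2 * i)] (mod int p))"

lemma even_power_1: "even_power 1"
  by (auto simp: even_power_def intro!: exI[of _ 0])

lemma even_power_mult: "even_power x \<Longrightarrow> even_power y \<Longrightarrow> even_power (x * y)"
proof -
  assume "even_power x" "even_power y"
  then obtain i j where "[x = \<alpha> ^ (2 * i)] (mod int p)" "[y = \<alpha> ^ (2 * j)] (mod int p)"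
    unfolding even_power_def by blast
  then have "[x * y = \<alpha> ^ (2 * (i + j))] (mod int p)"
    unfolding distrib_left power_add by (rule cong_mult)
  then show "even_power (x * y)" unfolding even_power_def by blast
qed

lemma not_dvd_power: "\<not> int p dvd \<alpha> ^ i"
  using alpha p prime_dvd_power[of "int p" \<alpha> i] by auto

text \<open>For these primes \<open>e\<close> is odd, so - 1 is an odd power and negation exchanges
  even and odd powers. The odd powers in the definition of the Paley digraph thereby become even
  powers once differences are taken in the other direction.\<close>

lemma uminus_odd_power_iff:
  assumes "[p = 3] (mod 4)"
  shows "(\<exists>i. [- z = \<alpha> ^ (2 * i + 1)] (mod int p)) \<longleftrightarrow> even_power z"
proof -
  have "odd e"
  proof -
    have "p mod 4 = 3" using assms by (simp add: cong_def)
    then obtain q where "p = 4 * q + 3" by (metis mult_div_mod_eq)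
    then have "e = 2 * q + 1" unfolding e_def by linarith
    then show ?thesis by simp
  qed
  then obtain h where h: "e = 2 * h + 1" by (elim oddE)
  have neg: "[- z = \<alpha> ^ i * \<alpha> ^ e] (mod int p)" if "[z = \<alpha> ^ i] (mod int p)" for z i
    using cong_mult[OF that cong_sym[OF power_e]] by simp
  show ?thesis
  proof
    assume "\<exists>i. [- z = \<alpha> ^ (2 * i + 1)] (mod int p)"
    then obtain i where "[- z = \<alpha> ^ (2 * i + 1)] (mod int p)" by blast
    from neg[OF this] have "[z = \<alpha> ^ (2 * (i + h + 1))] (mod int p)"
      by (simp add: power_add[symmetric] h algebra_simps)
    then show "even_power z" unfolding even_power_def by blast
  next
    assume "even_power z"
    then obtain i where "[z = \<alpha> ^ (2 * i)] (mod int p)" unfolding even_power_def by blast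
    from neg[OF this] have "[- z = \<alpha> ^ (2 * (i + h) + 1)] (mod int p)"
      by (simp add: power_add[symmetric] h algebra_simps)
    then show "\<exists>i. [- z = \<alpha> ^ (2 * i + 1)] (mod int p)" by blast
  qed
qed

lemma even_power_or_uminus:
  assumes "[p = 3] (mod 4)" "\<not> int p dvd z" shows "even_power z \<or> even_power (- z)"
proof -
  obtain i where i: "[z = \<alpha> ^ i] (mod int p)" using gen assms(2) by blast
  show ?thesis
  proof (cases "even i")
    case True
    then show ?thesis using i unfolding even_power_def by (metis evenE)
  next
    case False
    then have "\<exists>i. [- (- z) = \<alpha> ^ (2 * i + 1)] (mod int p)" using i by (metis minus_minus oddE)
    then show ?thesis using uminus_odd_power_iff[OF assms(1)] by blast
  qed
qed

text \<open>A multiplicatively closed set of units that contains exactly one of each pair \<open>x, - x\<close> is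
  the set of even powers: it contains the squares, and it does not contain \<open>\<alpha>\<close>.\<close>
lemma half_units_even_power:
  assumes cong: "\<And>x y. [x = y] (mod int p) \<Longrightarrow> K x \<longleftrightarrow> K y"
    and mult: "\<And>x y. K x \<Longrightarrow> K y \<Longrightarrow> K (x * y)"
    and half: "\<And>x. int p dvd x \<or> K x \<or> K (- x)"
    and zero: "\<And>x. K x \<Longrightarrow> \<not> int p dvd x" and minus: "\<not> K (- 1)"
  shows "K x \<longleftrightarrow> even_power x" "[p = 3] (mod 4)"
proof -
  have sq: "K (x * x)" if "\<not> int p dvd x" for x
    using half[of x] that mult[of x x] mult[of "- x" "- x"] by auto
  have ep: "K x" if x: "even_power x" for x
  proof -
    obtain i where i: "[x = \<alpha> ^ (2 * i)] (mod int p)" using x unfolding even_power_def by blast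
    have "K (\<alpha> ^ i * \<alpha> ^ i)" by (rule sq[OF not_dvd_power])
    then show ?thesis using cong[OF i] by (simp add: mult_2 power_add)
  qed
  have 1: "K 1" by (rule ep[OF even_power_1])
  have na: "\<not> K \<alpha>"
  proof
    assume a: "K \<alpha>"
    have "K (\<alpha> ^ i)" for i by (induction i) (use 1 a mult in auto)
    then show False using minus cong[OF power_e] by blast
  qed
  have odd: "\<not> K (\<alpha> ^ (2 * i + 1))" for i
  proof
    assume k: "K (\<alpha> ^ (2 * i + 1))"
    obtain r where r: "[\<alpha> ^ i * r = 1] (mod int p)"
      using prime_inverse_mod[of "int p" "\<alpha> ^ i"] not_dvd_power p by auto
    then have "\<not> int p dvd r" using 1 zero cong_dvd_iff by (metis dvd_mult)
    then have "K (\<alpha> ^ (2 * i + 1) * (r * r))" using mult k sq by blast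
    moreover have "[\<alpha> ^ (2 * i + 1) * (r * r) = \<alpha>] (mod int p)"
    proof -
      have "[(\<alpha> ^ i * r) * (\<alpha> ^ i * r) * \<alpha> = 1 * 1 * \<alpha>] (mod int p)"
        by (intro cong_mult r cong_refl)
      moreover have "(\<alpha> ^ i * r) * (\<alpha> ^ i * r) * \<alpha> = \<alpha> ^ (2 * i + 1) * (r * r)"
        unfolding mult_2 power_add by (simp add: algebra_simps)
      ultimately show ?thesis by simp
    qed
    ultimately show False using na cong by blast
  qed
  show "K x \<longleftrightarrow> even_power x"
  proof
    assume x: "K x"
    obtain i where i: "[x = \<alpha> ^ i] (mod int p)" using gen zero[OF x] by blast
    have "even i"
    proof (rule ccontr)
      assume "odd i"
      then obtain j where "i = 2 * j + 1" by (elim oddE)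
      then show False using odd[of j] x cong[OF i] by simp
    qed
    then show "even_power x" using i unfolding even_power_def by (metis evenE)
  qed (rule ep)
  have "odd e"
  proof
    assume "even e"
    then have "even_power (- 1)" using cong_sym[OF power_e] unfolding even_power_def by (metis evenE)
    then show False using ep minus by blast
  qed
  then obtain h where "e = 2 * h + 1" by (elim oddE)
  then have "p = 4 * h + 3" using two_e(1) prime_gt_1_nat[OF p] by simp
  then show "[p = 3] (mod 4)" by (simp add: cong_def)
qed

end

text \<open>In a finite group a cyclic subgroup consists of powers with natural exponents, so
  statements about generated subgroups become congruences between integer powers.\<close>

lemma primitive_element_iff:
  assumes p: "prime p"
  shows "primitive_element (residue_ring (int p)) \<alpha> \<longleftrightarrow>
    \<alpha> \<in> {1..<int p} \<and> (\<forall>x. \<not> int p dvd x \<longrightarrow> (\<exists>i. [x = \<alpha> ^ i] (mod int p)))"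
    (is "?L \<longleftrightarrow> ?R")
  and primitive_element_exists: "\<exists>\<alpha>. primitive_element (residue_ring (int p)) \<alpha>"
  and paley_set: "primitive_element (residue_ring (int p)) \<beta> \<Longrightarrow> w \<in> {0..<int p} \<Longrightarrow>
    w \<in> \<beta> <#\<^bsub>mult_of (residue_ring (int p))\<^esub> generate (mult_of (residue_ring (int p))) {\<beta> [^]\<^bsub>mult_of (residue_ring (int p))\<^esub> (2::nat)}
    \<longleftrightarrow> (\<exists>i. [w = \<beta> ^ (2 * i + 1)] (mod int p))"
proof -
  let ?M = "mult_of (residue_ring (int p))"
  interpret R: residues_prime p "residue_ring (int p)" by (simp add: residues_prime_def p)
  interpret M: group ?M by (rule R.field_mult_group)
  have car: "carrier ?M = {1..<int p}" by (auto simp: R.res_carrier_eq R.res_zero_eq)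
  have pow: "x [^]\<^bsub>?M\<^esub> i = x ^ i mod int p" if "x \<in> carrier ?M" for x and i :: nat
    using that R.pow_cong[of x i] unfolding car nat_pow_mult_of by simp
  have fin: "finite (carrier ?M)" by (simp add: car)
  have gen: "generate ?M {x} = {x ^ i mod int p | i. True}" if "x \<in> carrier ?M" for x
    using M.generate_pow_on_finite_carrier[OF fin that] pow[OF that] by auto
  show iff: "?L \<longleftrightarrow> ?R"
  proof
    assume ?L
    then have a: "\<alpha> \<in> carrier ?M" "generate ?M {\<alpha>} = carrier ?M" by (simp_all add: primitive_element_def)
    have "\<exists>i. [x = \<alpha> ^ i] (mod int p)" if "\<not> int p dvd x" for x
    proof -
      have "x mod int p \<in> {1..<int p}" using that prime_gt_0_nat[OF p]
        by (simp add: dvd_eq_mod_eq_0) (metis int_one_le_iff_zero_less of_nat_0_less_iff order_le_less pos_mod_sign)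
      then have "x mod int p \<in> {\<alpha> ^ i mod int p | i. True}" using a(2) gen[OF a(1)] car by metis
      then show ?thesis by (auto simp: cong_def)
    qed
    then show ?R using a(1) car by blast
  next
    assume R: ?R
    then have a: "\<alpha> \<in> carrier ?M" using car by blast
    have "carrier ?M \<subseteq> generate ?M {\<alpha>}"
    proof
      fix x assume x: "x \<in> carrier ?M"
      then have "\<not> int p dvd x" unfolding car by (auto dest: zdvd_imp_le)
      then obtain i where "[x = \<alpha> ^ i] (mod int p)" using R by blast
      then have "x = \<alpha> ^ i mod int p" using x unfolding car by (simp add: cong_def)
      then show "x \<in> generate ?M {\<alpha>}" unfolding gen[OF a] by blast
    qed
    moreover have "generate ?M {\<alpha>} \<subseteq> carrier ?M" using a by (intro M.generate_incl) simp
    ultimately show ?L using a unfolding primitive_element_def by blast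
  qed
  obtain g where g: "g \<in> carrier ?M" "carrier ?M = {g [^]\<^bsub>residue_ring (int p)\<^esub> i | i::nat. i \<in> UNIV}"
    using R.finite_field_mult_group_has_gen by blast
  then have "generate ?M {g} = carrier ?M"
    using M.generate_pow_on_finite_carrier[OF fin g(1)] g(2) unfolding nat_pow_mult_of by argo
  then have "primitive_element (residue_ring (int p)) g" using g(1) by (simp only: primitive_element_def)
  then show "\<exists>\<alpha>. primitive_element (residue_ring (int p)) \<alpha>" by blast
  assume b: "primitive_element (residue_ring (int p)) \<beta>" and w: "w \<in> {0..<int p}"
  have bc: "\<beta> \<in> carrier ?M" using b by (simp add: primitive_element_def)
  have b2: "\<beta> [^]\<^bsub>?M\<^esub> (2::nat) \<in> carrier ?M" using bc by (rule M.nat_pow_closed)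
  have gen2: "generate ?M {\<beta> [^]\<^bsub>?M\<^esub> (2::nat)} = {(\<beta> ^ 2 mod int p) ^ i mod int p | i. True}"
    using gen[OF b2] by (simp only: pow[OF bc])
  have "\<beta> <#\<^bsub>?M\<^esub> generate ?M {\<beta> [^]\<^bsub>?M\<^esub> (2::nat)} = {(\<beta> * (\<beta> ^ 2 mod int p) ^ i mod int p) mod int p | i. True}"
    unfolding gen2 l_coset_def by (auto simp: R.res_mult_eq mod_mult_right_eq)
  also have "\<dots> = {\<beta> ^ (2 * i + 1) mod int p | i. True}"
  proof -
    have "(\<beta> * (\<beta> ^ 2 mod int p) ^ i mod int p) mod int p = \<beta> ^ (2 * i + 1) mod int p" for i
    proof -
      have "[\<beta> * (\<beta> ^ 2 mod int p) ^ i = \<beta> * (\<beta> ^ 2) ^ i] (mod int p)"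
        by (intro cong_scalar_left cong_pow) (simp add: cong_def)
      then show ?thesis by (simp add: cong_def power_mult)
    qed
    then show ?thesis by simp
  qed
  finally show "w \<in> \<beta> <#\<^bsub>?M\<^esub> generate ?M {\<beta> [^]\<^bsub>?M\<^esub> (2::nat)} \<longleftrightarrow> (\<exists>i. [w = \<beta> ^ (2 * i + 1)] (mod int p))"
    using w by (auto simp: cong_def)
qed

text \<open>The sign arises because Paley arcs are given by tail minus head, labellings by head
  minus tail.\<close>

lemma (in digraph) paley_iso_iff:
  assumes p: "prime p" and a: "primitive_element (residue_ring (int p)) \<alpha>"
  shows "digraph_iso G (with_proj (paley_digraph (residue_ring (int p)) \<alpha>)) \<longleftrightarrow>
    (\<exists>f. circulant_labelling G (int p) f (\<lambda>z. \<exists>i. [- z = \<alpha> ^ (2 * i + 1)] (mod int p)))"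
proof (rule digraph_iso_labelled_iff[where g = id])
  let ?H = "paley_digraph (residue_ring (int p)) \<alpha>"
  interpret R: residues_prime p "residue_ring (int p)" by (simp add: residues_prime_def p)
  have car: "carrier (residue_ring (int p)) = {0..<int p}" by (auto simp: R.res_carrier_eq)
  show "int p > 0" using prime_gt_0_nat[OF p] by simp
  show "bij_betw id (pverts ?H) {0..<int p}" by (simp add: paley_digraph_def car)
  show "(\<exists>i. [- x = \<alpha> ^ (2 * i + 1)] (mod int p)) = (\<exists>i. [- y = \<alpha> ^ (2 * i + 1)] (mod int p))"
    if "[x = y] (mod int p)" for x y
  proof -
    have "[- x = - y] (mod int p)" using that by (simp only: cong_minus_minus_iff)
    then show ?thesis by (meson cong_sym cong_trans)
  qed
  have "x \<ominus>\<^bsub>residue_ring (int p)\<^esub> y = (x - y) mod int p" for x y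
    by (simp add: a_minus_def R.res_add_eq R.res_neg_eq mod_add_right_eq)
  moreover have "[(x - y) mod int p = \<alpha> ^ k] (mod int p) \<longleftrightarrow> [- (y - x) = \<alpha> ^ k] (mod int p)" for x y k
    by (simp add: cong_def)
  moreover have "(x - y) mod int p \<in> {0..<int p}" for x y using prime_gt_0_nat[OF p] by simp
  ultimately show "parcs ?H = {(x, y). x \<in> pverts ?H \<and> y \<in> pverts ?H \<and> (\<exists>i. [- (id y - id x) = \<alpha> ^ (2 * i + 1)] (mod int p))}"
    using paley_set[OF p a] by (auto simp: paley_digraph_def car)
qed

lemma (in digraph) circulant_labelling_asymmetric:
  assumes "circulant_labelling G n f P" shows "\<not> symmetric G \<longleftrightarrow> (\<exists>s. P s \<and> \<not> P (- s))"
proof -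
  interpret L: circulant_labelling G n f P by fact
  show ?thesis
  proof
    assume "\<not> symmetric G"
    then obtain u v where uv: "u \<rightarrow>\<^bsub>G\<^esub> v" "\<not> v \<rightarrow>\<^bsub>G\<^esub> u" unfolding symmetric_def sym_def by blast
    then have "u \<in> verts G" "v \<in> verts G" using adj_in_verts by blast+
    then have "P (f v - f u)" "\<not> P (- (f v - f u))" using uv L.arcs_iff by simp_all
    then show "\<exists>s. P s \<and> \<not> P (- s)" by blast
  next
    assume "\<exists>s. P s \<and> \<not> P (- s)"
    then obtain s where s: "P s" "\<not> P (- s)" by blast
    obtain u where u: "u \<in> verts G" "[f u = 0] (mod n)" using L.vertex_with_label by blast
    obtain v where v: "v \<in> verts G" "[f v = s] (mod n)" using L.vertex_with_label by blast
    have "[f v - f u = s] (mod n)" "[f u - f v = - s] (mod n)"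
      using cong_diff[OF v(2) u(2)] cong_diff[OF u(2) v(2)] by simp_all
    then have "u \<rightarrow>\<^bsub>G\<^esub> v" "\<not> v \<rightarrow>\<^bsub>G\<^esub> u" using L.arcs_iff L.steps_cong u(1) v(1) s by blast+
    then show "\<not> symmetric G" unfolding symmetric_def sym_def by blast
  qed
qed

section \<open>The three families are primitive and weakly distance-regular\<close>

text \<open>Exactly the residue of \<open>k\<close> is reached in \<open>k\<close> steps, so the
  distance determines the residue and all classes are singletons.\<close>

lemma primitive_wdr_circuit:
  assumes "circulant_labelling G n f (\<lambda>z. [z = 1] (mod n))" and "prime n"
  shows "weakly_distance_regular G" "primitive_digraph G"
proof -
  interpret connected_labelling G n f "\<lambda>z. [z = 1] (mod n)"
    by (rule connected_labelling_of_one[OF assms(1)]) simp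
  have reach_iff: "reach k z \<longleftrightarrow> [z = int k] (mod n)" for k z
  proof (induction k arbitrary: z)
    case (Suc k)
    show ?case
    proof
      assume "reach (Suc k) z"
      then obtain s where s: "[s = 1] (mod n)" "[z - s = int k] (mod n)" using Suc by auto
      show "[z = int (Suc k)] (mod n)" using cong_add[OF s(2) s(1)] by (simp add: add.commute)
    next
      assume "[z = int (Suc k)] (mod n)"
      then have "[z - 1 = int k] (mod n)" using cong_diff[OF _ cong_refl, of z "int (Suc k)" n 1] by simp
      then show "reach (Suc k) z" using Suc by (auto intro!: exI[of _ 1])
    qed
  qed (simp add: cong_0_iff)
  have eq: "[z = z'] (mod n)" if "z \<simeq> z'" for z z'
    using reach_dist[of z] reach_dist[of z'] that unfolding reach_iff eqv_def by (metis cong_sym cong_trans)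
  have mult: "[x * y = 1] (mod n)" if "[x = 1] (mod n)" "[y = 1] (mod n)" for x y
    using cong_mult[OF that] by simp
  have cosets: "\<exists>c k k'. [k = 1] (mod n) \<and> [k' = 1] (mod n) \<and> [z = c * k] (mod n) \<and> [z' = c * k'] (mod n)"
    if "z \<simeq> z'" "\<not> n dvd z" for z z'
    by (intro exI[of _ z] exI[of _ 1]) (simp add: cong_sym[OF eq[OF that(1)]])
  show "weakly_distance_regular G" "primitive_digraph G"
    using primitive_wdr_of_unit_group[OF assms cong_refl mult cosets] by blast+
qed

text \<open>Even powers and their negatives cover all nonzero residues, so \<open>dist z = 1\<close>
  and \<open>dist (- z) = 1\<close> already separate the two cosets.\<close>

lemma (in primitive_root_mod) primitive_wdr_paley:
  assumes L: "circulant_labelling G (int p) f even_power" and 3: "[p = 3] (mod 4)"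
  shows "weakly_distance_regular G" "primitive_digraph G"
proof -
  interpret connected_labelling G "int p" f even_power
    by (rule connected_labelling_of_one[OF L even_power_1])
  have cosets: "\<exists>c k k'. even_power k \<and> even_power k' \<and> [z = c * k] (mod int p) \<and> [z' = c * k'] (mod int p)"
    if zz: "z \<simeq> z'" and nd: "\<not> int p dvd z" for z z'
  proof -
    have "dist z = dist z'" "dist (- z) = dist (- z')" using zz unfolding eqv_def by blast+
    then have "even_power z \<longleftrightarrow> even_power z'" "even_power (- z) \<longleftrightarrow> even_power (- z')"
      using dist_eq_1_iff_step[of z] dist_eq_1_iff_step[of z'] dist_eq_1_iff_step[of "- z"] dist_eq_1_iff_step[of "- z'"]
      by argo+
    moreover have "even_power z \<or> even_power (- z)" using even_power_or_uminus[OF 3 nd] .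
    ultimately consider "even_power z" "even_power z'" | "even_power (- z)" "even_power (- z')" by blast
    then show ?thesis
    proof cases
      case 1 then show ?thesis by (intro exI[of _ 1] exI[of _ z] exI[of _ z']) simp
    next
      case 2 then show ?thesis by (intro exI[of _ "- 1"] exI[of _ "- z"] exI[of _ "- z'"]) simp
    qed
  qed
  have "prime (int p)" using p by simp
  then show "weakly_distance_regular G" "primitive_digraph G"
    using primitive_wdr_of_unit_group[OF L _ even_power_1 even_power_mult cosets] by blast+
qed

text \<open>The cosets of K = {1, 3, 9} are K, - K = {4, 10, 12}, 2 K = {2, 5, 6} and - 2 K = {7, 8,
  11}. The conditions \<open>dist z = 1\<close>, \<open>dist (- z) = 1\<close> and
  \<open>dist z = 2\<close> tell them apart.\<close>

lemma primitive_wdr_13: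
  assumes L: "circulant_labelling G 13 f (\<lambda>z. z mod 13 \<in> {1, 3, 9})"
  shows "weakly_distance_regular G" "primitive_digraph G"
proof -
  interpret connected_labelling G 13 f "\<lambda>z. z mod 13 \<in> {1, 3, 9}"
    by (rule connected_labelling_of_one[OF L]) simp
  let ?P = "\<lambda>z::int. z mod 13 \<in> {1, 3, 9}"
  have mult: "?P (x * y)" if "?P x" "?P y" for x y
  proof -
    have "(x * y) mod 13 = ((x mod 13) * (y mod 13)) mod 13" by (simp add: mod_mult_eq)
    then show ?thesis using that by auto
  qed
  have two: "dist z = 2" if "z mod 13 \<in> {2, 5, 6}" for z
  proof -
    \<comment> \<open>These residues are doubles of steps: 2 = 1 + 1, 5 = 9 + 9 and 6 = 3 + 3 modulo
      13.\<close>
    have "\<exists>s. ?P s \<and> ?P (z - s)"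
    proof -
      have *: "(z - s) mod 13 = (z mod 13 - s) mod 13" for s by (simp add: mod_diff_left_eq)
      from \<open>z mod 13 \<in> {2, 5, 6}\<close> consider "z mod 13 = 2" | "z mod 13 = 5" | "z mod 13 = 6" by blast
      then show ?thesis
      proof cases
        case 1 then show ?thesis by (intro exI[of _ 1]) (simp add: *)
      next
        case 2 then show ?thesis by (intro exI[of _ 9]) (simp add: *)
      next
        case 3 then show ?thesis by (intro exI[of _ 3]) (simp add: *)
      qed
    qed
    then have "reach 2 z" unfolding numeral_2_eq_2 reach.simps(2)[of "Suc 0"] using reach_1_iff by simp
    then have "dist z \<le> 2" by (rule dist_le)
    moreover have "dist z \<noteq> 1" using that unfolding dist_eq_1_iff_step by auto
    moreover have "dist z \<noteq> 0" using that unfolding dist_0_iff by (auto simp: dvd_eq_mod_eq_0)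
    ultimately show ?thesis by linarith
  qed
  have not_two: "dist z \<noteq> 2" if z: "z mod 13 \<in> {7, 8, 11}" for z
  proof
    assume "dist z = 2"
    then obtain s where s: "dist s = 1" "dist (z - s) = 1" using dist_step[of z 1] by auto
    have "z mod 13 = (s mod 13 + (z - s) mod 13) mod 13" by (simp add: mod_add_eq)
    then show False using s z unfolding dist_eq_1_iff_step by auto
  qed
  have neg: "(- z) mod 13 = (13 - z mod 13) mod 13" for z :: int
    using mod_add_self1[of 13 "- z"] mod_diff_right_eq[of 13 z 13] by simp
  have cls: "z mod 13 \<in> {1, 3, 9} \<and> dist z = 1 \<or>
      z mod 13 \<in> {4, 10, 12} \<and> dist z \<noteq> 1 \<and> dist (- z) = 1 \<or>
      z mod 13 \<in> {2, 5, 6} \<and> dist z \<noteq> 1 \<and> dist z = 2 \<and> dist (- z) \<noteq> 1 \<or>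
      z mod 13 \<in> {7, 8, 11} \<and> dist z \<noteq> 1 \<and> dist z \<noteq> 2 \<and> dist (- z) \<noteq> 1" if nd: "\<not> 13 dvd z" for z
  proof -
    have "0 \<le> z mod 13" "z mod 13 < 13" "z mod 13 \<noteq> 0" using nd by (simp_all add: dvd_eq_mod_eq_0)
    then have "z mod 13 \<in> {1, 3, 9} \<or> z mod 13 \<in> {4, 10, 12} \<or> z mod 13 \<in> {2, 5, 6} \<or> z mod 13 \<in> {7, 8, 11}"
      unfolding insert_iff empty_iff by presburger
    then show ?thesis
    proof (elim disjE)
      assume "z mod 13 \<in> {1, 3, 9}" then show ?thesis unfolding dist_eq_1_iff_step by blast
    next
      assume h: "z mod 13 \<in> {4, 10, 12}"
      then have "\<not> ?P z" "?P (- z)" unfolding neg by auto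
      then show ?thesis using h dist_eq_1_iff_step by blast
    next
      assume h: "z mod 13 \<in> {2, 5, 6}"
      then have "\<not> ?P z" "\<not> ?P (- z)" unfolding neg by auto
      then show ?thesis using h two dist_eq_1_iff_step by blast
    next
      assume h: "z mod 13 \<in> {7, 8, 11}"
      then have "\<not> ?P z" "\<not> ?P (- z)" unfolding neg by auto
      then show ?thesis using h not_two dist_eq_1_iff_step by blast
    qed
  qed
  have cosets: "\<exists>c k k'. ?P k \<and> ?P k' \<and> [z = c * k] (mod 13) \<and> [z' = c * k'] (mod 13)"
    if zz: "z \<simeq> z'" and nd: "\<not> 13 dvd z" for z z'
  proof -
    have nd': "\<not> 13 dvd z'" using nd eqv_dvd_iff[OF zz] by simp
    have eq: "dist z = dist z'" "dist (- z) = dist (- z')" using zz unfolding eqv_def by blast+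
    have in_coset: "\<exists>k. ?P k \<and> [x = c * k] (mod 13)"
      if "x mod 13 \<in> {c mod 13, (c * 3) mod 13, (c * 9) mod 13}" for x c :: int
    proof -
      from that consider "x mod 13 = (c * 1) mod 13" | "x mod 13 = (c * 3) mod 13" | "x mod 13 = (c * 9) mod 13" by auto
      then show ?thesis
      proof cases
        case 1 then show ?thesis by (intro exI[of _ 1]) (simp add: cong_def)
      next
        case 2 then show ?thesis by (intro exI[of _ 3]) (simp add: cong_def)
      next
        case 3 then show ?thesis by (intro exI[of _ 9]) (simp add: cong_def)
      qed
    qed
    \<comment> \<open>Representatives of K, - K, 2 K and - 2 K, in this order.\<close>
    have "\<exists>c\<in>{1, 4, 2, 7}. z mod 13 \<in> {c mod 13, (c * 3) mod 13, (c * 9) mod 13} \<and> z' mod 13 \<in> {c mod 13, (c * 3) mod 13, (c * 9) mod 13}"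
    proof -
      have "(z mod 13 \<in> {1, 3, 9} \<and> z' mod 13 \<in> {1, 3, 9}) \<or> (z mod 13 \<in> {4, 10, 12} \<and> z' mod 13 \<in> {4, 10, 12}) \<or>
          (z mod 13 \<in> {2, 5, 6} \<and> z' mod 13 \<in> {2, 5, 6}) \<or> (z mod 13 \<in> {7, 8, 11} \<and> z' mod 13 \<in> {7, 8, 11})"
        using cls[OF nd] cls[OF nd'] unfolding eq by blast
      then show ?thesis by (elim disjE) auto
    qed
    then show ?thesis using in_coset by meson
  qed
  show "weakly_distance_regular G" "primitive_digraph G"
    using primitive_wdr_of_unit_group[OF L _ _ mult cosets] by simp_all
qed

section \<open>The characterisation\<close>

theorem theorem1p2:
  fixes G :: "('a, 'b) pre_digraph"
  assumes "digraph G" and "\<not> symmetric G"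
  shows "(primitive_digraph G \<and> weakly_distance_regular G \<and> circulant G) \<longleftrightarrow>
    (\<exists>p::nat. prime p \<and> [p = 3] (mod 4) \<and>
       (\<exists>\<alpha>. primitive_element (residue_ring (int p)) \<alpha> \<and>
          digraph_iso G (with_proj (paley_digraph (residue_ring (int p)) \<alpha>)))) \<or>
    (\<exists>p::nat. prime p \<and> digraph_iso G (with_proj (directed_circuit p))) \<or>
    digraph_iso G (with_proj (cayley_digraph (integer_mod_group 13) {1, 3, 9}))"
    (is "?L \<longleftrightarrow> ?paley \<or> ?circuit \<or> ?cay")
proof
  interpret digraph G by fact
  have root: "primitive_root_mod p \<alpha>" if "prime p" "odd p" "primitive_element (residue_ring (int p)) \<alpha>" for p \<alpha>
    using that primitive_element_iff[OF that(1)] by unfold_locales (auto dest: zdvd_imp_le)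
  {
    assume ?L
    then have prim: "primitive_digraph G" and wdr: "weakly_distance_regular G" and circ: "circulant G" by auto
    have sc: "strongly_connected G" using wdr by (simp add: weakly_distance_regular_def)
    then have "verts G \<noteq> {}" by (simp add: strongly_connected_def)
    then obtain n f P where L: "circulant_labelling G n f P" using circulant_imp_labelling circ by blast
    then interpret L: circulant_labelling G n f P .
    interpret C: connected_labelling G n f P
      by unfold_locales (use sc L.strongly_connected_iff in blast)
    have "\<exists>s. P s \<and> \<not> P (- s)" using assms(2) circulant_labelling_asymmetric[OF L] by blast
    then interpret S: primitive_circulant_scheme n L.dist
      using C.primitive_circulant_schemeI wdr prim by blast
    obtain s where n: "prime n" and s: "P s" "\<not> P (- s)" and
      cases: "(\<forall>x. P (s * x) \<longleftrightarrow> [x = 1] (mod n)) \<or>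
       ((\<forall>x. n dvd x \<or> P (s * x) \<or> P (- (s * x))) \<and>
        (\<forall>x y. P (s * x) \<longrightarrow> P (s * y) \<longrightarrow> P (s * (x * y)))) \<or>
       (n = 13 \<and> (\<forall>x. P (s * x) \<longleftrightarrow> x mod 13 \<in> {1, 3, 9}))"
      using S.connection_set_classification unfolding C.dist_eq_1_iff_step by blast
    have nonzero: "\<not> n dvd x" if "P x" for x
      using that L.no_zero_step L.steps_cong[of x 0] by (auto simp: cong_0_iff)
    obtain r where r: "[s * r = 1] (mod n)" using prime_inverse_mod[OF n nonzero[OF s(1)]] .
    define g where "g v = (r * f v) mod n" for v
    have L': "circulant_labelling G n g (\<lambda>x. P (s * x))"
      unfolding g_def using circulant_labelling_scale[OF L r] .
    define p where "p = nat n"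
    have p: "prime p" "int p = n" "p > 0" using n prime_gt_0_int[OF n] by (simp_all add: p_def)
    consider "\<And>x. P (s * x) \<longleftrightarrow> [x = 1] (mod n)"
      | "\<And>x. n dvd x \<or> P (s * x) \<or> P (- (s * x))" "\<And>x y. P (s * x) \<Longrightarrow> P (s * y) \<Longrightarrow> P (s * (x * y))"
      | "n = 13" "\<And>x. P (s * x) \<longleftrightarrow> x mod 13 \<in> {1, 3, 9}"
      using cases by blast
    then show "?paley \<or> ?circuit \<or> ?cay"
    proof cases
      case 1
      then have "circulant_labelling G (int p) g (\<lambda>x. [x = 1] (mod int p))" using L' by (simp add: p(2))
      then have "digraph_iso G (with_proj (directed_circuit p))" using directed_circuit_iso_iff[OF p(3)] by blast
      then show ?thesis using p(1) by blast
    next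
      case 2
      \<comment> \<open>Any primitive element will do, since K is shown to be the set of even powers
        of whichever is chosen.\<close>
      obtain \<alpha> where a: "primitive_element (residue_ring (int p)) \<alpha>" using primitive_element_exists[OF p(1)] by blast
      have "odd p"
      proof
        assume "even p"
        then have "n = 2" using p primes_dvd_imp_eq[of 2 p] by auto
        then have "[s = - s] (mod n)" by (simp add: cong_iff_dvd_diff)
        then show False using s L.steps_cong by blast
      qed
      interpret R: primitive_root_mod p \<alpha> by (rule root[OF p(1) \<open>odd p\<close> a])
      have cong: "P (s * x) = P (s * y)" if "[x = y] (mod int p)" for x y
        using L.steps_cong[OF cong_scalar_left] that unfolding p(2) .
      have half: "int p dvd x \<or> P (s * x) \<or> P (s * - x)" for x using 2(1)[of x] p(2) by simp
      have zero: "\<not> int p dvd x" if "P (s * x)" for x using nonzero[OF that] p(2) by auto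
      have minus: "\<not> P (s * - 1)" using s(2) by simp
      note K = R.half_units_even_power[where K = "\<lambda>x. P (s * x)", OF cong 2(2) half zero minus]
      have 3: "[p = 3] (mod 4)" by (rule K(2))
      have "(\<lambda>x. P (s * x)) = (\<lambda>z. \<exists>i. [- z = \<alpha> ^ (2 * i + 1)] (mod int p))"
        using K(1) R.uminus_odd_power_iff[OF 3] by auto
      then have "digraph_iso G (with_proj (paley_digraph (residue_ring (int p)) \<alpha>))"
        using paley_iso_iff[OF p(1) a] L' p(2) by auto
      then show ?thesis using p(1) 3 a by blast
    next
      case 3
      then have "circulant_labelling G (int 13) g (\<lambda>x. x mod int 13 \<in> {1, 3, 9})" using L' by simp
      then show ?thesis using cayley_mod_iso_iff[of 13 "{1, 3, 9}"] by auto
    qed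
  }
  {
    assume "?paley \<or> ?circuit \<or> ?cay"
    \<comment> \<open>Each family is a labelling of prime modulus with 1 among its steps, from which
      circulancy follows uniformly.\<close>
    then obtain n f P where L: "circulant_labelling G n f P" and n: "prime n" and one: "P 1"
      and wp: "weakly_distance_regular G" "primitive_digraph G"
    proof (elim disjE)
      assume ?paley
      then obtain p \<alpha> where p: "prime p" "[p = 3] (mod 4)" "primitive_element (residue_ring (int p)) \<alpha>"
        "digraph_iso G (with_proj (paley_digraph (residue_ring (int p)) \<alpha>))" by blast
      have "odd p"
      proof -
        have "p mod 4 = 3" using p(2) by (simp add: cong_def)
        then show ?thesis by presburger
      qed
      interpret R: primitive_root_mod p \<alpha> by (rule root[OF p(1) \<open>odd p\<close> p(3)])
      obtain f where L: "circulant_labelling G (int p) f R.even_power"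
        using p(4) paley_iso_iff[OF p(1,3)] unfolding R.uminus_odd_power_iff[OF p(2)] by blast
      have "prime (int p)" using p(1) by simp
      from that[OF L this R.even_power_1 R.primitive_wdr_paley[OF L p(2)]] show thesis .
    next
      assume ?circuit
      then obtain p where p: "prime p" "digraph_iso G (with_proj (directed_circuit p))" by blast
      then obtain f where L: "circulant_labelling G (int p) f (\<lambda>z. [z = 1] (mod int p))"
        using directed_circuit_iso_iff prime_gt_0_nat by blast
      have n: "prime (int p)" using p(1) by simp
      from that[OF L n cong_refl primitive_wdr_circuit[OF L n]] show thesis .
    next
      assume ?cay
      then obtain f where L: "circulant_labelling G 13 f (\<lambda>z. z mod 13 \<in> {1, 3, 9})"
        using cayley_mod_iso_iff[of 13 "{1, 3, 9}"] by auto
      have n: "prime (13::int)" and one: "1 mod 13 \<in> {1, 3, 9::int}" by simp_all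
      from that[OF L n one primitive_wdr_13[OF L]] show thesis .
    qed
    \<comment> \<open>Asymmetry of \<open>G\<close> enters here; it excludes the circuit of length
      2.\<close>
    obtain s where "P s" "\<not> P (- s)" using assms(2) circulant_labelling_asymmetric[OF L] by blast
    then have "circulant G" using circulant_of_labelling[OF L prime_gt_1_int[OF n] one] by blast
    then show ?L using wp by blast
  }
qed

end
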